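(* Suppose $E=(E_1,\dots,E_g)\in M_d(\mathbb C)^g$ and $B=(B_1,\dots,B_g)\in M_e(\mathbb C)^g$. Assume: (i) $E$ is sv-generic and linearly independent (that is, $\{E_1,\dots,E_g\}$ is linearly independent); (ii) $B$ is sv-generic and $\mathcal D_B$ is bounded; (iii) $p:\mathcal B_E\to\mathcal D_B$ is (free) bianalytic with $p(0)=0$ and $p'(0)=I$; and (iv) $p$ is defined (as a free analytic map) on a free pseudoconvex set containing $\mathcal B_E$, and $q:\mathcal D_B\to\mathcal B_E$, the inverse of $p$, is defined (as a free analytic map) on a free pseudoconvex set containing $\mathcal D_B$. Then $d=e$ and there exist $d\times d$ unitary matrices $Z$ and $M$ and a tuple $\Xi=(\Xi_1,\dots,\Xi_g)\in M_g(\mathbb C)^g$ such that (1) $B=M^*ZEM$, i.e. $B_j=M^*ZE_jM$ for $1\le j\le g$; (2) for each $1\le j,k\le g$, $E_kZE_j=\sum_{s=1}^g(\Xi_j)_{k,s}E_s$; (3) the tuple $B$ spans an algebra and, for each $1\le j,k\le g$, $B_kB_j=\sum_{s=1}^g(\Xi_j)_{k,s}B_s$; (4) $\Xi$ is convexotonic and $p$ is the corresponding convexotonic map $p(x)=x(I-\Lambda_\Xi(x))^{-1}$.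
   Context: $g,d,e$ are positive integers. $M_n(\mathbb C)^g$ is the set of $g$-tuples of $n\times n$ complex matrices, and $M(\mathbb C)^g$ denotes the sequence $(M_n(\mathbb C)^g)_n$. For $A\in M_d(\mathbb C)^g$ and $X\in M_n(\mathbb C)^g$ let $\Lambda_A(X)=\sum_j A_j\otimes X_j$ and $L_A(X)=I+\Lambda_A(X)+\Lambda_A(X)^*$. The free spectrahedron $\mathcal D_A=(\mathcal D_A(n))_n$ is given by $\mathcal D_A(n)=\{X\in M_n(\mathbb C)^g: L_A(X)\succeq 0\}$, and the spectraball $\mathcal B_A=(\mathcal B_A(n))_n$ by $\mathcal B_A(n)=\{X\in M_n(\mathbb C)^g:\|\Lambda_A(X)\|\le 1\}$. $\mathcal D_A$ is bounded if there is a constant $c$ with $\|X_j\|\le c$ for all $j$, all $n$ and all $X\in\mathcal D_A(n)$. A subset $\{u^1,\dots,u^{d+1}\}$ of $\mathbb C^d$ is a hyperbasis for $\mathbb C^d$ if each of its $d$-element subsets is a basis. A tuple $A\in M_d(\mathbb C)^g$ is sv-generic if there exist $\alpha^1,\dots,\alpha^{d+1}$ and $\beta^1,\dots,\beta^d$ in $\mathbb C^g$ such that: for each $1\le j\le d+1$ the matrix $I-\Lambda_A(\alpha^j)^*\Lambda_A(\alpha^j)$ is positive semidefinite with one-dimensional kernel spanned by a vector $u^j$, and $\{u^1,\dots,u^{d+1}\}$ is a hyperbasis for $\mathbb C^d$; and for each $1\le k\le d$ the matrix $I-\Lambda_A(\beta^k)\Lambda_A(\beta^k)^*$ is positive semidefinite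 with one-dimensional kernel spanned by a vector $v^k$, and $\{v^1,\dots,v^d\}$ is a basis for $\mathbb C^d$. A subset $\Gamma=(\Gamma_n)_n$ of $M(\mathbb C)^g$, $\Gamma_n\subset M_n(\mathbb C)^g$, is a free set if it is closed under direct sums and (simultaneous) unitary similarity; it is open if each $\Gamma_n$ is open. A free function $f:\Gamma\to M(\mathbb C)$ is a sequence $f_n:\Gamma_n\to M_n(\mathbb C)$ respecting intertwining: if $X\in\Gamma_n$, $Y\in\Gamma_m$, $T:\mathbb C^m\to\mathbb C^n$ is linear and $X_jT=TY_j$ for all $j$, then $f_n(X)T=Tf_m(Y)$. A free mapping $f=(f^1,\dots,f^h)$ is a tuple of free functions. On an open free set it is analytic if each $f_n$ is analytic. A bianalytic map is a bijective free analytic map whose inverse is also a free analytic map (on the non-open sets $\mathcal B_E$, $\mathcal D_B$ analyticity is understood through hypothesis (iv): the map is the restriction of a free analytic map on a free pseudoconvex set). The condition $p'(0)=I$ means that the derivative of $p$ at $0$ is the identity (at each level $n$). A free pseudoconvex set is a set of the form $\{X\in M(\mathbb C)^g:\|Q(X)\|<1\}$, where $Q$ is a matrix-valued free (noncommutative) analytic polynomial, i.e. a polynomial in $x_1,\dots,x_g$ only (no adjoints) with matrix coefficients. A tuple $B$ spans an algebra if the linear span of $\{B_1,\dots,B_g\}$ is closed under multiplication. A tuple $\Xi\in M_g(\mathbb C)^g$ is convexotonic if $\Xi_k\Xi_j=\sum_{s=1}^g(\Xi_j)_{k,s}\Xi_s$ for all $1\le j,k\le g$. The corresponding convexotonic map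 $p(x)=x(I-\Lambda_\Xi(x))^{-1}$ is the free mapping $p=(p^1,\dots,p^g)$ with $p^i(x)=\sum_{j=1}^g x_j\,[(I-\Lambda_\Xi(x))^{-1}]_{j,i}$, where $\Lambda_\Xi(x)=\sum_j\Xi_jx_j$ is a $g\times g$ matrix with entries linear in $x$; for $X\in M_n(\mathbb C)^g$, $[\,\cdot\,]_{j,i}$ denotes the $(j,i)$ block, of size $n\times n$, of the $g\times g$ block matrix, and the domain consists of those $X$ for which $I-\Lambda_\Xi(X)$ is invertible. *)

theory Defs
  imports
    "HOL-Analysis.L2_Norm"
    "Jordan_Normal_Form.Schur_Decomposition"
    "Jordan_Normal_Form.Matrix_Kernel"
    "Jordan_Normal_Form.Gauss_Jordan_Elimination"
begin

text \<open>
  A tuple in \<open>M_n(\<complex>)^g\<close> is a list of length \<open>g\<close>, so all indices start at 0.  A sequence of sets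
  \<open>\<Gamma> = (\<Gamma>_n)_n\<close> is a function on \<open>nat\<close> of which only the levels \<open>n > 0\<close> are ever used; likewise
  for sequences of maps.
\<close>

definition mtuples :: "nat \<Rightarrow> nat \<Rightarrow> complex mat list set" where
  "mtuples n g = {X. length X = g \<and> set X \<subseteq> carrier_mat n n}"

definition mat_sum :: "nat \<Rightarrow> nat \<Rightarrow> 'i set \<Rightarrow> ('i \<Rightarrow> complex mat) \<Rightarrow> complex mat" where
  "mat_sum r c I F = mat r c (\<lambda>ij. \<Sum>s\<in>I. F s $$ ij)"

definition kron :: "complex mat \<Rightarrow> complex mat \<Rightarrow> complex mat" where
  "kron A B = mat (dim_row A * dim_row B) (dim_col A * dim_col B)
     (\<lambda>(i, j). A $$ (i div dim_row B, j div dim_col B) * B $$ (i mod dim_row B, j mod dim_col B))"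

text \<open>The \<open>(i, j)\<close> block of a block matrix with blocks of size \<open>n \<times> n\<close>, as in \<open>kron\<close>.\<close>

definition mat_block :: "nat \<Rightarrow> complex mat \<Rightarrow> nat \<Rightarrow> nat \<Rightarrow> complex mat" where
  "mat_block n R i j = mat n n (\<lambda>(a, b). R $$ (i * n + a, j * n + b))"

definition vnorm :: "complex vec \<Rightarrow> real" where
  "vnorm v = L2_set (\<lambda>i. norm (vec_index v i)) {..<dim_vec v}"

definition opnorm :: "complex mat \<Rightarrow> real" where
  "opnorm A = (SUP v \<in> {v \<in> carrier_vec (dim_col A). vnorm v \<le> 1}. vnorm (A *\<^sub>v v))"

definition psd :: "nat \<Rightarrow> complex mat \<Rightarrow> bool" where
  "psd n A \<longleftrightarrow> A \<in> carrier_mat n n \<and> mat_adjoint A = A \<and>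
     (\<forall>v \<in> carrier_vec n. 0 \<le> Re ((A *\<^sub>v v) \<bullet>c v))"

definition unitary_mat :: "nat \<Rightarrow> complex mat \<Rightarrow> bool" where
  "unitary_mat d U \<longleftrightarrow> U \<in> carrier_mat d d \<and>
     mat_adjoint U * U = 1\<^sub>m d \<and> U * mat_adjoint U = 1\<^sub>m d"

text \<open>Linear independence of the family, hence the distinctness.\<close>

definition lin_indep_tuple :: "nat \<Rightarrow> complex mat list \<Rightarrow> bool" where
  "lin_indep_tuple d A \<longleftrightarrow> distinct A \<and>
     \<not> module.lin_dep class_ring (module_mat TYPE(complex) d d) (set A)"

definition spans_algebra :: "nat \<Rightarrow> complex mat list \<Rightarrow> bool" where
  "spans_algebra d A \<longleftrightarrow>
     (let S = LinearCombinations.module.span class_ring (module_mat TYPE(complex) d d) (set A)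
      in \<forall>P \<in> S. \<forall>R \<in> S. P * R \<in> S)"

definition Lambda :: "nat \<Rightarrow> nat \<Rightarrow> complex mat list \<Rightarrow> complex mat list \<Rightarrow> complex mat" where
  "Lambda d n A X = mat_sum (d * n) (d * n) {..<length A} (\<lambda>j. kron (A ! j) (X ! j))"

definition pencil :: "nat \<Rightarrow> nat \<Rightarrow> complex mat list \<Rightarrow> complex mat list \<Rightarrow> complex mat" where
  "pencil d n A X = 1\<^sub>m (d * n) + Lambda d n A X + mat_adjoint (Lambda d n A X)"

definition free_spectrahedron :: "nat \<Rightarrow> nat \<Rightarrow> complex mat list \<Rightarrow> nat \<Rightarrow> complex mat list set" where
  "free_spectrahedron d g A n = {X \<in> mtuples n g. psd (d * n) (pencil d n A X)}"

definition spectraball :: "nat \<Rightarrow> nat \<Rightarrow> complex mat list \<Rightarrow> nat \<Rightarrow> complex mat list set" where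
  "spectraball d g A n = {X \<in> mtuples n g. opnorm (Lambda d n A X) \<le> 1}"

definition free_bounded :: "nat \<Rightarrow> (nat \<Rightarrow> complex mat list set) \<Rightarrow> bool" where
  "free_bounded g \<Gamma> \<longleftrightarrow> (\<exists>c. \<forall>n>0. \<forall>X \<in> \<Gamma> n. \<forall>j<g. opnorm (X ! j) \<le> c)"

abbreviation vbasis :: "nat \<Rightarrow> complex vec set \<Rightarrow> bool" where
  "vbasis d S \<equiv> vectorspace.basis class_ring (module_vec TYPE(complex) d) S"

definition hyperbasis :: "nat \<Rightarrow> complex vec set \<Rightarrow> bool" where
  "hyperbasis d S \<longleftrightarrow> card S = d + 1 \<and> (\<forall>T \<subseteq> S. card T = d \<longrightarrow> vbasis d T)"

definition psd_with_kernel :: "nat \<Rightarrow> complex mat \<Rightarrow> complex vec \<Rightarrow> bool" where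
  "psd_with_kernel d A u \<longleftrightarrow> psd d A \<and> u \<in> carrier_vec d \<and> u \<noteq> 0\<^sub>v d \<and>
     mat_kernel A = LinearCombinations.module.span class_ring (module_vec TYPE(complex) d) {u}"

text \<open>A point of \<open>\<complex>^g\<close> is regarded as an element of \<open>M_1(\<complex>)^g\<close>.\<close>

definition sv_generic :: "nat \<Rightarrow> nat \<Rightarrow> complex mat list \<Rightarrow> bool" where
  "sv_generic d g A \<longleftrightarrow>
     (\<exists>(\<alpha> :: nat \<Rightarrow> complex mat list) (\<beta> :: nat \<Rightarrow> complex mat list)
        (u :: nat \<Rightarrow> complex vec) (v :: nat \<Rightarrow> complex vec).
        (\<forall>j<d + 1. \<alpha> j \<in> mtuples 1 g \<and>
           psd_with_kernel d
             (1\<^sub>m d - mat_adjoint (Lambda d 1 A (\<alpha> j)) * Lambda d 1 A (\<alpha> j)) (u j)) \<and>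
        hyperbasis d (u ` {..<d + 1}) \<and>
        (\<forall>k<d. \<beta> k \<in> mtuples 1 g \<and>
           psd_with_kernel d
             (1\<^sub>m d - Lambda d 1 A (\<beta> k) * mat_adjoint (Lambda d 1 A (\<beta> k))) (v k)) \<and>
        card (v ` {..<d}) = d \<and> vbasis d (v ` {..<d}))"

definition free_map ::
  "nat \<Rightarrow> nat \<Rightarrow> (nat \<Rightarrow> complex mat list set) \<Rightarrow> (nat \<Rightarrow> complex mat list \<Rightarrow> complex mat list) \<Rightarrow> bool"
where
  "free_map g h \<Gamma> f \<longleftrightarrow>
     (\<forall>n>0. \<forall>X \<in> \<Gamma> n. f n X \<in> mtuples n h) \<and>
     (\<forall>n>0. \<forall>m>0. \<forall>X \<in> \<Gamma> n. \<forall>Y \<in> \<Gamma> m. \<forall>T \<in> carrier_mat n m.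
        (\<forall>j<g. X ! j * T = T * Y ! j) \<longrightarrow> (\<forall>i<h. f n X ! i * T = T * f m Y ! i))"

definition tzero :: "nat \<Rightarrow> nat \<Rightarrow> complex mat list" where
  "tzero n g = replicate g (0\<^sub>m n n)"

definition tadd :: "complex mat list \<Rightarrow> complex mat list \<Rightarrow> complex mat list" where
  "tadd X Y = map2 (+) X Y"

definition tsub :: "complex mat list \<Rightarrow> complex mat list \<Rightarrow> complex mat list" where
  "tsub X Y = map2 (-) X Y"

definition tscale :: "complex \<Rightarrow> complex mat list \<Rightarrow> complex mat list" where
  "tscale c X = map (\<lambda>A. c \<cdot>\<^sub>m A) X"

definition tnorm :: "complex mat list \<Rightarrow> real" where
  "tnorm X = sum_list (map opnorm X)"

definition tuple_open :: "nat \<Rightarrow> nat \<Rightarrow> complex mat list set \<Rightarrow> bool" where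
  "tuple_open n g S \<longleftrightarrow> S \<subseteq> mtuples n g \<and>
     (\<forall>X \<in> S. \<exists>\<delta>>0. \<forall>H \<in> mtuples n g. tnorm H < \<delta> \<longrightarrow> tadd X H \<in> S)"

text \<open>
  \<open>L\<close> is the complex Frechet derivative at \<open>X\<close> of \<open>f\<close>, which maps a neighbourhood of \<open>X\<close> in
  \<open>M_n(\<complex>)^g\<close> to \<open>M_n(\<complex>)^h\<close>.
\<close>

definition has_tuple_derivative ::
  "nat \<Rightarrow> nat \<Rightarrow> nat \<Rightarrow> (complex mat list \<Rightarrow> complex mat list) \<Rightarrow> (complex mat list \<Rightarrow> complex mat list)
     \<Rightarrow> complex mat list \<Rightarrow> bool"
where
  "has_tuple_derivative n g h f L X \<longleftrightarrow>
     (\<forall>H \<in> mtuples n g. L H \<in> mtuples n h) \<and>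
     (\<forall>H \<in> mtuples n g. \<forall>K \<in> mtuples n g. L (tadd H K) = tadd (L H) (L K)) \<and>
     (\<forall>c. \<forall>H \<in> mtuples n g. L (tscale c H) = tscale c (L H)) \<and>
     (\<forall>\<epsilon>>0. \<exists>\<delta>>0. \<forall>H \<in> mtuples n g. tnorm H < \<delta> \<longrightarrow>
        tnorm (tsub (tsub (f (tadd X H)) (f X)) (L H)) \<le> \<epsilon> * tnorm H)"

text \<open>
  As for \<open>analytic_on\<close>, analytic on an open set means complex differentiable at each of
  its points.
\<close>

definition free_analytic ::
  "nat \<Rightarrow> nat \<Rightarrow> (nat \<Rightarrow> complex mat list set) \<Rightarrow> (nat \<Rightarrow> complex mat list \<Rightarrow> complex mat list) \<Rightarrow> bool"
where
  "free_analytic g h U f \<longleftrightarrow> free_map g h U f \<and>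
     (\<forall>n>0. tuple_open n g (U n) \<and> (\<forall>X \<in> U n. \<exists>L. has_tuple_derivative n g h (f n) L X))"

text \<open>
  The free polynomial \<open>Q = \<Sum>w\<in>W. C w \<cdot> w\<close> with \<open>r \<times> s\<close> coefficients: words are lists of indices
  of variables, and \<open>W\<close> is a finite set of words.
\<close>

definition word_eval :: "nat \<Rightarrow> complex mat list \<Rightarrow> nat list \<Rightarrow> complex mat" where
  "word_eval n X w = foldr (\<lambda>j P. X ! j * P) w (1\<^sub>m n)"

definition ncpoly_eval ::
  "nat \<Rightarrow> nat \<Rightarrow> nat list set \<Rightarrow> (nat list \<Rightarrow> complex mat) \<Rightarrow> nat \<Rightarrow> complex mat list \<Rightarrow> complex mat"
where
  "ncpoly_eval r s W C n X = mat_sum (r * n) (s * n) W (\<lambda>w. kron (C w) (word_eval n X w))"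

definition free_pseudoconvex :: "nat \<Rightarrow> (nat \<Rightarrow> complex mat list set) \<Rightarrow> bool" where
  "free_pseudoconvex g U \<longleftrightarrow>
     (\<exists>r s W C. 0 < r \<and> 0 < s \<and> finite W \<and> (\<forall>w \<in> W. set w \<subseteq> {..<g} \<and> C w \<in> carrier_mat r s) \<and>
        U = (\<lambda>n. {X \<in> mtuples n g. opnorm (ncpoly_eval r s W C n X) < 1}))"

text \<open>\<open>f\<close> on the possibly non-open \<open>\<Gamma>\<close> is the restriction of a free analytic map \<open>F\<close>.\<close>

definition analytic_near ::
  "nat \<Rightarrow> nat \<Rightarrow> (nat \<Rightarrow> complex mat list set) \<Rightarrow> (nat \<Rightarrow> complex mat list \<Rightarrow> complex mat list) \<Rightarrow> bool"
where
  "analytic_near g h \<Gamma> f \<longleftrightarrow>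
     (\<exists>U F. free_pseudoconvex g U \<and> (\<forall>n>0. \<Gamma> n \<subseteq> U n) \<and> free_analytic g h U F \<and>
        (\<forall>n>0. \<forall>X \<in> \<Gamma> n. F n X = f n X))"

text \<open>\<open>p : \<Gamma> \<rightarrow> \<Delta>\<close> is bianalytic with inverse \<open>q\<close>, analyticity being that of \<open>analytic_near\<close>.\<close>

definition free_bianalytic ::
  "nat \<Rightarrow> (nat \<Rightarrow> complex mat list set) \<Rightarrow> (nat \<Rightarrow> complex mat list set)
     \<Rightarrow> (nat \<Rightarrow> complex mat list \<Rightarrow> complex mat list) \<Rightarrow> (nat \<Rightarrow> complex mat list \<Rightarrow> complex mat list) \<Rightarrow> bool"
where
  "free_bianalytic g \<Gamma> \<Delta> p q \<longleftrightarrow>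
     free_map g g \<Gamma> p \<and> analytic_near g g \<Gamma> p \<and>
     free_map g g \<Delta> q \<and> analytic_near g g \<Delta> q \<and>
     (\<forall>n>0. bij_betw (p n) (\<Gamma> n) (\<Delta> n) \<and> (\<forall>X \<in> \<Gamma> n. q n (p n X) = X))"

definition convexotonic :: "nat \<Rightarrow> complex mat list \<Rightarrow> bool" where
  "convexotonic g \<Xi> \<longleftrightarrow> \<Xi> \<in> mtuples g g \<and>
     (\<forall>j<g. \<forall>k<g. \<Xi> ! k * \<Xi> ! j = mat_sum g g {..<g} (\<lambda>s. (\<Xi> ! j) $$ (k, s) \<cdot>\<^sub>m \<Xi> ! s))"

definition convexotonic_domain :: "nat \<Rightarrow> complex mat list \<Rightarrow> nat \<Rightarrow> complex mat list set" where
  "convexotonic_domain g \<Xi> n = {X \<in> mtuples n g. invertible_mat (1\<^sub>m (g * n) - Lambda g n \<Xi> X)}"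

definition convexotonic_map :: "nat \<Rightarrow> complex mat list \<Rightarrow> nat \<Rightarrow> complex mat list \<Rightarrow> complex mat list" where
  "convexotonic_map g \<Xi> n X =
     (let R = the (mat_inverse (1\<^sub>m (g * n) - Lambda g n \<Xi> X))
      in map (\<lambda>i. mat_sum n n {..<g} (\<lambda>j. X ! j * mat_block n R j i)) [0..<g])"

end

theory Submission
  imports Defs "HOL-Complex_Analysis.Complex_Analysis"
begin

text \<open>
  A block tuple with \<open>x\<close> above a zero diagonal and zeros below is fixed by \<open>p\<close> and \<open>q\<close>, because
  \<open>p(0) = 0\<close> and \<open>p'(0) = I\<close>.  Such a tuple lies in \<open>\<D>_B\<close> iff \<open>\<parallel>\<Lambda>_B(x)\<parallel> \<le> 1\<close>, so \<open>\<B>_E\<close> and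
  \<open>\<B>_B\<close> agree on all rectangular tuples \<open>x\<close>.  Scale the hyperbasis of sv-genericity to
  \<open>\<Sum>_a u\<^sup>a = 0\<close>.  Then \<open>(u\<^sup>a)_a\<close> spans the vectors on which \<open>\<Lambda>_E(\<alpha>\<^sup>1 \<oplus> \<dots> \<oplus> \<alpha>\<^bsup>d+1\<^esup>)\<close> is isometric and
  whose sum over \<open>a\<close> vanishes; perturbing to second order
  there carries the Gram matrix of the vectors \<open>E_j u\<^sup>a\<close> over to \<open>B\<close>, and gives isometries \<open>W\<close>, \<open>V\<close> with
  \<open>B_j V = W E_j\<close>.  By symmetry \<open>d = e\<close>.

  On \<open>\<D>_B\<close> the operator \<open>\<Lambda>_B(Y) (I + \<Lambda>_B(Y))\<inverse>\<close> is a contraction.  Taking \<open>Y = p(X \<otimes> J)\<close> with a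
  nilpotent shift \<open>J\<close> and perturbing at the maximal singular values of \<open>B\<close>, all terms of degree at least
  two vanish, that is \<open>(I + \<Lambda>_B(p(X))) (I - \<Lambda>_B(X)) = I\<close> to all orders at \<open>0\<close>, hence on \<open>\<B>_E\<close> by the identity theorem
  along \<open>z \<mapsto> z X\<close>.  A nilpotent \<open>3 \<times> 3\<close> tuple then shows that \<open>B_k B_j\<close> is in the span of \<open>B\<close>, and comparing
  coefficients of the independent \<open>B_s\<close> gives the formula for \<open>p\<close>.
\<close>

section \<open>Spectraballs at rectangular levels\<close>

text \<open>Membership in a spectraball bounds a sum of squares, one for each row of the tuple, by
  the norm. Hence the coincidence of the balls transfers inequalities between sums of squares and
  nothing else, and each identity on the \<open>B\<close> side has to be squeezed out of
  inequalities. This is why the forms are nested: the first is maximal where the operator is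
  isometric, the second, with a small factor, breaks the tie among those vectors, and the third
  tests a single square on the line that is left. Compactness of the unit sphere makes each maximum
  stable under the next perturbation. The hyperbasis makes the last set of maximizers a line,
  because a relation between its vectors is unique up to a factor. Tuples are rectangular because
  many rows must be stacked on only \<open>d + 1\<close> columns.

  The formula for \<open>p\<close> rests on the same device: at a peak vector the terms of degree
  one already use up, to any precision, the norm that a contraction allows, so nothing is left for
  higher terms.\<close>

text \<open>Tychonoff: vectors are functions on possibly infinite types, with the product
  topology.\<close>

lemma compact_Pi_UNIV:
  fixes K :: "'a \<Rightarrow> 'b::topological_space set"
  assumes "\<And>i. compact (K i)"
  shows "compact {f. \<forall>i. f i \<in> K i}"
proof -
  have "compactin (product_topology (\<lambda>i. euclidean) UNIV) (Pi\<^sub>E UNIV K)"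
    using assms by (simp add: compactin_PiE)
  then show ?thesis
    by (simp add: euclidean_product_topology PiE_UNIV_domain Pi_def)
qed

text \<open>The perturbation principle behind all uses of compactness. On the compact part of
  \<open>S\<close> where \<open>q1 \<le> 0\<close>, \<open>q0\<close> has a positive lower bound
  \<open>c\<close>, of which \<open>e * q1\<close> takes away at most \<open>c / 2\<close>;
  elsewhere \<open>q1\<close> is positive.\<close>

lemma compact_pos_combination:
  fixes q0 q1 :: "'a::topological_space \<Rightarrow> real"
  assumes S: "compact S" and c0: "continuous_on S q0" and c1: "continuous_on S q1"
    and nn: "\<And>v. v \<in> S \<Longrightarrow> 0 \<le> q0 v" and pos: "\<And>v. v \<in> S \<Longrightarrow> q0 v = 0 \<Longrightarrow> 0 < q1 v"
  shows "\<exists>\<epsilon>>0. \<exists>\<delta>>0. \<forall>v\<in>S. \<delta> \<le> q0 v + \<epsilon> * q1 v"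
proof -
  have bdd: "\<exists>\<delta>>0. \<forall>v\<in>T. \<delta> \<le> q v"
    if T: "compact T" "continuous_on T q" "\<And>v. v \<in> T \<Longrightarrow> 0 < q v" for T and q :: "'a \<Rightarrow> real"
  proof (cases "T = {}")
    case True then show ?thesis by (auto intro: exI[of _ 1])
  next
    case False
    then obtain x where "x \<in> T" "\<forall>y\<in>T. q x \<le> q y"
      using continuous_attains_inf[OF T(1) False T(2)] by blast
    then show ?thesis using T(3) by blast
  qed
  define S1 where "S1 = S \<inter> q1 -` {..0}"
  have "compact S1"
  proof -
    obtain C where C: "closed C" "C \<inter> S = q1 -` {..0} \<inter> S"
      using c1 unfolding continuous_on_closed_invariant by (meson closed_atMost)
    then have "S1 = S \<inter> C" unfolding S1_def by blast
    then show ?thesis using S C(1) compact_Int_closed by blast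
  qed
  moreover have "continuous_on S1 q0" using c0 unfolding S1_def by (meson continuous_on_subset inf_le1)
  moreover have "0 < q0 v" if "v \<in> S1" for v
    using that nn[of v] pos[of v] unfolding S1_def by force
  ultimately obtain c where c: "c > 0" "\<And>v. v \<in> S1 \<Longrightarrow> c \<le> q0 v" using bdd by metis
  have "bounded (q1 ` S)" using compact_continuous_image[OF c1 S] compact_imp_bounded by blast
  then obtain M where M: "M > 0" "\<And>v. v \<in> S \<Longrightarrow> \<bar>q1 v\<bar> \<le> M"
    unfolding bounded_pos by auto
  define e where "e = c / (2 * M)"
  have e: "e > 0" using c M unfolding e_def by simp
  have "0 < q0 v + e * q1 v" if v: "v \<in> S" for v
  proof (cases "q1 v \<le> 0")
    case True
    then have "c \<le> q0 v" using c(2) v unfolding S1_def by simp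
    moreover have "e * \<bar>q1 v\<bar> \<le> e * M" using M(2)[OF v] e by simp
    moreover have "e * M = c / 2" using M(1) unfolding e_def by simp
    ultimately show ?thesis using c(1) e mult_nonneg_nonpos[of e "q1 v"] True
      by (simp add: abs_of_nonpos)
  next
    case False
    then show ?thesis using e nn[OF v] by (simp add: add_nonneg_pos)
  qed
  moreover have "continuous_on S (\<lambda>v. q0 v + e * q1 v)" by (intro continuous_intros c0 c1)
  ultimately show ?thesis using bdd[OF S, of "\<lambda>v. q0 v + e * q1 v"] e by blast
qed

section \<open>Vectors and operators as functions on index sets\<close>

text \<open>Plain functions allow index sets that are sums and products of finite sets, without
  enumerating them. Squares of norms are used throughout, because they add up over rows and
  columns.\<close>

definition nrm :: "nat \<Rightarrow> (nat \<Rightarrow> complex) \<Rightarrow> real" where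
  "nrm d x = (\<Sum>i<d. (cmod (x i))\<^sup>2)"

definition ip :: "nat \<Rightarrow> (nat \<Rightarrow> complex) \<Rightarrow> (nat \<Rightarrow> complex) \<Rightarrow> complex" where
  "ip d x y = (\<Sum>i<d. x i * cnj (y i))"

definition nsq :: "nat \<Rightarrow> 'a set \<Rightarrow> (nat \<Rightarrow> 'a \<Rightarrow> complex) \<Rightarrow> real" where
  "nsq d I v = (\<Sum>i<d. \<Sum>s\<in>I. (cmod (v i s))\<^sup>2)"

text \<open>\<open>lam g d A I x\<close> is the operator \<open>\<Lambda>_A(x)\<close> on \<open>\<complex>^d \<otimes> \<complex>^I\<close>, for a tuple \<open>x\<close> of matrices whose
  columns are indexed by \<open>I\<close> and whose rows are indexed by an arbitrary type.\<close>

definition lam :: "nat \<Rightarrow> nat \<Rightarrow> (nat \<Rightarrow> nat \<Rightarrow> nat \<Rightarrow> complex) \<Rightarrow> 'b set \<Rightarrow> (nat \<Rightarrow> 'a \<Rightarrow> 'b \<Rightarrow> complex)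
    \<Rightarrow> (nat \<Rightarrow> 'b \<Rightarrow> complex) \<Rightarrow> nat \<Rightarrow> 'a \<Rightarrow> complex" where
  "lam g d A I x v = (\<lambda>i s. \<Sum>j<g. \<Sum>k<d. \<Sum>t\<in>I. A j i k * x j s t * v k t)"

text \<open>Rows and columns have separate index sets, so \<open>x\<close> may be rectangular, and
  stacking rows adds up the quadratic forms on the left.\<close>

definition fball :: "nat \<Rightarrow> nat \<Rightarrow> (nat \<Rightarrow> nat \<Rightarrow> nat \<Rightarrow> complex) \<Rightarrow> 'a set \<Rightarrow> 'b set
    \<Rightarrow> (nat \<Rightarrow> 'a \<Rightarrow> 'b \<Rightarrow> complex) \<Rightarrow> bool" where
  "fball g d A R I x \<longleftrightarrow> (\<forall>v. nsq d R (lam g d A I x v) \<le> nsq d I v)"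

definition lin :: "nat \<Rightarrow> nat \<Rightarrow> (nat \<Rightarrow> nat \<Rightarrow> nat \<Rightarrow> complex) \<Rightarrow> (nat \<Rightarrow> complex) \<Rightarrow> (nat \<Rightarrow> complex)
    \<Rightarrow> nat \<Rightarrow> complex" where
  "lin g d A \<alpha> x = (\<lambda>i. \<Sum>j<g. \<Sum>k<d. \<alpha> j * A j i k * x k)"

definition mv :: "nat \<Rightarrow> (nat \<Rightarrow> nat \<Rightarrow> complex) \<Rightarrow> (nat \<Rightarrow> complex) \<Rightarrow> nat \<Rightarrow> complex" where
  "mv d M x = (\<lambda>i. \<Sum>k<d. M i k * x k)"

text \<open>Vanishing off the finite index set is demanded so that the sphere is compact in the
  product topology.\<close>

definition sphere2 :: "nat \<Rightarrow> 'a set \<Rightarrow> (nat \<Rightarrow> 'a \<Rightarrow> complex) set" where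
  "sphere2 d I = {v. (\<forall>i s. (i \<ge> d \<or> s \<notin> I) \<longrightarrow> v i s = 0) \<and> nsq d I v = 1}"

lemma continuous_on_coord2 [continuous_intros]:
  "continuous_on S (\<lambda>v :: 'b \<Rightarrow> 'a \<Rightarrow> 'c::topological_space. v i s)"
proof -
  have "continuous_on UNIV (\<lambda>v :: 'b \<Rightarrow> 'a \<Rightarrow> 'c. v i)" by simp
  then have "continuous_on UNIV (\<lambda>v :: 'b \<Rightarrow> 'a \<Rightarrow> 'c. v i s)"
    by (rule continuous_on_compose2[where g = "\<lambda>w. w s" and t = UNIV, rotated]) auto
  then show ?thesis by (rule continuous_on_subset) simp
qed

lemma compact_sphere2:
  fixes I :: "'a set"
  assumes "finite I"
  shows "compact (sphere2 d I)"
proof -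
  define K :: "nat \<Rightarrow> 'a \<Rightarrow> complex set"
    where "K i s = (if i < d \<and> s \<in> I then cball 0 1 else {0})" for i s
  have "compact {v. \<forall>i. v i \<in> {f. \<forall>s. f s \<in> K i s}}"
    by (intro compact_Pi_UNIV) (simp add: K_def)
  moreover have "closed {v :: nat \<Rightarrow> 'a \<Rightarrow> complex. nsq d I v = 1}"
    unfolding nsq_def by (intro closed_Collect_eq continuous_intros)
  ultimately have "compact ({v. \<forall>i. v i \<in> {f. \<forall>s. f s \<in> K i s}} \<inter> {v. nsq d I v = 1})"
    by (rule compact_Int_closed)
  moreover have "sphere2 d I = {v. \<forall>i. v i \<in> {f. \<forall>s. f s \<in> K i s}} \<inter> {v. nsq d I v = 1}"
  proof -
    have "cmod (v i s) \<le> 1" if "nsq d I v = 1" "i < d" "s \<in> I" for v i s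
    proof -
      have "(cmod (v i s))\<^sup>2 \<le> (\<Sum>s\<in>I. (cmod (v i s))\<^sup>2)"
        using that assms by (intro member_le_sum) auto
      also have "\<dots> \<le> nsq d I v"
        unfolding nsq_def using that
        by (intro member_le_sum[of i "{..<d}" "\<lambda>i. \<Sum>s\<in>I. (cmod (v i s))\<^sup>2"]) (auto intro: sum_nonneg)
      finally show ?thesis using that(1) by (simp add: abs_square_le_1)
    qed
    then show ?thesis unfolding sphere2_def K_def by (auto split: if_splits)
  qed
  ultimately show ?thesis by simp
qed

lemma nsq_nonneg [simp]: "0 \<le> nsq d I v"
  unfolding nsq_def by (intro sum_nonneg) auto

lemma nrm_nonneg [simp]: "0 \<le> nrm d v"
  unfolding nrm_def by (intro sum_nonneg) auto

lemma nsq_cong: "(\<And>i s. i < d \<Longrightarrow> s \<in> I \<Longrightarrow> v i s = w i s) \<Longrightarrow> nsq d I v = nsq d I w"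
  unfolding nsq_def by (intro sum.cong) auto

lemma nrm_cong: "(\<And>i. i < d \<Longrightarrow> v i = w i) \<Longrightarrow> nrm d v = nrm d w"
  unfolding nrm_def by (intro sum.cong) auto

lemma nsq_scale: "nsq d I (\<lambda>i s. c * v i s) = (cmod c)\<^sup>2 * nsq d I v"
  unfolding nsq_def by (simp add: norm_mult power_mult_distrib sum_distrib_left)

lemma nrm_scale: "nrm d (\<lambda>i. c * v i) = (cmod c)\<^sup>2 * nrm d v"
  unfolding nrm_def by (simp add: norm_mult power_mult_distrib sum_distrib_left)

lemma nsq_zero: "finite I \<Longrightarrow> nsq d I v = 0 \<Longrightarrow> i < d \<Longrightarrow> s \<in> I \<Longrightarrow> v i s = 0"
  unfolding nsq_def
  by (subst (asm) sum_nonneg_eq_0_iff) (auto intro: sum_nonneg simp: sum_nonneg_eq_0_iff)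

lemma nrm_zero: "nrm d v = 0 \<Longrightarrow> i < d \<Longrightarrow> v i = 0"
  unfolding nrm_def by (subst (asm) sum_nonneg_eq_0_iff) auto

lemma nsq_columns: "nsq d I v = (\<Sum>s\<in>I. nrm d (\<lambda>i. v i s))"
  unfolding nsq_def nrm_def by (rule sum.swap)

text \<open>By scaling to the sphere. A vector may have arbitrary values outside
  \<open>{..<d}\<close> and \<open>I\<close>; \<open>loc\<close> allows them to be cut off
  first.\<close>

lemma homogeneous_lower_bound:
  fixes Q :: "(nat \<Rightarrow> 'a \<Rightarrow> complex) \<Rightarrow> real"
  assumes I: "finite I" and hom: "\<And>(c::real) v. Q (\<lambda>i s. of_real c * v i s) = c\<^sup>2 * Q v"
    and loc: "\<And>v w. (\<And>i s. i < d \<Longrightarrow> s \<in> I \<Longrightarrow> v i s = w i s) \<Longrightarrow> Q v = Q w"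
    and bound: "\<And>v. v \<in> sphere2 d I \<Longrightarrow> \<delta> \<le> Q v"
  shows "\<delta> * nsq d I v \<le> Q v"
proof (cases "nsq d I v = 0")
  case True
  have "Q v = Q (\<lambda>i s. of_real 0 * v i s)" by (rule loc) (simp add: nsq_zero[OF I True])
  also have "\<dots> = 0" by (subst hom) simp
  finally show ?thesis using True by simp
next
  case False
  define N where "N = nsq d I v"
  have N: "N > 0" using False nsq_nonneg[of d I v] unfolding N_def by linarith
  define w where "w = (\<lambda>i s. if i < d \<and> s \<in> I then v i s else 0)"
  define z where "z = (\<lambda>i s. of_real (1 / sqrt N) * w i s)"
  have "nsq d I w = N" unfolding N_def w_def by (intro nsq_cong) auto
  then have "nsq d I z = 1" using N unfolding z_def nsq_scale
    by (simp add: norm_divide power_divide)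
  then have "z \<in> sphere2 d I" unfolding sphere2_def z_def w_def by auto
  then have "\<delta> \<le> Q z" by (rule bound)
  also have "Q z = (1 / sqrt N)\<^sup>2 * Q w" unfolding z_def by (rule hom)
  also have "Q w = Q v" by (intro loc) (auto simp: w_def)
  finally show ?thesis using N unfolding N_def[symmetric]
    by (simp add: power_divide divide_simps mult.commute)
qed

lemma nrm_add_scaled:
  "nrm d (\<lambda>i. x i + c * y i) = nrm d x + (cmod c)\<^sup>2 * nrm d y + 2 * Re (cnj c * ip d x y)"
proof -
  have *: "(cmod (p + c * q))\<^sup>2 = (cmod p)\<^sup>2 + (cmod c)\<^sup>2 * (cmod q)\<^sup>2 + 2 * Re (cnj c * (p * cnj q))" for p q
    unfolding cmod_power2 by (simp add: algebra_simps power2_eq_square)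
  show ?thesis unfolding nrm_def ip_def
    by (simp add: * sum.distrib sum_distrib_left Re_sum)
qed

lemma nrm_ip: "of_real (nrm d x) = ip d x x"
  unfolding nrm_def ip_def of_real_sum by (simp only: complex_norm_square)

lemma ip_sum_left: "ip d (\<lambda>i. \<Sum>r\<in>R. c r * x r i) y = (\<Sum>r\<in>R. c r * ip d (x r) y)"
  unfolding ip_def by (simp add: sum_distrib_left sum_distrib_right mult.assoc) (rule sum.swap)

lemma ip_sum_right: "ip d y (\<lambda>i. \<Sum>r\<in>R. c r * x r i) = (\<Sum>r\<in>R. cnj (c r) * ip d y (x r))"
  unfolding ip_def by (simp add: sum_distrib_left sum_distrib_right) (subst sum.swap, simp add: mult_ac)

section \<open>Rectangular tuples that realize prescribed quadratic forms\<close>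

text \<open>The four values of \<open>\<omega>\<close> in \<open>ridx\<close> recover the inner product of \<open>A_j v_a\<close> and \<open>A_k v_b\<close> by polarization.\<close>

definition rowf :: "nat \<Rightarrow> (nat \<Rightarrow> nat \<Rightarrow> nat \<Rightarrow> complex) \<Rightarrow> nat \<times> nat \<times> nat \<times> nat \<times> complex
    \<Rightarrow> (nat \<Rightarrow> nat \<Rightarrow> complex) \<Rightarrow> real" where
  "rowf n A r v = (case r of (a, j, b, k, \<omega>) \<Rightarrow>
     nrm n (\<lambda>i. mv n (A j) (\<lambda>k. v k a) i + \<omega> * mv n (A k) (\<lambda>k. v k b) i))"

text \<open>The squared norm of \<open>\<Lambda>_A\<close> at the direct sum of the points
  \<open>\<alpha> a\<close>, with one column of \<open>v\<close> for each point.\<close>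

definition diagf :: "nat \<Rightarrow> nat \<Rightarrow> (nat \<Rightarrow> nat \<Rightarrow> nat \<Rightarrow> complex) \<Rightarrow> (nat \<Rightarrow> nat \<Rightarrow> complex) \<Rightarrow> nat
    \<Rightarrow> (nat \<Rightarrow> nat \<Rightarrow> complex) \<Rightarrow> real" where
  "diagf g n A \<alpha> N v = (\<Sum>a\<le>N. nrm n (lin g n A (\<alpha> a) (\<lambda>k. v k a)))"

definition ridx :: "nat \<Rightarrow> nat \<Rightarrow> (nat \<times> nat \<times> nat \<times> nat \<times> complex) set" where
  "ridx g N = {..N} \<times> {..<g} \<times> {..N} \<times> {..<g} \<times> {1, -1, \<i>, -\<i>}"

text \<open>The rows \<open>Inl a\<close> form the direct sum of the points
  \<open>\<alpha> a\<close>; the row \<open>Inr (a, j, b, k, \<omega>)\<close> adds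
  \<open>A_j\<close> at column \<open>a\<close> and \<open>\<omega>\<close> times \<open>A_k\<close>
  at column \<open>b\<close>. The square root turns the weight of a row into the coefficient of its
  square.\<close>

definition rmat :: "(nat \<Rightarrow> nat \<Rightarrow> complex) \<Rightarrow> (nat \<times> nat \<times> nat \<times> nat \<times> complex \<Rightarrow> real) \<Rightarrow> complex
   \<Rightarrow> nat \<Rightarrow> nat + nat \<times> nat \<times> nat \<times> nat \<times> complex \<Rightarrow> nat \<Rightarrow> complex" where
  "rmat \<alpha> c s l z t = (case z of Inl a \<Rightarrow> (if t = a then s * \<alpha> a l else 0)
     | Inr (a, j, b, k, \<omega>) \<Rightarrow> s * of_real (sqrt (c (a, j, b, k, \<omega>))) *
         ((if l = j \<and> t = a then 1 else 0) + (if l = k \<and> t = b then \<omega> else 0)))"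

text \<open>Thus every nonnegative combination of the row forms, added to \<open>diagf\<close>,
  comes from a single rectangular tuple.\<close>

lemma nsq_rmat:
  assumes c: "\<And>r. r \<in> ridx g N \<Longrightarrow> 0 \<le> c r"
  shows "nsq n ({..N} <+> ridx g N) (lam g n A {..N} (rmat \<alpha> c s) v)
     = (cmod s)\<^sup>2 * (diagf g n A \<alpha> N v + (\<Sum>r\<in>ridx g N. c r * rowf n A r v))"
proof -
  have fin: "finite (ridx g N)" unfolding ridx_def by auto
  have 1: "nrm n (\<lambda>i. lam g n A {..N} (rmat \<alpha> c s) v i (Inl a))
      = (cmod s)\<^sup>2 * nrm n (lin g n A (\<alpha> a) (\<lambda>k. v k a))" if "a \<le> N" for a
  proof -
    have "lam g n A {..N} (rmat \<alpha> c s) v i (Inl a) = s * lin g n A (\<alpha> a) (\<lambda>k. v k a) i" for i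
    proof -
      have "lam g n A {..N} (rmat \<alpha> c s) v i (Inl a)
         = (\<Sum>l<g. \<Sum>h<n. \<Sum>t\<le>N. if t = a then s * (\<alpha> a l * A l i h * v h t) else 0)"
        unfolding lam_def rmat_def by (intro sum.cong refl) auto
      also have "\<dots> = s * lin g n A (\<alpha> a) (\<lambda>k. v k a) i"
        using that unfolding lin_def by (simp add: sum_distrib_left)
      finally show ?thesis .
    qed
    then show ?thesis by (simp add: nrm_scale)
  qed
  have 2: "nrm n (\<lambda>i. lam g n A {..N} (rmat \<alpha> c s) v i (Inr r)) = (cmod s)\<^sup>2 * (c r * rowf n A r v)"
    if r: "r \<in> ridx g N" for r
  proof -
    obtain a j b k \<omega> where req: "r = (a, j, b, k, \<omega>)" by (metis surj_pair)
    have m: "a \<le> N" "b \<le> N" "j < g" "k < g" using r unfolding req ridx_def by auto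
    have "lam g n A {..N} (rmat \<alpha> c s) v i (Inr r)
       = (s * of_real (sqrt (c r))) * (mv n (A j) (\<lambda>k. v k a) i + \<omega> * mv n (A k) (\<lambda>k. v k b) i)" for i
    proof -
      let ?q = "s * of_real (sqrt (c r))"
      have "lam g n A {..N} (rmat \<alpha> c s) v i (Inr r)
         = (\<Sum>l<g. \<Sum>h<n. \<Sum>t\<le>N. (if l = j then if t = a then ?q * (A l i h * v h t) else 0 else 0)
             + (if l = k then if t = b then ?q * (\<omega> * (A l i h * v h t)) else 0 else 0))"
        unfolding lam_def rmat_def req by (intro sum.cong refl) (auto simp: algebra_simps)
      also have "\<dots> = (\<Sum>l<g. (if l = j then \<Sum>h<n. ?q * (A l i h * v h a) else 0)
             + (if l = k then \<Sum>h<n. ?q * (\<omega> * (A l i h * v h b)) else 0))"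
        using m by (intro sum.cong refl) (auto simp: sum.distrib)
      also have "\<dots> = (\<Sum>h<n. ?q * (A j i h * v h a)) + (\<Sum>h<n. ?q * (\<omega> * (A k i h * v h b)))"
        using m by (simp add: sum.distrib)
      also have "\<dots> = ?q * (mv n (A j) (\<lambda>k. v k a) i + \<omega> * mv n (A k) (\<lambda>k. v k b) i)"
        unfolding mv_def by (simp add: sum_distrib_left distrib_left)
      finally show ?thesis .
    qed
    then show ?thesis using c[OF r] unfolding rowf_def req
      by (simp add: nrm_scale norm_mult power_mult_distrib)
  qed
  show ?thesis
    unfolding nsq_columns using fin
    by (simp add: sum.Plus 1 2 diagf_def sum_distrib_left distrib_left)
qed

section \<open>Transfer of the Gram matrix\<close>

text \<open>The hyperbasis of sv-genericity, its vectors scaled such that the unique linear relation between them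
  is \<open>\<Sum>_a u_a = 0\<close>.  Of the vectors \<open>v\<^sup>k\<close> only the consequence is kept that the ranges of the \<open>A_j\<close> span.\<close>

definition gen_data :: "nat \<Rightarrow> nat \<Rightarrow> (nat \<Rightarrow> nat \<Rightarrow> nat \<Rightarrow> complex) \<Rightarrow> (nat \<Rightarrow> nat \<Rightarrow> complex)
    \<Rightarrow> (nat \<Rightarrow> nat \<Rightarrow> complex) \<Rightarrow> bool" where
  "gen_data g d A \<alpha> u \<longleftrightarrow>
    (\<forall>a\<le>d. \<forall>x. nrm d (lin g d A (\<alpha> a) x) \<le> nrm d x) \<and>
    (\<forall>a\<le>d. nrm d (lin g d A (\<alpha> a) (u a)) = nrm d (u a)) \<and>
    (\<forall>a\<le>d. 0 < nrm d (u a)) \<and>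
    (\<forall>a\<le>d. \<forall>x. nrm d (lin g d A (\<alpha> a) x) = nrm d x \<longrightarrow> (\<exists>c. \<forall>i<d. x i = c * u a i)) \<and>
    (\<forall>i<d. (\<Sum>a\<le>d. u a i) = 0) \<and> (\<Sum>a\<le>d. nrm d (u a)) = 1 \<and>
    (\<forall>t. (\<forall>i<d. (\<Sum>a\<le>d. t a * u a i) = 0) \<longrightarrow> (\<forall>a\<le>d. t a = t 0)) \<and>
    (\<forall>x. \<exists>t. \<forall>i<d. x i = (\<Sum>a\<le>d. t a * u a i)) \<and>
    (\<forall>x. \<exists>\<kappa>. \<forall>i<d. x i = (\<Sum>j<g. mv d (A j) (\<kappa> j) i))"

lemma lin_mv: "lin g d A \<alpha> x i = (\<Sum>j<g. \<alpha> j * mv d (A j) x i)"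
  unfolding lin_def mv_def by (simp add: sum_distrib_left mult.assoc)

lemma mv_add_scaled: "mv d M (\<lambda>k. x k + c * y k) i = mv d M x i + c * mv d M y i"
  unfolding mv_def by (simp add: distrib_left sum.distrib sum_distrib_left mult_ac)

lemma mv_scale: "mv d M (\<lambda>k. c * y k) i = c * mv d M y i"
  unfolding mv_def by (simp add: sum_distrib_left mult_ac)

lemma mv_sum: "mv d M (\<lambda>k. \<Sum>r\<in>R. c r * y r k) i = (\<Sum>r\<in>R. c r * mv d M (y r) i)"
  unfolding mv_def by (simp add: sum_distrib_left) (subst sum.swap, simp add: mult_ac)

lemma mv_cong: "(\<And>k. k < d \<Longrightarrow> x k = y k) \<Longrightarrow> mv d M x i = mv d M y i"
  unfolding mv_def by (intro sum.cong) auto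

lemma ip_cong: "(\<And>k. k < d \<Longrightarrow> x k = x' k) \<Longrightarrow> (\<And>k. k < d \<Longrightarrow> y k = y' k) \<Longrightarrow> ip d x y = ip d x' y'"
  unfolding ip_def by (intro sum.cong) auto

lemma lin_add_scaled: "lin g d A \<alpha> (\<lambda>k. x k + c * y k) i = lin g d A \<alpha> x i + c * lin g d A \<alpha> y i"
  unfolding lin_mv mv_add_scaled by (simp add: distrib_left sum.distrib sum_distrib_left mult_ac)

text \<open>The nonnegative form \<open>nrm d x - nrm d (lin g d A \<alpha> x)\<close> is zero at
  \<open>u\<close>, hence minimal there, and its first variation vanishes. So \<open>u\<close> is an
  eigenvector of the adjoint times the map, for the eigenvalue 1.\<close>

lemma peak_ip:
  assumes contr: "\<And>x. nrm d (lin g d A \<alpha> x) \<le> nrm d x" and peak: "nrm d (lin g d A \<alpha> u) = nrm d u"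
  shows "ip d (lin g d A \<alpha> u) (lin g d A \<alpha> x) = ip d u x"
proof -
  define D where "D = ip d u x - ip d (lin g d A \<alpha> u) (lin g d A \<alpha> x)"
  define K where "K = nrm d x - nrm d (lin g d A \<alpha> x)"
  have K: "K \<ge> 0" using contr[of x] unfolding K_def by simp
  have *: "0 \<le> (cmod c)\<^sup>2 * K + 2 * Re (cnj c * D)" for c
  proof -
    have "nrm d (lin g d A \<alpha> (\<lambda>k. u k + c * x k)) \<le> nrm d (\<lambda>k. u k + c * x k)" by (rule contr)
    then show ?thesis unfolding lin_add_scaled nrm_add_scaled peak K_def D_def
      by (simp add: algebra_simps)
  qed
  \<comment> \<open>The variation \<open>c = - t * D\<close> lowers the form by
    \<open>2 t |D|^2\<close> to first order; \<open>t * K \<le> 1\<close> keeps the quadratic term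
    at most half of that.\<close>
  define t where "t = 1 / (K + 1)"
  have t: "t > 0" "t * K \<le> 1" using K unfolding t_def by (auto simp: divide_simps)
  have "0 \<le> (cmod (- (of_real t * D)))\<^sup>2 * K + 2 * Re (cnj (- (of_real t * D)) * D)" by (rule *)
  also have "Re (cnj (- (of_real t * D)) * D) = - t * (cmod D)\<^sup>2"
    unfolding cmod_power2 by (simp add: power2_eq_square algebra_simps)
  also have "(cmod (- (of_real t * D)))\<^sup>2 = t\<^sup>2 * (cmod D)\<^sup>2"
    using t by (simp add: norm_mult power_mult_distrib)
  finally have "0 \<le> t * (cmod D)\<^sup>2 * (t * K - 2)"
    by (simp only: power2_eq_square) (simp add: algebra_simps)
  moreover have "t * (cmod D)\<^sup>2 * (t * K - 2) \<le> t * (cmod D)\<^sup>2 * (-1)"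
    using t by (intro mult_left_mono) auto
  ultimately have "t * (cmod D)\<^sup>2 \<le> 0" by simp
  then have "D = 0" using t by (simp add: mult_le_0_iff)
  then show ?thesis unfolding D_def by simp
qed

lemma polarization:
  "4 * ip d x y = of_real (nrm d (\<lambda>i. x i + 1 * y i)) - of_real (nrm d (\<lambda>i. x i + (-1) * y i))
    + \<i> * of_real (nrm d (\<lambda>i. x i + \<i> * y i)) - \<i> * of_real (nrm d (\<lambda>i. x i + (-\<i>) * y i))"
  unfolding nrm_add_scaled by (simp add: complex_eq_iff)

lemma unit_roots_sum:
  "(\<Sum>\<omega>\<in>{1, -1, \<i>, -\<i>}. h \<omega>) = h 1 + h (-1) + h \<i> + h (-\<i>)"
proof -
  have "(1::complex) \<noteq> -1" "(1::complex) \<noteq> \<i>" "(1::complex) \<noteq> -\<i>" "(-1::complex) \<noteq> \<i>"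
    "(-1::complex) \<noteq> -\<i>" "\<i> \<noteq> -\<i>"
    by (auto simp: complex_eq_iff)
  then show ?thesis by (simp add: add.assoc)
qed

section \<open>Weights that single out one line of maximizers\<close>

text \<open>Weight at least 1 everywhere lets every row form count. The extra 1 at
  \<open>j = k\<close>, \<open>\<omega> = -1\<close> adds the squared differences between columns,
  which punish a nonzero sum over the columns. The last summand tunes a single column; there equal
  vectors are added, which gives a factor 4, hence \<open>\<theta> a / 4\<close>.\<close>

definition wt :: "(nat \<Rightarrow> real) \<Rightarrow> nat \<times> nat \<times> nat \<times> nat \<times> complex \<Rightarrow> real" where
  "wt \<theta> r = (case r of (a, j, b, k, \<omega>) \<Rightarrow>
     1 + (if j = k \<and> \<omega> = -1 then 1 else 0) + (if a = b \<and> j = k \<and> \<omega> = 1 then \<theta> a / 4 else 0))"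

text \<open>For given norms of the columns, the negative term makes the weighted form maximal only
  where the columns add up to zero.\<close>

lemma nrm_differences:
  "(\<Sum>a\<le>N. \<Sum>b\<le>N. nrm n (\<lambda>i. y a i + (-1) * y b i))
     = 2 * (real N + 1) * (\<Sum>a\<le>N. nrm n (y a)) - 2 * nrm n (\<lambda>i. \<Sum>a\<le>N. y a i)"
proof -
  have "ip n (\<lambda>i. \<Sum>a\<le>N. 1 * y a i) (\<lambda>i. \<Sum>a\<le>N. 1 * y a i) = (\<Sum>a\<le>N. \<Sum>b\<le>N. ip n (y a) (y b))"
    unfolding ip_sum_left ip_sum_right by simp
  then have "nrm n (\<lambda>i. \<Sum>a\<le>N. y a i) = (\<Sum>a\<le>N. \<Sum>b\<le>N. Re (ip n (y a) (y b)))"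
    using nrm_ip[of n "\<lambda>i. \<Sum>a\<le>N. y a i"] by (simp add: complex_eq_iff)
  moreover have "nrm n (\<lambda>i. y a i + (-1) * y b i) = nrm n (y a) + nrm n (y b) - 2 * Re (ip n (y a) (y b))" for a b
    unfolding nrm_add_scaled by simp
  then have "(\<Sum>a\<le>N. \<Sum>b\<le>N. nrm n (\<lambda>i. y a i + (-1) * y b i))
      = (\<Sum>a\<le>N. \<Sum>b\<le>N. nrm n (y a)) + (\<Sum>a\<le>N. \<Sum>b\<le>N. nrm n (y b))
        - 2 * (\<Sum>a\<le>N. \<Sum>b\<le>N. Re (ip n (y a) (y b)))"
    by (simp only: sum.distrib sum_subtractf sum_distrib_left)
  moreover have "(\<Sum>a\<le>N. \<Sum>b\<le>N. nrm n (y a)) = (real N + 1) * (\<Sum>a\<le>N. nrm n (y a))"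
    "(\<Sum>a\<le>N. \<Sum>b\<le>N. nrm n (y b)) = (real N + 1) * (\<Sum>a\<le>N. nrm n (y a))"
    by (simp_all add: sum_distrib_left algebra_simps)
  ultimately show ?thesis by (simp add: algebra_simps)
qed

text \<open>Over the four \<omega> the cross terms cancel. In \<open>8 (N + 1) g\<close> each
  \<open>y a j\<close> is counted as first and as second entry of a pair, with a factor 4 each time;
  \<open>2 (N + 1)\<close> comes from \<open>nrm_differences\<close>.\<close>

lemma weighted_rows:
  "(\<Sum>(a, j, b, k, \<omega>)\<in>ridx g N. wt \<theta> (a, j, b, k, \<omega>) * nrm n (\<lambda>i. y a j i + \<omega> * y b k i))
     = (\<Sum>a\<le>N. \<Sum>j<g. (8 * (real N + 1) * real g + 2 * (real N + 1) + \<theta> a) * nrm n (y a j))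
       - 2 * (\<Sum>j<g. nrm n (\<lambda>i. \<Sum>a\<le>N. y a j i))"
proof -
  let ?W = "{1, -1, \<i>, -\<i>}"
  let ?n = "\<lambda>a j b k \<omega>. nrm n (\<lambda>i. y a j i + \<omega> * y b k i)"
  have "(\<Sum>(a, j, b, k, \<omega>)\<in>ridx g N. wt \<theta> (a, j, b, k, \<omega>) * ?n a j b k \<omega>)
      = (\<Sum>a\<le>N. \<Sum>j<g. \<Sum>b\<le>N. \<Sum>k<g. \<Sum>\<omega>\<in>?W. wt \<theta> (a, j, b, k, \<omega>) * ?n a j b k \<omega>)"
    unfolding ridx_def by (simp only: sum.cartesian_product)
  also have "\<dots> = (\<Sum>a\<le>N. \<Sum>j<g. \<Sum>b\<le>N. \<Sum>k<g. 4 * nrm n (y a j) + 4 * nrm n (y b k)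
       + (if k = j then ?n a j b j (-1) else 0)
       + (if k = j then if b = a then \<theta> a * nrm n (y a j) else 0 else 0))"
  proof (intro sum.cong refl)
    fix a j b k
    have [simp]: "(1::complex) \<noteq> -1" "\<i> \<noteq> 1" "\<i> \<noteq> -1" "-\<i> \<noteq> 1" "-\<i> \<noteq> -1" "(-1::complex) \<noteq> 1"
      by (auto simp: complex_eq_iff)
    have d: "nrm n (\<lambda>i. y a j i + 1 * y a j i) = 4 * nrm n (y a j)"
    proof -
      have "(\<lambda>i. y a j i + 1 * y a j i) = (\<lambda>i. 2 * y a j i)" by auto
      then show ?thesis by (simp add: nrm_scale)
    qed
    have s: "?n a j b k 1 + ?n a j b k (-1) + ?n a j b k \<i> + ?n a j b k (-\<i>)
        = 4 * nrm n (y a j) + 4 * nrm n (y b k)"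
      unfolding nrm_add_scaled by simp
    show "(\<Sum>\<omega>\<in>?W. wt \<theta> (a, j, b, k, \<omega>) * ?n a j b k \<omega>) = 4 * nrm n (y a j) + 4 * nrm n (y b k)
       + (if k = j then ?n a j b j (-1) else 0)
       + (if k = j then if b = a then \<theta> a * nrm n (y a j) else 0 else 0)"
      unfolding unit_roots_sum s[symmetric] wt_def using d
      by (auto simp: algebra_simps)
  qed
  also have "\<dots> = (\<Sum>a\<le>N. \<Sum>j<g. 4 * (real N + 1) * real g * nrm n (y a j))
       + (real N + 1) * real g * (\<Sum>b\<le>N. \<Sum>k<g. 4 * nrm n (y b k))
       + (\<Sum>a\<le>N. \<Sum>j<g. \<Sum>b\<le>N. ?n a j b j (-1)) + (\<Sum>a\<le>N. \<Sum>j<g. \<theta> a * nrm n (y a j))"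
    by (simp add: sum.distrib sum_distrib_left algebra_simps)
  also have "(\<Sum>a\<le>N. \<Sum>j<g. \<Sum>b\<le>N. ?n a j b j (-1)) = (\<Sum>j<g. \<Sum>a\<le>N. \<Sum>b\<le>N. ?n a j b j (-1))"
    by (rule sum.swap)
  also have "\<dots> = 2 * (real N + 1) * (\<Sum>a\<le>N. \<Sum>j<g. nrm n (y a j))
      - 2 * (\<Sum>j<g. nrm n (\<lambda>i. \<Sum>a\<le>N. y a j i))"
    unfolding nrm_differences sum_subtractf
    by (subst sum.swap) (simp add: sum_distrib_left)
  finally show ?thesis by (simp add: sum.distrib sum_distrib_left algebra_simps)
qed

text \<open>Such an \<open>x\<close> is killed by every \<open>\<Lambda>_A(\<alpha> a)\<close>, so
  by \<open>peak_ip\<close> it is orthogonal to every \<open>u a\<close>, and these span.\<close>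

lemma gen_data_common_kernel:
  assumes "gen_data g d A \<alpha> u" and z: "\<And>j i. j < g \<Longrightarrow> i < d \<Longrightarrow> mv d (A j) x i = 0"
  shows "i < d \<Longrightarrow> x i = 0"
proof -
  have c: "\<And>a x. a \<le> d \<Longrightarrow> nrm d (lin g d A (\<alpha> a) x) \<le> nrm d x"
    and p: "\<And>a. a \<le> d \<Longrightarrow> nrm d (lin g d A (\<alpha> a) (u a)) = nrm d (u a)"
    and s: "\<And>x. \<exists>t. \<forall>i<d. x i = (\<Sum>a\<le>d. t a * u a i)"
    using assms(1) unfolding gen_data_def by auto
  have "ip d (u a) x = 0" if a: "a \<le> d" for a
  proof -
    have "ip d (u a) x = ip d (lin g d A (\<alpha> a) (u a)) (lin g d A (\<alpha> a) x)"
      using peak_ip[OF c[OF a] p[OF a]] by simp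
    also have "\<dots> = 0" unfolding ip_def lin_mv[of _ _ _ _ x] by (simp add: z)
    finally show ?thesis .
  qed
  moreover obtain t where t: "\<forall>i<d. x i = (\<Sum>a\<le>d. t a * u a i)" using s by blast
  have "of_real (nrm d x) = ip d (\<lambda>i. \<Sum>a\<le>d. t a * u a i) x"
    unfolding nrm_ip by (rule ip_cong) (use t in auto)
  ultimately have "nrm d x = 0" unfolding ip_sum_left by simp
  then show "i < d \<Longrightarrow> x i = 0" using nrm_zero by blast
qed

text \<open>Divided by \<open>c\<close>, the form is that of a rectangular tuple in the ball of
  \<open>E\<close>, and \<open>T\<close> puts this tuple into the ball of \<open>B\<close>.\<close>

lemma form_transfer:
  fixes E B :: "nat \<Rightarrow> nat \<Rightarrow> nat \<Rightarrow> complex"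
  assumes T: "\<And>(R :: (nat + nat \<times> nat \<times> nat \<times> nat \<times> complex) set) x. finite R \<Longrightarrow>
       fball g d E R {..N::nat} x \<Longrightarrow> fball g e B R {..N} x"
    and c: "0 < c" and w: "\<And>r. r \<in> ridx g N \<Longrightarrow> 0 \<le> w r"
    and E: "\<And>v. diagf g d E \<alpha> N v + (\<Sum>r\<in>ridx g N. w r * rowf d E r v) \<le> c * nsq d {..N} v"
  shows "diagf g e B \<alpha> N v + (\<Sum>r\<in>ridx g N. w r * rowf e B r v) \<le> c * nsq e {..N} v"
proof -
  have "(cmod (of_real (1 / sqrt c)))\<^sup>2 = 1 / c" using c by (simp add: norm_divide power_divide)
  then obtain s where s: "(cmod s)\<^sup>2 = 1 / c" by blast
  have fin: "finite ({..N} <+> ridx g N)" unfolding ridx_def by auto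
  have nr: "nsq n ({..N} <+> ridx g N) (lam g n A {..N} (rmat \<alpha> w s) v)
      = (1 / c) * (diagf g n A \<alpha> N v + (\<Sum>r\<in>ridx g N. w r * rowf n A r v))" for n A v
    unfolding s[symmetric] by (rule nsq_rmat) (rule w)
  have "fball g d E ({..N} <+> ridx g N) {..N} (rmat \<alpha> w s)"
    unfolding fball_def nr using E c by (simp add: divide_simps mult.commute)
  from T[OF fin this] have "fball g e B ({..N} <+> ridx g N) {..N} (rmat \<alpha> w s)" .
  then show ?thesis
    unfolding fball_def nr using c by (simp add: divide_simps mult.commute)
qed
lemma continuous_on_nsq [continuous_intros]: "continuous_on S (\<lambda>v. nsq n I v)"
  unfolding nsq_def by (intro continuous_intros)

lemma continuous_on_diagf [continuous_intros]: "continuous_on S (\<lambda>v. diagf g n A \<alpha> N v)"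
  unfolding diagf_def nrm_def lin_def by (intro continuous_intros)

lemma continuous_on_rowf [continuous_intros]: "continuous_on S (\<lambda>v. rowf n A r v)"
proof -
  obtain a j b k \<omega> where r: "r = (a, j, b, k, \<omega>)" by (metis surj_pair)
  show ?thesis unfolding rowf_def nrm_def mv_def r prod.case by (intro continuous_intros)
qed

lemma diagf_scale: "diagf g n A \<alpha> N (\<lambda>i s. c * v i s) = (cmod c)\<^sup>2 * diagf g n A \<alpha> N v"
proof -
  have "lin g n A \<beta> (\<lambda>k. c * x k) = (\<lambda>i. c * lin g n A \<beta> x i)" for \<beta> x
    unfolding lin_mv mv_scale by (simp add: sum_distrib_left mult_ac)
  then show ?thesis unfolding diagf_def by (simp add: nrm_scale sum_distrib_left)
qed

lemma rowf_scale: "rowf n A r (\<lambda>i s. c * v i s) = (cmod c)\<^sup>2 * rowf n A r v"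
proof -
  obtain a j b k \<omega> where r: "r = (a, j, b, k, \<omega>)" by (metis surj_pair)
  have "(\<lambda>i. mv n (A j) (\<lambda>k. c * v k a) i + \<omega> * mv n (A k) (\<lambda>k. c * v k b) i)
      = (\<lambda>i. c * (mv n (A j) (\<lambda>k. v k a) i + \<omega> * mv n (A k) (\<lambda>k. v k b) i))"
    unfolding mv_scale by (simp add: algebra_simps)
  then show ?thesis unfolding rowf_def r by (simp add: nrm_scale)
qed

lemma diagf_cong:
  assumes "\<And>i s. i < n \<Longrightarrow> s \<in> {..N} \<Longrightarrow> v i s = w i s"
  shows "diagf g n A \<alpha> N v = diagf g n A \<alpha> N w"
proof -
  have "lin g n A (\<alpha> a) (\<lambda>k. v k a) = lin g n A (\<alpha> a) (\<lambda>k. w k a)" if "a \<le> N" for a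
    using that assms unfolding lin_def by (intro ext sum.cong refl) auto
  then show ?thesis unfolding diagf_def by simp
qed

lemma rowf_cong:
  assumes "\<And>i s. i < n \<Longrightarrow> s \<in> {..N} \<Longrightarrow> v i s = w i s" and "r \<in> ridx g N"
  shows "rowf n A r v = rowf n A r w"
proof -
  obtain a j b k \<omega> where r: "r = (a, j, b, k, \<omega>)" by (metis surj_pair)
  have ab: "a \<le> N" "b \<le> N" using assms(2) unfolding r ridx_def by auto
  have "mv n M (\<lambda>k. v k a) i = mv n M (\<lambda>k. w k a) i" "mv n M (\<lambda>k. v k b) i = mv n M (\<lambda>k. w k b) i" for M i
    using ab assms(1) by (auto intro: mv_cong)
  then show ?thesis unfolding rowf_def r by simp
qed

lemma weighted_rows_rowf:
  "(\<Sum>r\<in>ridx g N. wt \<theta> r * rowf n A r v)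
     = (\<Sum>a\<le>N. \<Sum>j<g. (8 * (real N + 1) * real g + 2 * (real N + 1) + \<theta> a) * nrm n (mv n (A j) (\<lambda>k. v k a)))
       - 2 * (\<Sum>j<g. nrm n (mv n (A j) (\<lambda>k. \<Sum>a\<le>N. v k a)))"
proof -
  have "(\<Sum>r\<in>ridx g N. wt \<theta> r * rowf n A r v) = (\<Sum>(a, j, b, k, \<omega>)\<in>ridx g N. wt \<theta> (a, j, b, k, \<omega>)
      * nrm n (\<lambda>i. mv n (A j) (\<lambda>k. v k a) i + \<omega> * mv n (A k) (\<lambda>k. v k b) i))"
    unfolding rowf_def by (simp add: case_prod_beta)
  also have "\<dots> = (\<Sum>a\<le>N. \<Sum>j<g. (8 * (real N + 1) * real g + 2 * (real N + 1) + \<theta> a) * nrm n (mv n (A j) (\<lambda>k. v k a)))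
       - 2 * (\<Sum>j<g. nrm n (\<lambda>i. \<Sum>a\<le>N. mv n (A j) (\<lambda>k. v k a) i))"
    by (rule weighted_rows)
  also have "(\<Sum>j<g. nrm n (\<lambda>i. \<Sum>a\<le>N. mv n (A j) (\<lambda>k. v k a) i))
      = (\<Sum>j<g. nrm n (mv n (A j) (\<lambda>k. \<Sum>a\<le>N. v k a)))"
    using mv_sum[of n _ "\<lambda>a. 1" "\<lambda>a k. v k a" "{..N}"] by (intro sum.cong refl nrm_cong) simp
  finally show ?thesis .
qed

text \<open>A chain of perturbations: \<open>diagf\<close> dominates, a small multiple of the
  weighted rows breaks the tie among its maximizers, and a still smaller multiple of one row tests
  its value on the remaining line, spanned by \<open>\<xi>\<close>. Once all row values agree,
  polarization gives the inner products.\<close>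

lemma gram_transfer:
  fixes E B :: "nat \<Rightarrow> nat \<Rightarrow> nat \<Rightarrow> complex"
  assumes gd: "gen_data g d E \<alpha> u"
    and T: "\<And>(R :: (nat + nat \<times> nat \<times> nat \<times> nat \<times> complex) set) x. finite R \<Longrightarrow>
       fball g d E R {..d::nat} x \<longleftrightarrow> fball g e B R {..d} x"
  obtains \<zeta> where "(\<Sum>a\<le>d. nrm e (\<zeta> a)) = 1"
    and "\<And>a x. a \<le> d \<Longrightarrow> nrm e (lin g e B (\<alpha> a) x) \<le> nrm e x"
    and "\<And>a. a \<le> d \<Longrightarrow> nrm e (lin g e B (\<alpha> a) (\<zeta> a)) = nrm e (\<zeta> a)"
    and "\<And>a b j k. a \<le> d \<Longrightarrow> b \<le> d \<Longrightarrow> j < g \<Longrightarrow> k < g \<Longrightarrow>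
       ip e (mv e (B j) (\<zeta> a)) (mv e (B k) (\<zeta> b)) = ip d (mv d (E j) (u a)) (mv d (E k) (u b))"
proof -
  have contr: "\<And>a x. a \<le> d \<Longrightarrow> nrm d (lin g d E (\<alpha> a) x) \<le> nrm d x"
    and peak: "\<And>a. a \<le> d \<Longrightarrow> nrm d (lin g d E (\<alpha> a) (u a)) = nrm d (u a)"
    and upos: "\<And>a. a \<le> d \<Longrightarrow> 0 < nrm d (u a)"
    and uniq: "\<And>a x. a \<le> d \<Longrightarrow> nrm d (lin g d E (\<alpha> a) x) = nrm d x \<Longrightarrow> \<exists>c. \<forall>i<d. x i = c * u a i"
    and sum0: "\<And>i. i < d \<Longrightarrow> (\<Sum>a\<le>d. u a i) = 0" and norm1: "(\<Sum>a\<le>d. nrm d (u a)) = 1"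
    and hyper: "\<And>t a. (\<And>i. i < d \<Longrightarrow> (\<Sum>a\<le>d. t a * u a i) = 0) \<Longrightarrow> a \<le> d \<Longrightarrow> t a = t 0"
    using gd unfolding gen_data_def by auto
  define \<xi> where "\<xi> = (\<lambda>i a. u a i)"
  define R where "R = ridx g d"
  have fR: "finite R" unfolding R_def ridx_def by auto
  have nsq\<xi>: "nsq d {..d} \<xi> = 1" unfolding nsq_columns \<xi>_def using norm1 by simp
  define S where "S a = (\<Sum>j<g. nrm d (mv d (E j) (u a)))" for a
  have Spos: "S a > 0" if a: "a \<le> d" for a
  proof (rule ccontr)
    assume "\<not> ?thesis"
    moreover have "S a \<ge> 0" unfolding S_def by (intro sum_nonneg) simp
    ultimately have "S a = 0" by simp
    then have "nrm d (mv d (E j) (u a)) = 0" if "j < g" for j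
      unfolding S_def using that by (simp add: sum_nonneg_eq_0_iff)
    then have "u a i = 0" if "i < d" for i
      using gen_data_common_kernel[OF gd, of "u a" i] nrm_zero that by blast
    then have "nrm d (u a) = 0" unfolding nrm_def by simp
    then show False using upos[OF a] by simp
  qed
  define c0 where "c0 = 8 * (real d + 1) * real g + 2 * (real d + 1)"
  have c0: "c0 \<ge> 0" unfolding c0_def by simp
  \<comment> \<open>A common upper bound of the quotients, which makes every
    \<open>\<theta> a\<close> below nonnegative.\<close>
  define C where "C = (\<Sum>a\<le>d. c0 * S a / nrm d (u a))"
  have Cge: "c0 * S a / nrm d (u a) \<le> C" if "a \<le> d" for a
    unfolding C_def using that c0 Spos upos
    by (intro member_le_sum) (auto intro!: divide_nonneg_nonneg mult_nonneg_nonneg simp: less_imp_le)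
  have C0: "C \<ge> 0"
  proof -
    have "0 \<le> c0 * S 0 / nrm d (u 0)" using c0 Spos[of 0] by simp
    then show ?thesis using Cge[of 0] by linarith
  qed
  \<comment> \<open>Solves \<open>(c0 + \<theta> a) * S a = C * nrm d (u a)\<close>: each column
    \<open>t a * u a\<close> then contributes exactly \<open>C\<close> times its squared norm to the
    positive part of \<open>fE\<close>.\<close>
  define \<theta> where "\<theta> a = C * nrm d (u a) / S a - c0" for a
  have \<theta>: "\<theta> a \<ge> 0" "(c0 + \<theta> a) * S a = C * nrm d (u a)" if a: "a \<le> d" for a
    using Cge[OF a] Spos[OF a] upos[OF a] unfolding \<theta>_def by (auto simp: divide_simps)
  define w where "w = wt \<theta>"
  have w: "w r \<ge> 1" if "r \<in> R" for r
    using that \<theta>(1) unfolding w_def wt_def R_def ridx_def by (auto split: prod.splits)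
  define fE where "fE v = (\<Sum>r\<in>R. w r * rowf d E r v)" for v
  define fB where "fB v = (\<Sum>r\<in>R. w r * rowf e B r v)" for v
  have fE_scale: "fE (\<lambda>i s. of_real c * v i s) = c\<^sup>2 * fE v"
    and fB_scale: "fB (\<lambda>i s. of_real c * v i s) = c\<^sup>2 * fB v" for c v
    unfolding fE_def fB_def rowf_scale by (simp_all add: sum_distrib_left mult_ac)
  have fE_cong: "fE v = fE v'" if "\<And>i s. i < d \<Longrightarrow> s \<in> {..d} \<Longrightarrow> v i s = v' i s" for v v'
    unfolding fE_def using rowf_cong[of d d v v' _ g, OF that] unfolding R_def by (intro sum.cong) auto
  have fB_cong: "fB v = fB v'" if "\<And>i s. i < e \<Longrightarrow> s \<in> {..d} \<Longrightarrow> v i s = v' i s" for v v'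
    unfolding fB_def using rowf_cong[of e d v v' _ g, OF that] unfolding R_def by (intro sum.cong) auto
  \<comment> \<open>On the maximizers of \<open>diagf\<close>, \<open>fE\<close> is at most
    \<open>C\<close> times the squared norm. Equality forces all \<open>E_j\<close> to kill
    \<open>\<Sum>_a t a * u a\<close>, which is then zero, so that \<open>t\<close> is
    constant.\<close>
  have fE_peak: "fE v = C * nsq d {..d} v - 2 * (\<Sum>j<g. nrm d (mv d (E j) (\<lambda>k. \<Sum>a\<le>d. t a * u a k)))"
    if v: "\<And>i a. i < d \<Longrightarrow> a \<le> d \<Longrightarrow> v i a = t a * u a i" for v t
  proof -
    have "fE v = fE (\<lambda>i a. t a * u a i)" using v by (intro fE_cong) auto
    also have "\<dots> = (\<Sum>a\<le>d. \<Sum>j<g. (c0 + \<theta> a) * ((cmod (t a))\<^sup>2 * nrm d (mv d (E j) (u a))))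
         - 2 * (\<Sum>j<g. nrm d (mv d (E j) (\<lambda>k. \<Sum>a\<le>d. t a * u a k)))"
      unfolding fE_def w_def R_def weighted_rows_rowf mv_scale nrm_scale c0_def by simp
    also have "(\<Sum>a\<le>d. \<Sum>j<g. (c0 + \<theta> a) * ((cmod (t a))\<^sup>2 * nrm d (mv d (E j) (u a))))
        = (\<Sum>a\<le>d. (cmod (t a))\<^sup>2 * ((c0 + \<theta> a) * S a))"
      unfolding S_def by (simp add: sum_distrib_left mult_ac)
    also have "\<dots> = C * (\<Sum>a\<le>d. nrm d (\<lambda>i. t a * u a i))"
      using \<theta>(2) by (simp add: nrm_scale sum_distrib_left mult_ac)
    also have "(\<Sum>a\<le>d. nrm d (\<lambda>i. t a * u a i)) = nsq d {..d} v"
      unfolding nsq_columns using v by (intro sum.cong refl nrm_cong) auto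
    finally show ?thesis .
  qed
  have fE\<xi>: "fE \<xi> = C"
  proof -
    have "mv d (E j) (\<lambda>k. \<Sum>a\<le>d. 1 * u a k) i = 0" for j i
      unfolding mv_def using sum0 by (intro sum.neutral) auto
    then have "nrm d (mv d (E j) (\<lambda>k. \<Sum>a\<le>d. 1 * u a k)) = 0" for j unfolding nrm_def by simp
    then show ?thesis using fE_peak[of \<xi> "\<lambda>a. 1"] nsq\<xi> unfolding \<xi>_def by simp
  qed
  have diag\<xi>: "diagf g d E \<alpha> d \<xi> = 1" unfolding diagf_def \<xi>_def using peak norm1 by simp
  have diagE: "diagf g d E \<alpha> d v \<le> nsq d {..d} v" for v
    unfolding diagf_def nsq_columns using contr by (intro sum_mono) auto
  have EB: "diagf g e B \<alpha> d v + (\<Sum>r\<in>ridx g d. w r * rowf e B r v) \<le> c * nsq e {..d} v"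
    if "0 < c" "\<And>r. r \<in> ridx g d \<Longrightarrow> 0 \<le> w r"
      "\<And>v. diagf g d E \<alpha> d v + (\<Sum>r\<in>ridx g d. w r * rowf d E r v) \<le> c * nsq d {..d} v" for c w v
    using that by (intro form_transfer[where N = d and d = d and E = E and e = e and B = B]) (auto simp: T)
  have BE: "diagf g d E \<alpha> d v + (\<Sum>r\<in>ridx g d. w r * rowf d E r v) \<le> c * nsq d {..d} v"
    if "0 < c" "\<And>r. r \<in> ridx g d \<Longrightarrow> 0 \<le> w r"
      "\<And>v. diagf g e B \<alpha> d v + (\<Sum>r\<in>ridx g d. w r * rowf e B r v) \<le> c * nsq e {..d} v" for c w v
    using that by (intro form_transfer[where N = d and d = e and E = B and e = d and B = E]) (auto simp: T)
  have diagB: "diagf g e B \<alpha> d v \<le> nsq e {..d} v" for v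
    using EB[of 1 "\<lambda>r. 0" v] diagE by simp
  have contrB: "nrm e (lin g e B (\<alpha> a) x) \<le> nrm e x" if a: "a \<le> d" for a x
  proof -
    have *: "nrm e (lin g e B (\<alpha> b) (\<lambda>k. if b = a then x k else 0))
        = (if b = a then nrm e (lin g e B (\<alpha> a) x) else 0)" for b
      by (simp add: lin_def nrm_def)
    have **: "nrm e (\<lambda>k. if b = a then x k else 0) = (if b = a then nrm e x else 0)" for b
      by (simp add: nrm_def)
    show ?thesis using diagB[of "\<lambda>k b. if b = a then x k else 0"] a
      unfolding diagf_def nsq_columns * ** by simp
  qed

  \<comment> \<open>Without such a vector, a bound slightly below \<open>1 + \<epsilon> * C\<close>
    would hold for \<open>B\<close>, hence for \<open>E\<close>, where \<open>\<xi>\<close> violates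
    it.\<close>
  have "\<exists>\<zeta>\<in>sphere2 e {..d}. nsq e {..d} \<zeta> - diagf g e B \<alpha> d \<zeta> = 0 \<and> C * nsq e {..d} \<zeta> - fB \<zeta> \<le> 0"
  proof (rule ccontr)
    assume "\<not> ?thesis"
    then have pos: "0 < C * nsq e {..d} v - fB v"
      if "v \<in> sphere2 e {..d}" "nsq e {..d} v - diagf g e B \<alpha> d v = 0" for v using that by force
    let ?q0 = "\<lambda>v. nsq e {..d} v - diagf g e B \<alpha> d v" and ?q1 = "\<lambda>v. C * nsq e {..d} v - fB v"
    have "continuous_on (sphere2 e {..d}) ?q0" "continuous_on (sphere2 e {..d}) ?q1"
      unfolding fB_def by (intro continuous_intros)+
    from compact_pos_combination[OF compact_sphere2 this] pos diagB
    obtain \<epsilon> \<delta> where ed: "\<epsilon> > 0" "\<delta> > 0"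
      and b: "\<And>v. v \<in> sphere2 e {..d} \<Longrightarrow> \<delta> \<le> ?q0 v + \<epsilon> * ?q1 v" by auto
    have b': "\<delta> * nsq e {..d} v \<le> ?q0 v + \<epsilon> * ?q1 v" for v
    proof (rule homogeneous_lower_bound[of "{..d}" "\<lambda>v. ?q0 v + \<epsilon> * ?q1 v"])
      show "?q0 (\<lambda>i s. of_real c * v i s) + \<epsilon> * ?q1 (\<lambda>i s. of_real c * v i s) = c\<^sup>2 * (?q0 v + \<epsilon> * ?q1 v)"
        for c v unfolding nsq_scale diagf_scale fB_scale by (simp add: algebra_simps)
      show "?q0 v + \<epsilon> * ?q1 v = ?q0 v' + \<epsilon> * ?q1 v'"
        if "\<And>i s. i < e \<Longrightarrow> s \<in> {..d} \<Longrightarrow> v i s = v' i s" for v v'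
        using nsq_cong[of e "{..d}" v v'] diagf_cong[of e d v v' g B \<alpha>] fB_cong[of v v'] that by simp
    qed (use b in auto)
    \<comment> \<open>The cap 1/2 keeps the bound \<open>1 + \<epsilon> * C - \<delta>'\<close>
      positive, as \<open>form_transfer\<close> requires.\<close>
    define \<delta>' where "\<delta>' = min \<delta> (1/2)"
    have d': "0 < \<delta>'" "\<delta>' \<le> \<delta>" "\<delta>' \<le> 1/2" using ed unfolding \<delta>'_def by auto
    have "diagf g e B \<alpha> d v + (\<Sum>r\<in>ridx g d. (\<epsilon> * w r) * rowf e B r v)
        \<le> (1 + \<epsilon> * C - \<delta>') * nsq e {..d} v" for v
    proof -
      have "(\<Sum>r\<in>ridx g d. (\<epsilon> * w r) * rowf e B r v) = \<epsilon> * fB v"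
        unfolding fB_def R_def by (simp add: sum_distrib_left mult_ac)
      moreover have "\<delta>' * nsq e {..d} v \<le> \<delta> * nsq e {..d} v"
        using d' by (intro mult_right_mono) auto
      ultimately show ?thesis using b'[of v] by (simp add: algebra_simps)
    qed
    moreover have "0 < 1 + \<epsilon> * C - \<delta>'" using d' ed C0 mult_nonneg_nonneg[of \<epsilon> C] by linarith
    moreover have "0 \<le> \<epsilon> * w r" if "r \<in> ridx g d" for r using ed w[of r] that unfolding R_def by simp
    ultimately have "diagf g d E \<alpha> d \<xi> + (\<Sum>r\<in>ridx g d. (\<epsilon> * w r) * rowf d E r \<xi>)
        \<le> (1 + \<epsilon> * C - \<delta>') * nsq d {..d} \<xi>" by (intro BE) auto
    moreover have "(\<Sum>r\<in>ridx g d. (\<epsilon> * w r) * rowf d E r \<xi>) = \<epsilon> * C"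
      unfolding fE\<xi>[symmetric] fE_def R_def by (simp add: sum_distrib_left mult_ac)
    ultimately show False using diag\<xi> nsq\<xi> d' by simp
  qed
  then obtain \<eta> where \<eta>: "\<eta> \<in> sphere2 e {..d}" and \<eta>0: "nsq e {..d} \<eta> - diagf g e B \<alpha> d \<eta> = 0"
    and \<eta>1: "C * nsq e {..d} \<eta> - fB \<eta> \<le> 0" by auto
  have n\<eta>: "nsq e {..d} \<eta> = 1" using \<eta> unfolding sphere2_def by simp
  have d\<eta>: "diagf g e B \<alpha> d \<eta> = 1" and f\<eta>: "fB \<eta> \<ge> C" using n\<eta> \<eta>0 \<eta>1 by auto

  \<comment> \<open>Now from \<open>E\<close> to \<open>B\<close>: for any \<sigma> above the row
    value at \<open>\<xi>\<close> the perturbed inequality holds for \<open>E\<close>; read at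
    \<open>\<eta>\<close>, where the first two forms are as large as possible, it bounds the row
    value by \<sigma>.\<close>
  have row_le: "rowf e B r \<eta> \<le> rowf d E r \<xi>" if r: "r \<in> R" for r
  proof (rule field_le_epsilon)
    fix \<kappa> :: real assume \<kappa>: "\<kappa> > 0"
    define \<sigma> where "\<sigma> = rowf d E r \<xi> + \<kappa>"
    have rn: "rowf n A r v \<ge> 0" for n A v unfolding rowf_def by (auto split: prod.splits)
    have \<sigma>: "\<sigma> > 0" using rn[of d E \<xi>] \<kappa> unfolding \<sigma>_def by linarith
    let ?q0 = "\<lambda>v. nsq d {..d} v - diagf g d E \<alpha> d v" and ?q1 = "\<lambda>v. C * nsq d {..d} v - fE v"
      and ?q2 = "\<lambda>v. \<sigma> * nsq d {..d} v - rowf d E r v"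
    \<comment> \<open>Compactness is used twice: the two lower forms are first combined on the
      maximizers of \<open>diagf\<close> alone, and the result is then added to the leading form
      with a small factor.\<close>
    define S2 where "S2 = sphere2 d {..d} \<inter> {v. ?q0 v = 0}"
    have cl: "closed {v. ?q0 v = 0}" by (intro closed_Collect_eq continuous_intros)
    have S2: "compact S2" unfolding S2_def by (intro compact_Int_closed compact_sphere2 cl) simp
    have cont: "continuous_on A ?q0" "continuous_on A ?q1" "continuous_on A ?q2" for A
      unfolding fE_def by (intro continuous_intros)+
    have col: "\<exists>t. \<forall>i a. i < d \<longrightarrow> a \<le> d \<longrightarrow> v i a = t a * u a i" if v: "v \<in> S2" for v
    proof -
      have "(\<Sum>a\<le>d. nrm d (\<lambda>i. v i a) - nrm d (lin g d E (\<alpha> a) (\<lambda>k. v k a))) = 0"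
        using v unfolding S2_def nsq_columns diagf_def by (simp add: sum_subtractf)
      then have "nrm d (\<lambda>i. v i a) - nrm d (lin g d E (\<alpha> a) (\<lambda>k. v k a)) = 0" if "a \<le> d" for a
        using that contr by (subst (asm) sum_nonneg_eq_0_iff) auto
      then have "\<exists>c. \<forall>i<d. v i a = c * u a i" if "a \<le> d" for a
        using uniq[OF that, of "\<lambda>i. v i a"] that by simp
      then show ?thesis by metis
    qed
    have q1: "0 \<le> ?q1 v" if v: "v \<in> S2" for v
    proof -
      obtain t where t: "\<And>i a. i < d \<Longrightarrow> a \<le> d \<Longrightarrow> v i a = t a * u a i" using col[OF v] by blast
      have fe: "fE v = C * nsq d {..d} v - 2 * (\<Sum>j<g. nrm d (mv d (E j) (\<lambda>k. \<Sum>a\<le>d. t a * u a k)))"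
        by (rule fE_peak) (rule t)
      show ?thesis unfolding fe by (simp add: sum_nonneg)
    qed
    have q2: "0 < ?q2 v" if v: "v \<in> S2" and z: "?q1 v = 0" for v
    proof -
      obtain t where t: "\<And>i a. i < d \<Longrightarrow> a \<le> d \<Longrightarrow> v i a = t a * u a i" using col[OF v] by blast
      have fe: "fE v = C * nsq d {..d} v - 2 * (\<Sum>j<g. nrm d (mv d (E j) (\<lambda>k. \<Sum>a\<le>d. t a * u a k)))"
        by (rule fE_peak) (rule t)
      have "(\<Sum>j<g. nrm d (mv d (E j) (\<lambda>k. \<Sum>a\<le>d. t a * u a k))) = 0"
        using z unfolding fe by simp
      then have "nrm d (mv d (E j) (\<lambda>k. \<Sum>a\<le>d. t a * u a k)) = 0" if "j < g" for j
        using that by (subst (asm) sum_nonneg_eq_0_iff) auto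
      then have "(\<Sum>a\<le>d. t a * u a i) = 0" if "i < d" for i
        using gen_data_common_kernel[OF gd, of "\<lambda>k. \<Sum>a\<le>d. t a * u a k" i] nrm_zero that by blast
      then have "t a = t 0" if "a \<le> d" for a using hyper that by blast
      then have v': "v i a = t 0 * \<xi> i a" if "i < d" "a \<le> d" for i a
        using t that unfolding \<xi>_def by metis
      have "nsq d {..d} v = nsq d {..d} (\<lambda>i a. t 0 * \<xi> i a)" using v' by (intro nsq_cong) auto
      then have n: "(cmod (t 0))\<^sup>2 = 1" using v nsq\<xi> unfolding nsq_scale S2_def sphere2_def by simp
      have "rowf d E r v = rowf d E r (\<lambda>i a. t 0 * \<xi> i a)"
        using v' r unfolding R_def by (intro rowf_cong[of d d]) auto
      then show ?thesis using v n \<kappa> unfolding rowf_scale \<sigma>_def S2_def sphere2_def by simp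
    qed
    from compact_pos_combination[OF S2 cont(2,3)] q1 q2
    obtain s \<delta> where s: "s > 0" "\<delta> > 0" "\<And>v. v \<in> S2 \<Longrightarrow> \<delta> \<le> ?q1 v + s * ?q2 v" by auto
    have "continuous_on (sphere2 d {..d}) (\<lambda>v. ?q1 v + s * ?q2 v)"
      by (intro continuous_on_add continuous_on_mult continuous_on_const cont)
    moreover have "0 < ?q1 v + s * ?q2 v" if "v \<in> sphere2 d {..d}" "?q0 v = 0" for v
      using s(2) s(3)[of v] that unfolding S2_def by force
    ultimately obtain \<epsilon> \<delta>' where ed: "\<epsilon> > 0" "\<delta>' > 0"
      "\<And>v. v \<in> sphere2 d {..d} \<Longrightarrow> \<delta>' \<le> ?q0 v + \<epsilon> * (?q1 v + s * ?q2 v)"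
      using compact_pos_combination[OF compact_sphere2[of "{..d}" d] cont(1)[of "sphere2 d {..d}"], of "\<lambda>v. ?q1 v + s * ?q2 v"]
        diagE by auto
    have b': "\<delta>' * nsq d {..d} v \<le> ?q0 v + \<epsilon> * (?q1 v + s * ?q2 v)" for v
    proof (rule homogeneous_lower_bound[of "{..d}" "\<lambda>v. ?q0 v + \<epsilon> * (?q1 v + s * ?q2 v)"])
      show "?q0 (\<lambda>i s. of_real c * v i s) + \<epsilon> * (?q1 (\<lambda>i s. of_real c * v i s) + s * ?q2 (\<lambda>i s. of_real c * v i s))
          = c\<^sup>2 * (?q0 v + \<epsilon> * (?q1 v + s * ?q2 v))"
        for c v unfolding nsq_scale diagf_scale fE_scale rowf_scale by (simp add: algebra_simps)
      show "?q0 v + \<epsilon> * (?q1 v + s * ?q2 v) = ?q0 v' + \<epsilon> * (?q1 v' + s * ?q2 v')"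
        if "\<And>i s. i < d \<Longrightarrow> s \<in> {..d} \<Longrightarrow> v i s = v' i s" for v v'
        using nsq_cong[of d "{..d}" v v'] diagf_cong[of d d v v' g E \<alpha>] fE_cong[of v v']
          rowf_cong[of d d v v' r g E] r that unfolding R_def by simp
    qed (use ed in auto)
    define w' where "w' r' = \<epsilon> * (w r' + (if r' = r then s else 0))" for r'
    have w'sum: "(\<Sum>r'\<in>ridx g d. w' r' * rowf n A r' v)
        = \<epsilon> * ((\<Sum>r'\<in>R. w r' * rowf n A r' v) + s * rowf n A r v)" for n A v
    proof -
      have "(\<Sum>r'\<in>R. w' r' * rowf n A r' v)
          = (\<Sum>r'\<in>R. \<epsilon> * (w r' * rowf n A r' v) + (if r' = r then \<epsilon> * (s * rowf n A r v) else 0))"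
        unfolding w'_def by (intro sum.cong) (auto simp: algebra_simps)
      also have "\<dots> = \<epsilon> * ((\<Sum>r'\<in>R. w r' * rowf n A r' v) + s * rowf n A r v)"
        using r fR by (simp add: sum.distrib sum_distrib_left distrib_left)
      finally show ?thesis unfolding R_def .
    qed
    have "diagf g e B \<alpha> d \<eta> + (\<Sum>r'\<in>ridx g d. w' r' * rowf e B r' \<eta>)
        \<le> (1 + \<epsilon> * (C + s * \<sigma>)) * nsq e {..d} \<eta>"
    proof (rule EB)
      show "0 < 1 + \<epsilon> * (C + s * \<sigma>)" using ed s \<sigma> C0 by (intro add_pos_nonneg mult_nonneg_nonneg add_nonneg_nonneg) auto
      show "0 \<le> w' r'" if "r' \<in> ridx g d" for r' using that w[of r'] s ed unfolding w'_def R_def by auto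
      show "diagf g d E \<alpha> d v + (\<Sum>r'\<in>ridx g d. w' r' * rowf d E r' v)
        \<le> (1 + \<epsilon> * (C + s * \<sigma>)) * nsq d {..d} v" for v
      proof -
        have "0 \<le> ?q0 v + \<epsilon> * (?q1 v + s * ?q2 v)" using b'[of v] ed(2) nsq_nonneg[of d "{..d}" v]
          by (meson less_imp_le mult_nonneg_nonneg order_trans)
        then show ?thesis unfolding w'sum fE_def[symmetric] by (simp add: algebra_simps)
      qed
    qed
    then have "\<epsilon> * (fB \<eta> + s * rowf e B r \<eta>) \<le> \<epsilon> * (C + s * \<sigma>)"
      unfolding w'sum fB_def[symmetric] d\<eta> n\<eta> by simp
    then have "fB \<eta> + s * rowf e B r \<eta> \<le> C + s * \<sigma>" using ed(1) by simp
    then have "s * rowf e B r \<eta> \<le> s * \<sigma>" using f\<eta> by linarith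
    then show "rowf e B r \<eta> \<le> rowf d E r \<xi> + \<kappa>" using s(1) unfolding \<sigma>_def by simp
  qed
  \<comment> \<open>No row of \<open>B\<close> at \<open>\<eta>\<close> exceeds that of
    \<open>E\<close> at \<open>\<xi>\<close>, yet the weighted sum over \<open>B\<close> is at least
    as large and all weights are positive.\<close>
  have row_eq: "rowf e B r \<eta> = rowf d E r \<xi>" if r: "r \<in> R" for r
  proof -
    have "(\<Sum>r\<in>R. w r * (rowf d E r \<xi> - rowf e B r \<eta>)) = fE \<xi> - fB \<eta>"
      unfolding fE_def fB_def by (simp add: algebra_simps sum_subtractf)
    then have le: "(\<Sum>r\<in>R. w r * (rowf d E r \<xi> - rowf e B r \<eta>)) \<le> 0" using f\<eta> fE\<xi> by simp
    have nn: "0 \<le> w r * (rowf d E r \<xi> - rowf e B r \<eta>)" if "r \<in> R" for r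
      using w[OF that] row_le[OF that] by simp
    have "(\<Sum>r\<in>R. w r * (rowf d E r \<xi> - rowf e B r \<eta>)) = 0" using le nn by (meson antisym sum_nonneg)
    then have "w r * (rowf d E r \<xi> - rowf e B r \<eta>) = 0" using r nn fR by (simp add: sum_nonneg_eq_0_iff)
    then show ?thesis using w[OF r] by simp
  qed
  define \<zeta> where "\<zeta> a i = \<eta> i a" for a i
  show ?thesis
  proof (rule that[of \<zeta>])
    show "(\<Sum>a\<le>d. nrm e (\<zeta> a)) = 1" using n\<eta> unfolding nsq_columns \<zeta>_def .
    show "nrm e (lin g e B (\<alpha> a) x) \<le> nrm e x" if "a \<le> d" for a x by (rule contrB[OF that])
    show "nrm e (lin g e B (\<alpha> a) (\<zeta> a)) = nrm e (\<zeta> a)" if "a \<le> d" for a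
    proof -
      have "(\<Sum>a\<le>d. nrm e (\<zeta> a) - nrm e (lin g e B (\<alpha> a) (\<zeta> a))) = 0"
        using \<eta>0 unfolding nsq_columns diagf_def \<zeta>_def by (simp add: sum_subtractf)
      then show ?thesis using that contrB by (subst (asm) sum_nonneg_eq_0_iff) auto
    qed
    show "ip e (mv e (B j) (\<zeta> a)) (mv e (B k) (\<zeta> b)) = ip d (mv d (E j) (u a)) (mv d (E k) (u b))"
      if "a \<le> d" "b \<le> d" "j < g" "k < g" for a b j k
    proof -
      have *: "nrm e (\<lambda>i. mv e (B j) (\<zeta> a) i + \<omega> * mv e (B k) (\<zeta> b) i)
          = nrm d (\<lambda>i. mv d (E j) (u a) i + \<omega> * mv d (E k) (u b) i)" if "\<omega> \<in> {1, -1, \<i>, -\<i>}" for \<omega>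
        using row_eq[of "(a, j, b, k, \<omega>)"] that \<open>a \<le> d\<close> \<open>b \<le> d\<close> \<open>j < g\<close> \<open>k < g\<close>
        unfolding R_def ridx_def rowf_def \<zeta>_def \<xi>_def by auto
      have "4 * ip e (mv e (B j) (\<zeta> a)) (mv e (B k) (\<zeta> b)) = 4 * ip d (mv d (E j) (u a)) (mv d (E k) (u b))"
        unfolding polarization by (simp only: * insert_iff simp_thms)
      then show ?thesis by simp
    qed
  qed
qed

section \<open>Isometries from equal Gram matrices\<close>

text \<open>Coefficients are chosen for the unit vectors only. This makes them linear in
  \<open>z\<close>, even if the spanning family has relations.\<close>

lemma spanning_coefficients:
  fixes x :: "'r \<Rightarrow> nat \<Rightarrow> complex"
  assumes "\<And>z. \<exists>c. \<forall>i<d. z i = (\<Sum>r\<in>R. c r * x r i)"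
  obtains \<kappa> where "\<And>i z. i < d \<Longrightarrow> (\<Sum>r\<in>R. (\<Sum>k<d. \<kappa> k r * z k) * x r i) = z i"
proof -
  have "\<forall>k. \<exists>c. \<forall>i<d. (if i = k then 1 else 0) = (\<Sum>r\<in>R. c r * x r i)"
    by (intro allI) (rule assms)
  then obtain \<kappa> where \<kappa>: "\<And>k i. i < d \<Longrightarrow> (if i = k then 1 else 0) = (\<Sum>r\<in>R. \<kappa> k r * x r i)" by metis
  show ?thesis
  proof (rule that[of \<kappa>])
    fix i z assume i: "i < d"
    have "(\<Sum>r\<in>R. (\<Sum>k<d. \<kappa> k r * z k) * x r i) = (\<Sum>k<d. z k * (\<Sum>r\<in>R. \<kappa> k r * x r i))"
      by (simp add: sum_distrib_left sum_distrib_right) (subst sum.swap, simp add: mult_ac)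
    also have "\<dots> = (\<Sum>k<d. if i = k then z k else 0)"
      by (intro sum.cong refl) (simp add: \<kappa>[OF i, symmetric])
    also have "\<dots> = z i" using i by simp
    finally show "(\<Sum>r\<in>R. (\<Sum>k<d. \<kappa> k r * z k) * x r i) = z i" .
  qed
qed

lemma mv_combination:
  "mv d (\<lambda>i k. \<Sum>r\<in>R. \<kappa> k r * b r i) z i = (\<Sum>r\<in>R. (\<Sum>k<d. \<kappa> k r * z k) * b r i)"
  unfolding mv_def by (simp add: sum_distrib_left sum_distrib_right) (subst sum.swap, simp add: mult_ac)

text \<open>\<open>W\<close> is defined through chosen coefficients, so \<open>W x_r = b_r\<close>
  is not automatic when the \<open>x_r\<close> are dependent; the Gram identities show that the
  difference has norm zero.\<close>

lemma gram_isometry: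
  fixes x b :: "'r \<Rightarrow> nat \<Rightarrow> complex"
  assumes span: "\<And>z. \<exists>c. \<forall>i<d. z i = (\<Sum>r\<in>R. c r * x r i)"
    and gram: "\<And>r s. r \<in> R \<Longrightarrow> s \<in> R \<Longrightarrow> ip e (b r) (b s) = ip d (x r) (x s)"
  obtains W where "\<And>y z. ip e (mv d W y) (mv d W z) = ip d y z"
    and "\<And>r i. r \<in> R \<Longrightarrow> i < e \<Longrightarrow> mv d W (x r) i = b r i"
proof -
  obtain \<kappa> where \<kappa>: "\<And>i z. i < d \<Longrightarrow> (\<Sum>r\<in>R. (\<Sum>k<d. \<kappa> k r * z k) * x r i) = z i"
    using spanning_coefficients[OF span] by blast
  define W where "W i k = (\<Sum>r\<in>R. \<kappa> k r * b r i)" for i k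
  let ?c = "\<lambda>z r. \<Sum>k<d. \<kappa> k r * z k"
  have W: "mv d W z = (\<lambda>i. \<Sum>r\<in>R. ?c z r * b r i)" for z unfolding W_def mv_combination ..
  have x: "ip d y z = ip d (\<lambda>i. \<Sum>r\<in>R. ?c y r * x r i) z" for y z by (rule ip_cong) (use \<kappa> in auto)
  have ipb: "ip e (mv d W z) (b s) = ip d z (x s)" if "s \<in> R" for z s
    unfolding W x[of z] ip_sum_left using gram that by simp
  have iso: "ip e (mv d W y) (mv d W z) = ip d y z" for y z
  proof -
    have "ip d y z = ip d y (\<lambda>i. \<Sum>r\<in>R. ?c z r * x r i)" by (rule ip_cong) (use \<kappa> in auto)
    then show ?thesis unfolding W[of z] ip_sum_right using ipb by simp
  qed
  have "mv d W (x r) i = b r i" if r: "r \<in> R" and i: "i < e" for r i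
  proof -
    have "of_real (nrm e (mv d W (x r))) = (of_real (nrm d (x r)) :: complex)" unfolding nrm_ip iso ..
    moreover have "of_real (nrm e (b r)) = (of_real (nrm d (x r)) :: complex)" unfolding nrm_ip using gram r by simp
    ultimately have "nrm e (\<lambda>i. mv d W (x r) i + (-1) * b r i) = 0"
      unfolding nrm_add_scaled ipb[OF r] by (simp add: nrm_ip[symmetric])
    from nrm_zero[OF this i] show ?thesis by simp
  qed
  then show ?thesis using that[of W] iso by blast
qed

lemma isometry_columns:
  assumes iso: "\<And>y z. ip e (mv d W y) (mv d W z) = ip d y z" and "k < d" "l < d"
  shows "(\<Sum>i<e. W i k * cnj (W i l)) = (if k = l then 1 else 0)"
proof -
  have mv: "mv d W (\<lambda>h. if h = m then 1 else 0) = (\<lambda>i. W i m)" if "m < d" for m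
    using that unfolding mv_def by (simp add: if_distrib cong: if_cong)
  have "(\<Sum>i<e. W i k * cnj (W i l)) = ip d (\<lambda>h. if h = k then 1 else 0) (\<lambda>h. if h = l then 1 else 0)"
    using iso[of "\<lambda>h. if h = k then 1 else 0" "\<lambda>h. if h = l then 1 else 0"]
    unfolding mv[OF assms(2)] mv[OF assms(3)] by (simp add: ip_def[of e])
  also have "\<dots> = (\<Sum>h<d. if h = k then (if k = l then 1 else 0) else 0)"
    unfolding ip_def by (intro sum.cong) auto
  also have "\<dots> = (if k = l then 1 else 0)" using assms(2) by simp
  finally show ?thesis .
qed

text \<open>The \<open>d\<close> columns have total square norm \<open>d\<close>, while no row has norm above \<open>1\<close>.\<close>

lemma isometry_dim_le:
  assumes iso: "\<And>y z. ip e (mv d W y) (mv d W z) = ip d y z"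
  shows "d \<le> e"
proof -
  have row: "nrm d (\<lambda>k. cnj (W i k)) \<le> 1" if i: "i < e" for i
  proof -
    let ?x = "\<lambda>k. cnj (W i k)"
    have "of_real (nrm e (mv d W ?x)) = (of_real (nrm d ?x) :: complex)" unfolding nrm_ip iso ..
    then have 1: "nrm e (mv d W ?x) = nrm d ?x" by simp
    have "mv d W ?x i = of_real (nrm d ?x)" unfolding mv_def nrm_ip ip_def by (simp add: mult.commute)
    then have "(nrm d ?x)\<^sup>2 = (cmod (mv d W ?x i))\<^sup>2" by simp
    also have "\<dots> \<le> nrm d ?x" unfolding 1[symmetric] nrm_def[of e] using i by (intro member_le_sum) auto
    finally have "nrm d ?x * nrm d ?x \<le> 1 * nrm d ?x" by (simp add: power2_eq_square)
    then show ?thesis using nrm_nonneg[of d ?x]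
      by (cases "nrm d ?x = 0") (auto simp del: nrm_nonneg)
  qed
  have "complex_of_real (real d) = (\<Sum>k<d. \<Sum>i<e. W i k * cnj (W i k))"
    using isometry_columns[OF iso] by simp
  also have "\<dots> = of_real (\<Sum>k<d. \<Sum>i<e. (cmod (W i k))\<^sup>2)"
    unfolding of_real_sum by (simp only: complex_norm_square)
  finally have "real d = (\<Sum>k<d. \<Sum>i<e. (cmod (W i k))\<^sup>2)" by (simp only: of_real_eq_iff)
  also have "\<dots> = (\<Sum>i<e. nrm d (\<lambda>k. cnj (W i k)))" unfolding nrm_def by (subst sum.swap) simp
  also have "\<dots> \<le> (\<Sum>i<e. 1)" using row by (intro sum_mono) auto
  finally show ?thesis by simp
qed

text \<open>\<open>W\<close> sends \<open>E_j u_a\<close> to \<open>B_j \<zeta>_a\<close> and is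
  defined everywhere because the ranges of the \<open>E_j\<close> span; \<open>V\<close> sends
  \<open>u_a\<close> to \<open>\<zeta>_a\<close>. \<open>W\<close> is isometric by the equality of
  Gram matrices, \<open>V\<close> because an inner product with a peak vector may be computed after
  applying \<open>\<Lambda>\<close>.\<close>

lemma gen_data_equivalence:
  fixes E B :: "nat \<Rightarrow> nat \<Rightarrow> nat \<Rightarrow> complex"
  assumes gE: "gen_data g d E \<alpha> u" and gB: "gen_data g e B \<alpha>' u'"
    and T: "\<And>(R :: (nat + nat \<times> nat \<times> nat \<times> nat \<times> complex) set) x. finite R \<Longrightarrow>
       fball g d E R {..d::nat} x \<longleftrightarrow> fball g e B R {..d} x"
  obtains W V where "d \<le> e" and "\<And>y z. ip e (mv d W y) (mv d W z) = ip d y z"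
    and "\<And>y z. ip e (mv d V y) (mv d V z) = ip d y z"
    and "\<And>j y i. j < g \<Longrightarrow> i < e \<Longrightarrow> mv e (B j) (mv d V y) i = mv d W (mv d (E j) y) i"
proof -
  obtain \<zeta> where
    contr: "\<And>a x. a \<le> d \<Longrightarrow> nrm e (lin g e B (\<alpha> a) x) \<le> nrm e x" and
    peak: "\<And>a. a \<le> d \<Longrightarrow> nrm e (lin g e B (\<alpha> a) (\<zeta> a)) = nrm e (\<zeta> a)" and
    gram: "\<And>a b j k. a \<le> d \<Longrightarrow> b \<le> d \<Longrightarrow> j < g \<Longrightarrow> k < g \<Longrightarrow>
       ip e (mv e (B j) (\<zeta> a)) (mv e (B k) (\<zeta> b)) = ip d (mv d (E j) (u a)) (mv d (E k) (u b))"
    using gram_transfer[OF gE T] by metis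
  have contrE: "\<And>a x. a \<le> d \<Longrightarrow> nrm d (lin g d E (\<alpha> a) x) \<le> nrm d x"
    and peakE: "\<And>a. a \<le> d \<Longrightarrow> nrm d (lin g d E (\<alpha> a) (u a)) = nrm d (u a)"
    and span: "\<And>x. \<exists>t. \<forall>i<d. x i = (\<Sum>a\<le>d. t a * u a i)"
    and range: "\<And>x. \<exists>\<kappa>. \<forall>i<d. x i = (\<Sum>j<g. mv d (E j) (\<kappa> j) i)"
    using gE unfolding gen_data_def by auto
  let ?R = "{..d} \<times> {..<g}"
  let ?x = "\<lambda>(a, j). mv d (E j) (u a)" and ?b = "\<lambda>(a, j). mv e (B j) (\<zeta> a)"
  have spanR: "\<exists>c. \<forall>i<d. z i = (\<Sum>r\<in>?R. c r * ?x r i)" for z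
  proof -
    obtain \<kappa> where \<kappa>: "\<And>i. i < d \<Longrightarrow> z i = (\<Sum>j<g. mv d (E j) (\<kappa> j) i)" using range[of z] by blast
    have "\<forall>j. \<exists>t. \<forall>i<d. \<kappa> j i = (\<Sum>a\<le>d. t a * u a i)" by (intro allI) (rule span)
    then obtain t where t: "\<And>j i. i < d \<Longrightarrow> \<kappa> j i = (\<Sum>a\<le>d. t j a * u a i)" by metis
    have "z i = (\<Sum>r\<in>?R. (\<lambda>(a, j). t j a) r * ?x r i)" if i: "i < d" for i
    proof -
      have "z i = (\<Sum>j<g. mv d (E j) (\<lambda>k. \<Sum>a\<le>d. t j a * u a k) i)"
        unfolding \<kappa>[OF i] by (intro sum.cong refl mv_cong) (use t in auto)
      also have "\<dots> = (\<Sum>a\<le>d. \<Sum>j<g. t j a * mv d (E j) (u a) i)"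
        unfolding mv_sum by (rule sum.swap)
      also have "\<dots> = (\<Sum>r\<in>?R. (\<lambda>(a, j). t j a) r * ?x r i)"
        unfolding sum.cartesian_product by (intro sum.cong) auto
      finally show ?thesis .
    qed
    then show ?thesis by blast
  qed
  have gramR: "ip e (?b r) (?b s) = ip d (?x r) (?x s)" if "r \<in> ?R" "s \<in> ?R" for r s
    using that gram by auto
  from gram_isometry[of d ?x ?R e ?b, OF spanR gramR]
  obtain W where isoW: "\<And>y z. ip e (mv d W y) (mv d W z) = ip d y z"
    and Wr: "\<And>r i. r \<in> ?R \<Longrightarrow> i < e \<Longrightarrow> mv d W (?x r) i = ?b r i" by blast
  have W: "mv d W (mv d (E j) (u a)) i = mv e (B j) (\<zeta> a) i" if "a \<le> d" "j < g" "i < e" for a j i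
    using Wr[of "(a, j)" i] that by auto
  obtain \<kappa> where \<kappa>: "\<And>i z. i < d \<Longrightarrow> (\<Sum>a\<le>d. (\<Sum>k<d. \<kappa> k a * z k) * u a i) = z i"
    using spanning_coefficients[of d u "{..d}"] span by blast
  define V where "V i k = (\<Sum>a\<le>d. \<kappa> k a * \<zeta> a i)" for i k
  let ?c = "\<lambda>z a. \<Sum>k<d. \<kappa> k a * z k"
  have V: "mv d V z = (\<lambda>i. \<Sum>a\<le>d. ?c z a * \<zeta> a i)" for z unfolding V_def mv_combination ..
  have BV: "mv e (B j) (mv d V y) i = mv d W (mv d (E j) y) i" if "j < g" "i < e" for j y i
  proof -
    have "mv e (B j) (mv d V y) i = (\<Sum>a\<le>d. ?c y a * mv d W (mv d (E j) (u a)) i)"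
      unfolding V mv_sum using W that by simp
    also have "\<dots> = mv d W (\<lambda>k. \<Sum>a\<le>d. ?c y a * mv d (E j) (u a) k) i" by (rule mv_sum[symmetric])
    also have "(\<lambda>k. \<Sum>a\<le>d. ?c y a * mv d (E j) (u a) k) = mv d (E j) (\<lambda>k. \<Sum>a\<le>d. ?c y a * u a k)"
      by (intro ext) (rule mv_sum[symmetric])
    also have "mv d (E j) (\<lambda>k. \<Sum>a\<le>d. ?c y a * u a k) = mv d (E j) y"
      by (intro ext mv_cong) (use \<kappa> in auto)
    finally show ?thesis .
  qed
  \<comment> \<open>The difference of both sides is killed by all \<open>B_j\<close>, which have no
    common kernel.\<close>
  have Vu: "mv d V (u a) i = \<zeta> a i" if a: "a \<le> d" and i: "i < e" for a i
  proof -
    have "mv e (B j) (\<lambda>k. mv d V (u a) k + (-1) * \<zeta> a k) l = 0" if "j < g" "l < e" for j l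
      unfolding mv_add_scaled using BV[OF that] W[OF a that] by simp
    from gen_data_common_kernel[OF gB this i] show ?thesis by simp
  qed
  have linV: "lin g e B \<beta> (mv d V y) i = mv d W (lin g d E \<beta> y) i" if "i < e" for \<beta> y i
  proof -
    have "lin g e B \<beta> (mv d V y) i = (\<Sum>j<g. \<beta> j * mv d W (mv d (E j) y) i)"
      unfolding lin_mv using BV that by simp
    also have "\<dots> = mv d W (lin g d E \<beta> y) i"
      unfolding mv_sum[symmetric] by (rule mv_cong) (simp add: lin_mv)
    finally show ?thesis .
  qed
  \<comment> \<open>\<open>peak_ip\<close> is applied on both sides; in between, the isometry
    \<open>W\<close> carries the images under \<open>\<Lambda>_E\<close> to those under
    \<open>\<Lambda>_B\<close>.\<close>
  have ipV: "ip e (\<zeta> a) (mv d V y) = ip d (u a) y" if a: "a \<le> d" for a y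
  proof -
    have "ip e (\<zeta> a) (mv d V y) = ip e (lin g e B (\<alpha> a) (\<zeta> a)) (lin g e B (\<alpha> a) (mv d V y))"
      using peak_ip[of e g B "\<alpha> a", OF contr peak] a by simp
    also have "lin g e B (\<alpha> a) (\<zeta> a) = lin g e B (\<alpha> a) (mv d V (u a))"
      unfolding lin_def using Vu[OF a] by (intro ext sum.cong refl) auto
    also have "ip e (lin g e B (\<alpha> a) (mv d V (u a))) (lin g e B (\<alpha> a) (mv d V y))
        = ip e (mv d W (lin g d E (\<alpha> a) (u a))) (mv d W (lin g d E (\<alpha> a) y))"
      by (rule ip_cong) (simp_all add: linV)
    also have "\<dots> = ip d (u a) y" unfolding isoW using peak_ip[of d g E "\<alpha> a", OF contrE peakE] a by simp
    finally show ?thesis .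
  qed
  have isoV: "ip e (mv d V y) (mv d V z) = ip d y z" for y z
  proof -
    have "ip d y z = ip d (\<lambda>i. \<Sum>a\<le>d. ?c y a * u a i) z" by (rule ip_cong) (use \<kappa> in auto)
    then show ?thesis unfolding V[of y] ip_sum_left using ipV by simp
  qed
  show ?thesis using that[OF isometry_dim_le[OF isoW] isoW isoV BV] .
qed

section \<open>Free maps on matrices over finite index sets\<close>

abbreviation (input) cf :: "complex mat list \<Rightarrow> nat \<Rightarrow> nat \<Rightarrow> nat \<Rightarrow> complex" where
  "cf A \<equiv> \<lambda>j i k. A ! j $$ (i, k)"

text \<open>\<open>tup\<close> and \<open>vf\<close> turn matrices and vectors indexed by an arbitrary finite set \<open>I\<close> into those of
  the library, through an enumeration \<open>h\<close> of \<open>I\<close>; \<open>ev\<close> evaluates a free map on such matrices.\<close>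

definition tup :: "nat \<Rightarrow> nat \<Rightarrow> (nat \<Rightarrow> 'a) \<Rightarrow> (nat \<Rightarrow> 'a \<Rightarrow> 'a \<Rightarrow> complex) \<Rightarrow> complex mat list" where
  "tup g N h x = map (\<lambda>j. Matrix.mat N N (\<lambda>(a, b). x j (h a) (h b))) [0..<g]"

definition vf :: "nat \<Rightarrow> nat \<Rightarrow> (nat \<Rightarrow> 'a) \<Rightarrow> (nat \<Rightarrow> 'a \<Rightarrow> complex) \<Rightarrow> complex Matrix.vec" where
  "vf d N h w = Matrix.vec (d * N) (\<lambda>l. w (l div N) (h (l mod N)))"

definition ev :: "nat \<Rightarrow> (nat \<Rightarrow> complex mat list \<Rightarrow> complex mat list) \<Rightarrow> nat \<Rightarrow> (nat \<Rightarrow> 'a)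
    \<Rightarrow> (nat \<Rightarrow> 'a \<Rightarrow> 'a \<Rightarrow> complex) \<Rightarrow> nat \<Rightarrow> 'a \<Rightarrow> 'a \<Rightarrow> complex" where
  "ev g f N h x i s t = f N (tup g N h x) ! i $$ (inv_into {..<N} h s, inv_into {..<N} h t)"

lemma tup_mtuples [simp]: "tup g N h x \<in> mtuples N g"
  unfolding tup_def mtuples_def by auto

lemma tup_nth: "j < g \<Longrightarrow> a < N \<Longrightarrow> b < N \<Longrightarrow> tup g N h x ! j $$ (a, b) = x j (h a) (h b)"
  unfolding tup_def by simp

lemma mtuples_nth: "X \<in> mtuples n g \<Longrightarrow> j < g \<Longrightarrow> X ! j \<in> carrier_mat n n"
  unfolding mtuples_def by auto

lemma mtuples_length: "X \<in> mtuples n g \<Longrightarrow> length X = g"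
  unfolding mtuples_def by auto

lemma tuple_eqI:
  assumes "X \<in> mtuples n g" "Y \<in> mtuples n g"
    and "\<And>j a b. j < g \<Longrightarrow> a < n \<Longrightarrow> b < n \<Longrightarrow> X ! j $$ (a, b) = Y ! j $$ (a, b)"
  shows "X = Y"
proof (rule nth_equalityI)
  show "length X = length Y" using assms(1,2) by (simp add: mtuples_length)
  fix j assume "j < length X"
  then have j: "j < g" using assms(1) by (simp add: mtuples_length)
  show "X ! j = Y ! j"
    using mtuples_nth[OF assms(1) j] mtuples_nth[OF assms(2) j] assms(3)[OF j] by (intro eq_matI) auto
qed

lemma tup_id: "X \<in> mtuples n g \<Longrightarrow> tup g n id (cf X) = X"
  by (rule tuple_eqI[of _ n g]) (auto simp: tup_nth)

lemma tup_ev: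
  assumes h: "bij_betw h {..<N} I" and f: "f N (tup g N h x) \<in> mtuples N g"
  shows "tup g N h (ev g f N h x) = f N (tup g N h x)"
proof (rule tuple_eqI[OF tup_mtuples f])
  fix j a b assume "j < g" "a < N" "b < N"
  then show "tup g N h (ev g f N h x) ! j $$ (a, b) = f N (tup g N h x) ! j $$ (a, b)"
    using bij_betw_inv_into_left[OF h] by (simp add: tup_nth ev_def)
qed

lemma sum_blocks: "(\<Sum>l<d * N. f l) = (\<Sum>k<d. \<Sum>b<N. f (k * N + b))" for f :: "nat \<Rightarrow> 'b::comm_monoid_add"
proof (induction d)
  case (Suc d)
  have "{..<Suc d * N} = {..<d * N} \<union> (\<lambda>b. d * N + b) ` {..<N}"
  proof -
    have "l \<in> (\<lambda>b. d * N + b) ` {..<N}" if "l < N + d * N" "\<not> l < d * N" for l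
      using that by (intro image_eqI[of _ _ "l - d * N"]) auto
    then show ?thesis by auto
  qed
  moreover have "{..<d * N} \<inter> (\<lambda>b. d * N + b) ` {..<N} = {}" by auto
  ultimately have "(\<Sum>l<Suc d * N. f l) = (\<Sum>l<d * N. f l) + (\<Sum>l\<in>(\<lambda>b. d * N + b) ` {..<N}. f l)"
    by (simp add: sum.union_disjoint)
  also have "(\<Sum>l\<in>(\<lambda>b. d * N + b) ` {..<N}. f l) = (\<Sum>b<N. f (d * N + b))"
    by (subst sum.reindex) (auto simp: inj_on_def)
  finally show ?case using Suc by simp
qed simp

lemma block_index_less: "i < d \<Longrightarrow> a < N \<Longrightarrow> i * N + a < d * (N::nat)"
proof -
  assume "i < d" "a < N"
  then have "i * N + a < Suc i * N" by simp
  also have "\<dots> \<le> d * N" using \<open>i < d\<close> by (intro mult_le_mono1) simp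
  finally show ?thesis .
qed

lemma block_index_cases:
  assumes "l < d * (N::nat)"
  obtains i a where "l = i * N + a" "i < d" "a < N"
proof -
  have "N > 0" using assms by (cases N) auto
  then show ?thesis using that[of "l div N" "l mod N"] assms by (simp add: less_mult_imp_div_less)
qed

lemma sum_bij_h: "bij_betw h {..<N} I \<Longrightarrow> (\<Sum>b<N. f (h b)) = (\<Sum>t\<in>I. f t)"
  by (rule sum.reindex_bij_betw)

lemma vf_nth: "i < d \<Longrightarrow> a < N \<Longrightarrow> vec_index (vf d N h w) (i * N + a) = w i (h a)"
  unfolding vf_def by (simp add: block_index_less)

lemma vf_carrier [simp]: "vf d N h w \<in> carrier_vec (d * N)"
  unfolding vf_def by simp

lemma vf_surj:
  assumes h: "bij_betw h {..<N} I" and v: "v \<in> carrier_vec (d * N)"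
  obtains w where "v = vf d N h w"
proof
  show "v = vf d N h (\<lambda>k t. vec_index v (k * N + inv_into {..<N} h t))"
  proof (rule eq_vecI)
    fix l assume "l < dim_vec (vf d N h (\<lambda>k t. vec_index v (k * N + inv_into {..<N} h t)))"
    then obtain i a where "l = i * N + a" "i < d" "a < N"
      using block_index_cases[of l d N] unfolding vf_def by auto
    then show "vec_index v l = vec_index (vf d N h (\<lambda>k t. vec_index v (k * N + inv_into {..<N} h t))) l"
      using bij_betw_inv_into_left[OF h] by (simp add: vf_nth)
  qed (use v in \<open>simp add: vf_def\<close>)
qed

lemma all_vf:
  assumes h: "bij_betw h {..<N} I"
  shows "(\<forall>v \<in> carrier_vec (d * N). P v) \<longleftrightarrow> (\<forall>w. P (vf d N h w))"
proof
  assume r: "\<forall>w. P (vf d N h w)"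
  show "\<forall>v \<in> carrier_vec (d * N). P v"
  proof
    fix v :: "complex Matrix.vec" assume "v \<in> carrier_vec (d * N)"
    then obtain w where "v = vf d N h w" by (rule vf_surj[OF h])
    then show "P v" using r by simp
  qed
qed simp

section \<open>Norms, spectraballs and spectrahedra over arbitrary index sets\<close>

lemma vnorm_power2: "(vnorm v)\<^sup>2 = (\<Sum>l<dim_vec v. (cmod (vec_index v l))\<^sup>2)"
  unfolding vnorm_def L2_set_def by (simp add: sum_nonneg)

lemma vnorm_nonneg [simp]: "0 \<le> vnorm v"
  unfolding vnorm_def by (rule L2_set_nonneg)

lemma vnorm_vf:
  assumes "bij_betw h {..<N} I"
  shows "(vnorm (vf d N h w))\<^sup>2 = nsq d I w"
proof -
  have "(vnorm (vf d N h w))\<^sup>2 = (\<Sum>i<d. \<Sum>a<N. (cmod (w i (h a)))\<^sup>2)"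
    unfolding vnorm_power2 by (simp add: vf_def[of d N h w] sum_blocks block_index_less)
  then show ?thesis unfolding nsq_def using sum_bij_h[OF assms] by (simp add: sum_bij_h[OF assms, symmetric])
qed

lemma Lambda_carrier [simp]: "Lambda d n A X \<in> carrier_mat (d * n) (d * n)"
  unfolding Lambda_def mat_sum_def by simp

lemma Lambda_nth:
  assumes A: "A \<in> mtuples d g" and X: "X \<in> mtuples n g" and l: "l < d * n" "m < d * n"
  shows "Lambda d n A X $$ (l, m) = (\<Sum>j<g. A ! j $$ (l div n, m div n) * X ! j $$ (l mod n, m mod n))"
proof -
  have "kron (A ! j) (X ! j) $$ (l, m) = A ! j $$ (l div n, m div n) * X ! j $$ (l mod n, m mod n)"
    if "j < g" for j
    using mtuples_nth[OF A that] mtuples_nth[OF X that] l unfolding kron_def by auto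
  then show ?thesis using l unfolding Lambda_def mat_sum_def by (simp add: mtuples_length[OF A])
qed

lemma mult_mat_vec_nth:
  assumes "M \<in> carrier_mat r c" "v \<in> carrier_vec c" "i < r"
  shows "vec_index (M *\<^sub>v v) i = (\<Sum>k<c. M $$ (i, k) * vec_index v k)"
  using assms unfolding mult_mat_vec_def scalar_prod_def by (auto simp: lessThan_atLeast0 intro!: sum.cong)

lemma Lambda_vf:
  assumes h: "bij_betw h {..<N} I" and A: "A \<in> mtuples d g"
  shows "Lambda d N A (tup g N h x) *\<^sub>v vf d N h w = vf d N h (lam g d (cf A) I x w)"
proof (rule eq_vecI)
  show "dim_vec (Lambda d N A (tup g N h x) *\<^sub>v vf d N h w) = dim_vec (vf d N h (lam g d (cf A) I x w))"
    unfolding vf_def using carrier_matD[OF Lambda_carrier[of d N A "tup g N h x"]] by simp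
  fix l assume "l < dim_vec (vf d N h (lam g d (cf A) I x w))"
  then have l: "l < d * N" unfolding vf_def by simp
  then obtain i a where ia: "l = i * N + a" "i < d" "a < N" by (rule block_index_cases)
  have "vec_index (Lambda d N A (tup g N h x) *\<^sub>v vf d N h w) l
      = (\<Sum>m<d * N. Lambda d N A (tup g N h x) $$ (l, m) * vec_index (vf d N h w) m)"
    by (rule mult_mat_vec_nth) (use l in auto)
  also have "\<dots> = (\<Sum>k<d. \<Sum>b<N. (\<Sum>j<g. A ! j $$ (i, k) * x j (h a) (h b)) * w k (h b))"
    unfolding sum_blocks using ia l
    by (intro sum.cong refl)
      (simp add: Lambda_nth[OF A tup_mtuples] block_index_less tup_nth vf_nth)
  also have "\<dots> = (\<Sum>k<d. \<Sum>t\<in>I. (\<Sum>j<g. A ! j $$ (i, k) * x j (h a) t) * w k t)"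
    by (intro sum.cong refl sum_bij_h[OF h])
  also have "\<dots> = lam g d (cf A) I x w i (h a)"
  proof -
    have "(\<Sum>k<d. \<Sum>t\<in>I. (\<Sum>j<g. A ! j $$ (i, k) * x j (h a) t) * w k t)
        = (\<Sum>k<d. \<Sum>j<g. \<Sum>t\<in>I. A ! j $$ (i, k) * x j (h a) t * w k t)"
      unfolding sum_distrib_right by (intro sum.cong refl sum.swap)
    also have "\<dots> = (\<Sum>j<g. \<Sum>k<d. \<Sum>t\<in>I. A ! j $$ (i, k) * x j (h a) t * w k t)" by (rule sum.swap)
    finally show ?thesis unfolding lam_def .
  qed
  also have "\<dots> = vec_index (vf d N h (lam g d (cf A) I x w)) l" using ia by (simp add: vf_nth)
  finally show "vec_index (Lambda d N A (tup g N h x) *\<^sub>v vf d N h w) l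
      = vec_index (vf d N h (lam g d (cf A) I x w)) l" .
qed

lemma vnorm_smult: "vnorm (c \<cdot>\<^sub>v v) = cmod c * vnorm v"
proof -
  have "(vnorm (c \<cdot>\<^sub>v v))\<^sup>2 = (cmod c * vnorm v)\<^sup>2"
    unfolding vnorm_power2 power_mult_distrib
    by (simp add: norm_mult power_mult_distrib sum_distrib_left)
  then show ?thesis by (simp add: power2_eq_iff_nonneg)
qed

text \<open>Without boundedness the supremum in \<open>opnorm\<close> would be an unspecified
  number.\<close>

lemma opnorm_bdd:
  assumes A: "A \<in> carrier_mat r c"
  shows "bdd_above ((\<lambda>v. vnorm (A *\<^sub>v v)) ` {v \<in> carrier_vec (dim_col A). vnorm v \<le> 1})"
proof (rule bdd_aboveI2)
  fix v assume "v \<in> {v \<in> carrier_vec (dim_col A). vnorm v \<le> 1}"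
  then have v: "v \<in> carrier_vec c" "vnorm v \<le> 1" using A by auto
  have vk: "cmod (vec_index v k) \<le> 1" if "k < c" for k
  proof -
    have "cmod (vec_index v k) \<le> vnorm v" unfolding vnorm_def using that v(1)
      by (intro member_le_L2_set) auto
    then show ?thesis using v(2) by simp
  qed
  have dv: "dim_vec (A *\<^sub>v v) = r" using A by simp
  have "vnorm (A *\<^sub>v v) \<le> (\<Sum>i<r. cmod (vec_index (A *\<^sub>v v) i))"
    unfolding vnorm_def dv by (intro L2_set_le_sum) auto
  also have "\<dots> \<le> (\<Sum>i<r. \<Sum>k<c. cmod (A $$ (i, k)))"
  proof (rule sum_mono)
    fix i assume "i \<in> {..<r}"
    then have "vec_index (A *\<^sub>v v) i = (\<Sum>k<c. A $$ (i, k) * vec_index v k)"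
      using mult_mat_vec_nth[OF A v(1)] by simp
    also have "cmod \<dots> \<le> (\<Sum>k<c. cmod (A $$ (i, k) * vec_index v k))" by (rule norm_sum)
    also have "\<dots> \<le> (\<Sum>k<c. cmod (A $$ (i, k)))"
      using vk by (intro sum_mono) (simp add: norm_mult mult_left_le)
    finally show "cmod (vec_index (A *\<^sub>v v) i) \<le> (\<Sum>k<c. cmod (A $$ (i, k)))" .
  qed
  finally show "vnorm (A *\<^sub>v v) \<le> (\<Sum>i<r. \<Sum>k<c. cmod (A $$ (i, k)))" .
qed

lemma vnorm_zero_vec [simp]: "vnorm (0\<^sub>v n) = 0"
  using vnorm_power2[of "0\<^sub>v n"] by simp

lemma vnorm_mult_le_opnorm:
  assumes A: "A \<in> carrier_mat r c" and v: "v \<in> carrier_vec c"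
  shows "vnorm (A *\<^sub>v v) \<le> opnorm A * vnorm v"
proof (cases "vnorm v = 0")
  case True
  have "vec_index v k = 0" if "k < c" for k
  proof -
    have "(\<Sum>l<dim_vec v. (cmod (vec_index v l))\<^sup>2) = 0" using True vnorm_power2[of v] by simp
    then show ?thesis using that v by (subst (asm) sum_nonneg_eq_0_iff) auto
  qed
  then have "A *\<^sub>v v = 0\<^sub>v r" using A v by (intro eq_vecI) (auto simp: mult_mat_vec_nth[OF A v] simp del: index_mult_mat_vec)
  then show ?thesis using True by simp
next
  case False
  let ?c = "complex_of_real (1 / vnorm v)"
  have vp: "vnorm v > 0" using False vnorm_nonneg[of v] by linarith
  have nc: "cmod ?c = 1 / vnorm v" using vp by (simp only: norm_of_real) simp
  have "vnorm (A *\<^sub>v (?c \<cdot>\<^sub>v v)) \<le> opnorm A"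
    unfolding opnorm_def using v A vp nc
    by (intro cSUP_upper opnorm_bdd[OF A]) (auto simp: vnorm_smult simp del: of_real_divide)
  also have "A *\<^sub>v (?c \<cdot>\<^sub>v v) = ?c \<cdot>\<^sub>v (A *\<^sub>v v)" using mult_mat_vec[OF A v] by simp
  finally show ?thesis unfolding vnorm_smult nc using vp by (simp add: divide_simps)
qed

lemma opnorm_le:
  assumes A: "A \<in> carrier_mat r c" and K: "0 \<le> K"
    and "\<And>v. v \<in> carrier_vec c \<Longrightarrow> vnorm (A *\<^sub>v v) \<le> K * vnorm v"
  shows "opnorm A \<le> K"
  unfolding opnorm_def
proof (rule cSUP_least)
  show "{v \<in> carrier_vec (dim_col A). vnorm v \<le> 1} \<noteq> {}"
    by (auto intro: exI[of _ "0\<^sub>v (dim_col A)"])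
  fix v assume "v \<in> {v \<in> carrier_vec (dim_col A). vnorm v \<le> 1}"
  then have v: "v \<in> carrier_vec c" "vnorm v \<le> 1" using A by auto
  have "vnorm (A *\<^sub>v v) \<le> K * vnorm v" by (rule assms(3)[OF v(1)])
  also have "\<dots> \<le> K" using v(2) K by (simp add: mult_left_le)
  finally show "vnorm (A *\<^sub>v v) \<le> K" .
qed

lemma opnorm_le_1_iff:
  assumes A: "A \<in> carrier_mat r c"
  shows "opnorm A \<le> 1 \<longleftrightarrow> (\<forall>v \<in> carrier_vec c. vnorm (A *\<^sub>v v) \<le> vnorm v)"
proof
  assume o: "opnorm A \<le> 1"
  show "\<forall>v \<in> carrier_vec c. vnorm (A *\<^sub>v v) \<le> vnorm v"
  proof
    fix v :: "complex Matrix.vec" assume v: "v \<in> carrier_vec c"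
    have "vnorm (A *\<^sub>v v) \<le> opnorm A * vnorm v" by (rule vnorm_mult_le_opnorm[OF A v])
    also have "\<dots> \<le> 1 * vnorm v" using o by (intro mult_right_mono) auto
    finally show "vnorm (A *\<^sub>v v) \<le> vnorm v" by simp
  qed
next
  assume "\<forall>v \<in> carrier_vec c. vnorm (A *\<^sub>v v) \<le> vnorm v"
  then show "opnorm A \<le> 1" using opnorm_le[OF A, of 1] by simp
qed

lemma spectraball_tup:
  assumes h: "bij_betw h {..<N} I" and A: "A \<in> mtuples d g"
  shows "tup g N h x \<in> spectraball d g A N \<longleftrightarrow> fball g d (cf A) I I x"
proof -
  have "opnorm (Lambda d N A (tup g N h x)) \<le> 1 \<longleftrightarrow>
      (\<forall>v \<in> carrier_vec (d * N). vnorm (Lambda d N A (tup g N h x) *\<^sub>v v) \<le> vnorm v)"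
    by (rule opnorm_le_1_iff[where r = "d * N"]) simp
  also have "\<dots> \<longleftrightarrow> (\<forall>w. vnorm (Lambda d N A (tup g N h x) *\<^sub>v vf d N h w) \<le> vnorm (vf d N h w))"
    by (rule all_vf[OF h])
  also have "\<dots> \<longleftrightarrow> (\<forall>w. nsq d I (lam g d (cf A) I x w) \<le> nsq d I w)"
    unfolding Lambda_vf[OF h A] vnorm_vf[OF h, symmetric] by (simp add: power2_le_iff_abs_le)
  finally show ?thesis unfolding spectraball_def fball_def by simp
qed

lemma mat_adjoint_carrier [simp]: "A \<in> carrier_mat r c \<Longrightarrow> mat_adjoint A \<in> carrier_mat c r"
  unfolding mat_adjoint_def mat_of_rows_def by auto

lemma mat_adjoint_nth: "(A :: complex mat) \<in> carrier_mat r c \<Longrightarrow> i < c \<Longrightarrow> j < r \<Longrightarrow> mat_adjoint A $$ (i, j) = cnj (A $$ (j, i))"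
  unfolding mat_adjoint_def mat_of_rows_def by (auto simp: conjugate_complex_def)

lemma cscalar_sum: "v \<in> carrier_vec n \<Longrightarrow> w \<in> carrier_vec n \<Longrightarrow> v \<bullet>c w = (\<Sum>l<n. vec_index v l * cnj (vec_index w l))"
  unfolding scalar_prod_def by (auto simp: lessThan_atLeast0 conjugate_complex_def intro!: sum.cong)

lemma mat_adjoint_cscalar:
  fixes A :: "complex mat"
  assumes A: "A \<in> carrier_mat r c" and v: "v \<in> carrier_vec r" and w: "w \<in> carrier_vec c"
  shows "(mat_adjoint A *\<^sub>v v) \<bullet>c w = v \<bullet>c (A *\<^sub>v w)"
proof -
  have "(mat_adjoint A *\<^sub>v v) \<bullet>c w = (\<Sum>l<c. (\<Sum>k<r. cnj (A $$ (k, l)) * vec_index v k) * cnj (vec_index w l))"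
    using mult_mat_vec_carrier[OF mat_adjoint_carrier[OF A] v] w by (subst cscalar_sum[of _ c])
      (auto simp del: index_mult_mat_vec simp: mult_mat_vec_nth[OF mat_adjoint_carrier[OF A] v] mat_adjoint_nth[OF A] intro!: sum.cong)
  also have "\<dots> = (\<Sum>k<r. vec_index v k * cnj (\<Sum>l<c. A $$ (k, l) * vec_index w l))"
    by (simp add: sum_distrib_left sum_distrib_right) (subst sum.swap, simp add: mult_ac)
  also have "\<dots> = v \<bullet>c (A *\<^sub>v w)"
    using mult_mat_vec_carrier[OF A w] v by (subst cscalar_sum[of _ r])
      (auto simp del: index_mult_mat_vec simp: mult_mat_vec_nth[OF A w])
  finally show ?thesis .
qed

lemma cscalar_vf:
  assumes h: "bij_betw h {..<N} I"
  shows "vf d N h v \<bullet>c vf d N h w = (\<Sum>i<d. \<Sum>s\<in>I. v i s * cnj (w i s))"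
proof -
  have "vf d N h v \<bullet>c vf d N h w = (\<Sum>i<d. \<Sum>a<N. v i (h a) * cnj (w i (h a)))"
    by (subst cscalar_sum[of _ "d * N"]) (auto simp: sum_blocks vf_nth intro!: sum.cong)
  then show ?thesis by (simp add: sum_bij_h[OF h, of "\<lambda>s. v _ s * cnj (w _ s)"])
qed

text \<open>The pencil is self-adjoint for every \<open>X\<close>, so only its quadratic form
  counts, in which the adjoint term doubles a real part.\<close>

lemma psd_pencil_iff:
  "psd (d * n) (pencil d n A X) \<longleftrightarrow>
    (\<forall>v \<in> carrier_vec (d * n). 0 \<le> (vnorm v)\<^sup>2 + 2 * Re ((Lambda d n A X *\<^sub>v v) \<bullet>c v))"
proof -
  let ?L = "Lambda d n A X" and ?m = "d * n"
  have L: "?L \<in> carrier_mat ?m ?m" "mat_adjoint ?L \<in> carrier_mat ?m ?m" by simp_all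
  have P: "pencil d n A X \<in> carrier_mat ?m ?m" unfolding pencil_def using L by simp
  have "mat_adjoint (pencil d n A X) = pencil d n A X"
  proof (rule eq_matI)
    fix i j assume "i < dim_row (pencil d n A X)" "j < dim_col (pencil d n A X)"
    then have ij: "i < ?m" "j < ?m" using P by auto
    show "mat_adjoint (pencil d n A X) $$ (i, j) = pencil d n A X $$ (i, j)"
      unfolding mat_adjoint_nth[OF P ij]
      unfolding pencil_def using ij carrier_matD[OF L(1)] carrier_matD[OF L(2)]
      by (auto simp: mat_adjoint_nth[OF L(1)])
  qed (use carrier_matD[OF P] carrier_matD[OF mat_adjoint_carrier[OF P]] in auto)
  moreover have "Re ((pencil d n A X *\<^sub>v v) \<bullet>c v) = (vnorm v)\<^sup>2 + 2 * Re ((?L *\<^sub>v v) \<bullet>c v)"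
    if v: "v \<in> carrier_vec ?m" for v
  proof -
    have c: "?L *\<^sub>v v \<in> carrier_vec ?m" "mat_adjoint ?L *\<^sub>v v \<in> carrier_vec ?m" "conjugate v \<in> carrier_vec ?m"
      using mult_mat_vec_carrier[OF L(1) v] mult_mat_vec_carrier[OF L(2) v] v by auto
    have "pencil d n A X *\<^sub>v v = (v + ?L *\<^sub>v v) + mat_adjoint ?L *\<^sub>v v"
      unfolding pencil_def using L v
      by (subst add_mult_distrib_mat_vec[of _ ?m ?m], auto, subst add_mult_distrib_mat_vec[of _ ?m ?m], auto)
    then have "(pencil d n A X *\<^sub>v v) \<bullet>c v = v \<bullet>c v + (?L *\<^sub>v v) \<bullet>c v + (mat_adjoint ?L *\<^sub>v v) \<bullet>c v"
      using c v by (simp add: add_scalar_prod_distrib[of _ ?m])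
    moreover have "(mat_adjoint ?L *\<^sub>v v) \<bullet>c v = cnj ((?L *\<^sub>v v) \<bullet>c v)"
      unfolding mat_adjoint_cscalar[OF L(1) v v] cscalar_sum[OF v c(1)] cscalar_sum[OF c(1) v]
      by (simp add: mult.commute)
    moreover have "v \<bullet>c v = of_real ((vnorm v)\<^sup>2)"
      unfolding cscalar_sum[OF v v] vnorm_power2 of_real_sum using v
      by (simp only: complex_norm_square carrier_vecD)
    ultimately show ?thesis by simp
  qed
  ultimately show ?thesis unfolding psd_def using P by auto
qed

lemma spectrahedron_tup:
  assumes h: "bij_betw h {..<N} I" and A: "A \<in> mtuples d g"
  shows "tup g N h x \<in> free_spectrahedron d g A N \<longleftrightarrow>
    (\<forall>w. 0 \<le> nsq d I w + 2 * Re (\<Sum>i<d. \<Sum>s\<in>I. lam g d (cf A) I x w i s * cnj (w i s)))"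
proof -
  have "tup g N h x \<in> free_spectrahedron d g A N \<longleftrightarrow> (\<forall>w. 0 \<le> (vnorm (vf d N h w))\<^sup>2
      + 2 * Re ((Lambda d N A (tup g N h x) *\<^sub>v vf d N h w) \<bullet>c vf d N h w))"
    unfolding free_spectrahedron_def psd_pencil_iff all_vf[OF h] by simp
  then show ?thesis unfolding Lambda_vf[OF h A] vnorm_vf[OF h] cscalar_vf[OF h] .
qed

text \<open>Through the two enumerations, an intertwiner between tuples over different index sets
  becomes a library matrix. All later uses of the intertwining property go through this
  form.\<close>

lemma ev_intertwine:
  assumes f: "free_map g g \<Gamma> f" and h: "bij_betw h {..<N} I" "bij_betw h' {..<N'} I'" and N: "0 < N" "0 < N'"
    and x: "tup g N h x \<in> \<Gamma> N" and y: "tup g N' h' y \<in> \<Gamma> N'"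
    and T: "\<And>j s t. j < g \<Longrightarrow> s \<in> I \<Longrightarrow> t \<in> I' \<Longrightarrow> (\<Sum>r\<in>I. x j s r * T r t) = (\<Sum>r\<in>I'. T s r * y j r t)"
    and ist: "i < g" "s \<in> I" "t \<in> I'"
  shows "(\<Sum>r\<in>I. ev g f N h x i s r * T r t) = (\<Sum>r\<in>I'. T s r * ev g f N' h' y i r t)"
proof -
  define M where "M = Matrix.mat N N' (\<lambda>(a, b). T (h a) (h' b))"
  have M: "M \<in> carrier_mat N N'" unfolding M_def by simp
  have prod1: "(Z * M) $$ (a, b) = (\<Sum>c<N. Z $$ (a, c) * T (h c) (h' b))"
    if "Z \<in> carrier_mat N N" "a < N" "b < N'" for Z a b
    using that unfolding M_def by (auto simp: scalar_prod_def lessThan_atLeast0 intro!: sum.cong)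
  have prod2: "(M * Z) $$ (a, b) = (\<Sum>c<N'. T (h a) (h' c) * Z $$ (c, b))"
    if "Z \<in> carrier_mat N' N'" "a < N" "b < N'" for Z a b
    using that unfolding M_def by (auto simp: scalar_prod_def lessThan_atLeast0 intro!: sum.cong)
  have "tup g N h x ! j * M = M * tup g N' h' y ! j" if j: "j < g" for j
  proof (rule eq_matI)
    have c: "tup g N h x ! j \<in> carrier_mat N N" "tup g N' h' y ! j \<in> carrier_mat N' N'"
      using mtuples_nth[OF tup_mtuples j] by auto
    show "dim_row (tup g N h x ! j * M) = dim_row (M * tup g N' h' y ! j)"
      "dim_col (tup g N h x ! j * M) = dim_col (M * tup g N' h' y ! j)" using c M by auto
    fix a b assume "a < dim_row (M * tup g N' h' y ! j)" "b < dim_col (M * tup g N' h' y ! j)"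
    then have ab: "a < N" "b < N'" using c M by auto
    then have hab: "h a \<in> I" "h' b \<in> I'" using h by (auto simp: bij_betw_def)
    have "(tup g N h x ! j * M) $$ (a, b) = (\<Sum>c<N. x j (h a) (h c) * T (h c) (h' b))"
      unfolding prod1[OF c(1) ab] using j ab by (intro sum.cong) (auto simp: tup_nth)
    also have "\<dots> = (\<Sum>c<N'. T (h a) (h' c) * y j (h' c) (h' b))"
      using T[OF j hab] unfolding sum_bij_h[OF h(1), symmetric] sum_bij_h[OF h(2), symmetric] .
    also have "\<dots> = (M * tup g N' h' y ! j) $$ (a, b)"
      unfolding prod2[OF c(2) ab] using j ab by (intro sum.cong) (auto simp: tup_nth)
    finally show "(tup g N h x ! j * M) $$ (a, b) = (M * tup g N' h' y ! j) $$ (a, b)" .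
  qed
  moreover have "\<forall>X \<in> \<Gamma> N. \<forall>Y \<in> \<Gamma> N'. \<forall>T \<in> carrier_mat N N'.
      (\<forall>j<g. X ! j * T = T * Y ! j) \<longrightarrow> (\<forall>i<g. f N X ! i * T = T * f N' Y ! i)"
    using f N unfolding free_map_def by simp
  ultimately have eq: "f N (tup g N h x) ! i * M = M * f N' (tup g N' h' y) ! i"
    using x y M ist(1) by simp
  have fc: "f N (tup g N h x) ! i \<in> carrier_mat N N" "f N' (tup g N' h' y) ! i \<in> carrier_mat N' N'"
    using f x y N mtuples_nth[OF _ ist(1)] unfolding free_map_def by auto
  define a b where "a = inv_into {..<N} h s" and "b = inv_into {..<N'} h' t"
  have ab: "a < N" "b < N'" "h a = s" "h' b = t"
    using ist h inv_into_into[of s h "{..<N}"] inv_into_into[of t h' "{..<N'}"] unfolding a_def b_def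
    by (auto simp: bij_betw_def f_inv_into_f)
  have "(\<Sum>c<N. f N (tup g N h x) ! i $$ (a, c) * T (h c) t) = (\<Sum>c<N'. T s (h' c) * f N' (tup g N' h' y) ! i $$ (c, b))"
    using prod1[OF fc(1) ab(1,2)] prod2[OF fc(2) ab(1,2)] eq ab(3,4) by simp
  moreover have "(\<Sum>c<N. f N (tup g N h x) ! i $$ (a, c) * T (h c) t) = (\<Sum>c<N. ev g f N h x i s (h c) * T (h c) t)"
    unfolding ev_def a_def[symmetric] using bij_betw_inv_into_left[OF h(1)] by (intro sum.cong) auto
  moreover have "(\<Sum>c<N'. T s (h' c) * f N' (tup g N' h' y) ! i $$ (c, b)) = (\<Sum>c<N'. T s (h' c) * ev g f N' h' y i (h' c) t)"
    unfolding ev_def b_def[symmetric] using bij_betw_inv_into_left[OF h(2)] by (intro sum.cong) auto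
  ultimately show ?thesis
    unfolding sum_bij_h[OF h(1), symmetric] sum_bij_h[OF h(2), symmetric] by simp
qed

text \<open>The operator \<open>I \<otimes> T\<close>.\<close>

definition ten :: "'b set \<Rightarrow> ('a \<Rightarrow> 'b \<Rightarrow> complex) \<Rightarrow> (nat \<Rightarrow> 'b \<Rightarrow> complex) \<Rightarrow> nat \<Rightarrow> 'a \<Rightarrow> complex" where
  "ten I T v = (\<lambda>k s. \<Sum>t\<in>I. T s t * v k t)"

text \<open>\<open>I \<otimes> T\<close> commutes with the coefficients \<open>A_j\<close>, so an
  intertwiner of the tuples also intertwines the operators \<open>\<Lambda>_A\<close>.\<close>

lemma lam_intertwine:
  assumes T: "\<And>j t. j < g \<Longrightarrow> t \<in> I' \<Longrightarrow> (\<Sum>r\<in>I. x j s r * T r t) = (\<Sum>r\<in>I'. T s r * y j r t)"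
  shows "lam g d A I x (ten I' T v) i s = ten I' T (lam g d A I' y v) i s"
proof -
  have inner: "(\<Sum>t\<in>I'. A j i k * v k t * (\<Sum>r\<in>I'. T s r * y j r t))
      = (\<Sum>r\<in>I'. T s r * (\<Sum>t\<in>I'. A j i k * y j r t * v k t))" for j k
    unfolding sum_distrib_left by (subst sum.swap) (simp add: mult_ac)
  have "lam g d A I x (ten I' T v) i s
      = (\<Sum>j<g. \<Sum>k<d. \<Sum>r\<in>I. \<Sum>t\<in>I'. A j i k * x j s r * (T r t * v k t))"
    unfolding lam_def ten_def by (simp add: sum_distrib_left)
  also have "\<dots> = (\<Sum>j<g. \<Sum>k<d. \<Sum>t\<in>I'. A j i k * v k t * (\<Sum>r\<in>I. x j s r * T r t))"
    by (intro sum.cong refl, subst sum.swap) (simp add: sum_distrib_left mult_ac)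
  also have "\<dots> = (\<Sum>j<g. \<Sum>k<d. \<Sum>t\<in>I'. A j i k * v k t * (\<Sum>r\<in>I'. T s r * y j r t))"
    using T by (intro sum.cong refl) auto
  also have "\<dots> = (\<Sum>j<g. \<Sum>k<d. \<Sum>r\<in>I'. T s r * (\<Sum>t\<in>I'. A j i k * y j r t * v k t))"
    by (simp only: inner)
  also have "\<dots> = (\<Sum>j<g. \<Sum>r\<in>I'. \<Sum>k<d. T s r * (\<Sum>t\<in>I'. A j i k * y j r t * v k t))"
    by (intro sum.cong refl sum.swap)
  also have "\<dots> = (\<Sum>r\<in>I'. \<Sum>j<g. \<Sum>k<d. T s r * (\<Sum>t\<in>I'. A j i k * y j r t * v k t))"
    by (rule sum.swap)
  finally show ?thesis unfolding ten_def lam_def by (simp add: sum_distrib_left)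
qed

lemma lam_cong:
  "(\<And>j k t. j < g \<Longrightarrow> k < d \<Longrightarrow> t \<in> I \<Longrightarrow> x j s t * v k t = x' j s t * v' k t) \<Longrightarrow>
    lam g d A I x v i s = lam g d A I x' v' i s"
  unfolding lam_def mult.assoc by (intro sum.cong refl) auto

lemma lam_add_scaled:
  "lam g d A I x (\<lambda>k t. v k t + c * w k t) i s = lam g d A I x v i s + c * lam g d A I x w i s"
  unfolding lam_def by (simp add: sum.distrib sum_distrib_left distrib_left mult_ac)

lemma lam_scale_vec: "lam g d A I x (\<lambda>k t. c * w k t) i s = c * lam g d A I x w i s"
  unfolding lam_def by (simp add: sum_distrib_left mult_ac)

lemma lam_scale: "lam g d A I (\<lambda>j s t. c * x j s t) w i s = c * lam g d A I x w i s"
  unfolding lam_def by (simp add: sum_distrib_left mult_ac)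

lemma tscale_tup: "tscale c (tup g N h x) = tup g N h (\<lambda>j s t. c * x j s t)"
  by (rule tuple_eqI[of _ N g]) (auto simp: tscale_def tup_def mtuples_def)

lemma tadd_tup: "tadd (tup g N h x) (tup g N h y) = tup g N h (\<lambda>j s t. x j s t + y j s t)"
  by (rule tuple_eqI[of _ N g]) (auto simp: tadd_def tup_def mtuples_def set_zip)

lemma tsub_tup: "tsub (tup g N h x) (tup g N h y) = tup g N h (\<lambda>j s t. x j s t - y j s t)"
  by (rule tuple_eqI[of _ N g]) (auto simp: tsub_def tup_def mtuples_def set_zip)

lemma tzero_tup: "tzero N g = tup g N h (\<lambda>j s t. 0)"
  by (rule tuple_eqI[of _ N g]) (auto simp: tzero_def tup_def mtuples_def)

lemma opnorm_nonneg: "A \<in> carrier_mat r c \<Longrightarrow> 0 \<le> opnorm A"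
proof -
  assume A: "A \<in> carrier_mat r c"
  have "vnorm (A *\<^sub>v 0\<^sub>v c) \<le> opnorm A"
    unfolding opnorm_def using A by (intro cSUP_upper opnorm_bdd[OF A]) auto
  then show ?thesis using vnorm_nonneg order_trans by blast
qed

lemma cmod_nth_le_opnorm:
  assumes A: "A \<in> carrier_mat r c" and ij: "i < r" "j < c"
  shows "cmod (A $$ (i, j)) \<le> opnorm A"
proof -
  have "vnorm (unit_vec c j) = 1"
  proof -
    have "(vnorm (unit_vec c j))\<^sup>2 = (\<Sum>l<c. if l = j then 1 else 0)"
      unfolding vnorm_power2 by (intro sum.cong) (auto simp: unit_vec_def ij)
    then show ?thesis using ij by (simp add: power2_eq_1_iff) (metis neg_0_le_iff_le not_one_le_zero vnorm_nonneg)
  qed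
  moreover have "vec_index (A *\<^sub>v unit_vec c j) i = A $$ (i, j)" using A ij by simp
  moreover have "cmod (vec_index (A *\<^sub>v unit_vec c j) i) \<le> vnorm (A *\<^sub>v unit_vec c j)"
    unfolding vnorm_def using A ij by (intro member_le_L2_set) auto
  ultimately show ?thesis using vnorm_mult_le_opnorm[OF A, of "unit_vec c j"] by simp
qed

lemma cmod_nth_le_tnorm:
  assumes X: "X \<in> mtuples n g" and "j < g" "a < n" "b < n"
  shows "cmod (X ! j $$ (a, b)) \<le> tnorm X"
proof -
  have "cmod (X ! j $$ (a, b)) \<le> opnorm (X ! j)"
    using mtuples_nth[OF X] assms by (intro cmod_nth_le_opnorm) auto
  also have "opnorm (X ! j) \<le> tnorm X"
    unfolding tnorm_def using X assms(2)
    by (intro member_le_sum_list) (auto simp: mtuples_def intro: opnorm_nonneg)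
  finally show ?thesis .
qed

lemma tnorm_nonneg: "X \<in> mtuples n g \<Longrightarrow> 0 \<le> tnorm X"
  unfolding tnorm_def mtuples_def by (auto intro!: sum_list_nonneg opnorm_nonneg)

lemma tnorm_tscale:
  assumes X: "X \<in> mtuples n g"
  shows "tnorm (tscale c X) \<le> cmod c * tnorm X"
proof -
  have "opnorm (c \<cdot>\<^sub>m A) \<le> cmod c * opnorm A" if A: "A \<in> carrier_mat n n" for A
  proof (rule opnorm_le[of _ n n])
    fix v :: "complex Matrix.vec" assume v: "v \<in> carrier_vec n"
    have "(c \<cdot>\<^sub>m A) *\<^sub>v v = c \<cdot>\<^sub>v (A *\<^sub>v v)" using A v by (intro eq_vecI) (auto simp: smult_scalar_prod_distrib[of _ n])
    then have "vnorm ((c \<cdot>\<^sub>m A) *\<^sub>v v) = cmod c * vnorm (A *\<^sub>v v)" by (simp add: vnorm_smult)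
    also have "\<dots> \<le> cmod c * (opnorm A * vnorm v)" by (intro mult_left_mono vnorm_mult_le_opnorm[OF A v]) simp
    finally show "vnorm ((c \<cdot>\<^sub>m A) *\<^sub>v v) \<le> cmod c * opnorm A * vnorm v" by simp
  qed (use A opnorm_nonneg[OF A] in auto)
  then have "(\<Sum>A\<leftarrow>X. opnorm (c \<cdot>\<^sub>m A)) \<le> (\<Sum>A\<leftarrow>X. cmod c * opnorm A)"
    using X by (intro sum_list_mono) (auto simp: mtuples_def)
  then show ?thesis unfolding tnorm_def tscale_def by (simp add: o_def sum_list_const_mult)
qed

lemma lam_bounded:
  assumes h: "bij_betw h {..<N::nat} I" and A: "A \<in> mtuples d g"
  obtains K where "0 < K" "\<And>w. nsq d I (lam g d (cf A) I x w) \<le> K\<^sup>2 * nsq d I w"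
proof -
  define K where "K = opnorm (Lambda d N A (tup g N h x)) + 1"
  have o: "opnorm (Lambda d N A (tup g N h x)) \<ge> 0" by (rule opnorm_nonneg[OF Lambda_carrier])
  then have K: "K > 0" unfolding K_def by simp
  moreover have "nsq d I (lam g d (cf A) I x w) \<le> K\<^sup>2 * nsq d I w" for w
  proof -
    have "vnorm (Lambda d N A (tup g N h x) *\<^sub>v vf d N h w) \<le> opnorm (Lambda d N A (tup g N h x)) * vnorm (vf d N h w)"
      by (intro vnorm_mult_le_opnorm[of _ "d * N" "d * N"]) auto
    also have "\<dots> \<le> K * vnorm (vf d N h w)" unfolding K_def by (intro mult_right_mono) auto
    finally have "(vnorm (Lambda d N A (tup g N h x) *\<^sub>v vf d N h w))\<^sup>2 \<le> (K * vnorm (vf d N h w))\<^sup>2"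
      by (intro power_mono) auto
    then show ?thesis unfolding Lambda_vf[OF h A] power_mult_distrib vnorm_vf[OF h] .
  qed
  ultimately show ?thesis using that by blast
qed

text \<open>On \<open>\<D>_B\<close> the operator \<open>P = \<Lambda>_B(X)\<close> has \<open>I + P\<close> invertible and \<open>P (I + P)\<inverse>\<close> contractive.\<close>

lemma spectrahedron_contraction:
  assumes h: "bij_betw h {..<N} I" and A: "A \<in> mtuples d g" and X: "tup g N h x \<in> free_spectrahedron d g A N"
  shows "nsq d I (lam g d (cf A) I x w) \<le> nsq d I (\<lambda>i s. w i s + lam g d (cf A) I x w i s)"
proof -
  let ?P = "lam g d (cf A) I x w"
  have "(cmod (p + q))\<^sup>2 = (cmod q)\<^sup>2 + ((cmod p)\<^sup>2 + 2 * Re (q * cnj p))" for p q :: complex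
    unfolding cmod_power2 by (simp add: power2_eq_square algebra_simps)
  then have "nsq d I (\<lambda>i s. w i s + ?P i s)
      = nsq d I ?P + (nsq d I w + 2 * Re (\<Sum>i<d. \<Sum>s\<in>I. ?P i s * cnj (w i s)))"
    unfolding nsq_def by (simp add: sum.distrib sum_distrib_left Re_sum)
  then show ?thesis using X unfolding spectrahedron_tup[OF h A] by simp
qed

text \<open>If \<open>(I + P) v = 0\<close>, the contraction estimate gives \<open>P v = 0\<close>
  and hence \<open>v = 0\<close>.\<close>

lemma spectrahedron_inj:
  assumes h: "bij_betw h {..<N} I" and A: "A \<in> mtuples d g" and X: "tup g N h x \<in> free_spectrahedron d g A N"
    and eq: "\<And>i s. i < d \<Longrightarrow> s \<in> I \<Longrightarrow> w i s + lam g d (cf A) I x w i s = w' i s + lam g d (cf A) I x w' i s"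
    and ist: "i < d" "s \<in> I"
  shows "w i s = w' i s"
proof -
  have fin: "finite I" using bij_betw_finite[OF h] by simp
  let ?v = "\<lambda>i s. w i s + (-1) * w' i s"
  have z: "?v i s + lam g d (cf A) I x ?v i s = 0" if "i < d" "s \<in> I" for i s
    unfolding lam_add_scaled using eq[OF that] by (simp add: algebra_simps)
  have "nsq d I (\<lambda>i s. ?v i s + lam g d (cf A) I x ?v i s) = nsq d I (\<lambda>i s. 0)"
    by (rule nsq_cong) (rule z)
  also have "\<dots> = 0" by (simp add: nsq_def)
  finally have "nsq d I (lam g d (cf A) I x ?v) = 0"
    using spectrahedron_contraction[OF h A X, of ?v]
      nsq_nonneg[of d I "lam g d (cf A) I x ?v"] by linarith
  then have "lam g d (cf A) I x ?v i s = 0" using nsq_zero[OF fin] ist by blast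
  then show ?thesis using z[OF ist] by simp
qed

text \<open>\<open>I + P\<close> is a square matrix with trivial kernel.\<close>

lemma spectrahedron_solve:
  assumes h: "bij_betw h {..<N} I" and A: "A \<in> mtuples d g" and X: "tup g N h x \<in> free_spectrahedron d g A N"
  obtains w where "\<And>i s. i < d \<Longrightarrow> s \<in> I \<Longrightarrow> w i s + lam g d (cf A) I x w i s = z i s"
proof -
  let ?L = "Lambda d N A (tup g N h x)"
  let ?M = "1\<^sub>m (d * N) + ?L"
  have M: "?M \<in> carrier_mat (d * N) (d * N)" by simp
  have Mv: "?M *\<^sub>v vf d N h w = vf d N h (\<lambda>i s. w i s + lam g d (cf A) I x w i s)" for w
  proof -
    have "?M *\<^sub>v vf d N h w = 1\<^sub>m (d * N) *\<^sub>v vf d N h w + ?L *\<^sub>v vf d N h w"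
      by (rule add_mult_distrib_mat_vec[of _ "d * N" "d * N"]) auto
    also have "\<dots> = vf d N h w + vf d N h (lam g d (cf A) I x w)"
      unfolding Lambda_vf[OF h A] using one_mult_mat_vec[OF vf_carrier] by simp
    finally show ?thesis unfolding vf_def by (auto intro: eq_vecI)
  qed
  have hi: "h (inv_into {..<N} h s) = s" "inv_into {..<N} h s < N" if "s \<in> I" for s
    using that h inv_into_into[of s h "{..<N}"] by (auto simp: bij_betw_def f_inv_into_f)
  have vf_eqD: "w i s = w' i s" if "vf d N h w = vf d N h w'" "i < d" "s \<in> I" for w w' i s
    using vf_nth[OF that(2) hi(2)[OF that(3)], of h w] vf_nth[OF that(2) hi(2)[OF that(3)], of h w'] that(1)
      hi(1)[OF that(3)] by simp
  have "Determinant.det ?M \<noteq> 0"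
  proof
    assume "Determinant.det ?M = 0"
    then obtain v where v: "v \<in> carrier_vec (d * N)" "v \<noteq> 0\<^sub>v (d * N)" "?M *\<^sub>v v = 0\<^sub>v (d * N)"
      using det_0_iff_vec_prod_zero_field[OF M] by blast
    obtain w where w: "v = vf d N h w" using vf_surj[OF h v(1)] .
    have "vf d N h (\<lambda>i s. w i s + lam g d (cf A) I x w i s) = vf d N h (\<lambda>i s. 0)"
      using v(3) unfolding w Mv by (auto simp: vf_def)
    then have "w i s = 0" if "i < d" "s \<in> I" for i s
      using spectrahedron_inj[OF h A X, of w "\<lambda>i s. 0" i s] that vf_eqD
      by (auto simp: lam_def)
    then have "v = 0\<^sub>v (d * N)" unfolding w vf_def using h
      by (intro eq_vecI) (auto simp: bij_betw_def less_mult_imp_div_less elim!: block_index_cases)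
    then show False using v(2) by simp
  qed
  then obtain R where R: "R \<in> carrier_mat (d * N) (d * N)" "?M * R = 1\<^sub>m (d * N)"
    using det_non_zero_imp_unit[OF M] unfolding Units_def ring_mat_def by auto
  obtain w where w: "R *\<^sub>v vf d N h z = vf d N h w"
    using vf_surj[OF h mult_mat_vec_carrier[OF R(1) vf_carrier]] by metis
  have "?M *\<^sub>v (R *\<^sub>v vf d N h z) = vf d N h z"
    using assoc_mult_mat_vec[OF M R(1) vf_carrier] R(2) one_mult_mat_vec[OF vf_carrier] by metis
  then have "vf d N h (\<lambda>i s. w i s + lam g d (cf A) I x w i s) = vf d N h z" unfolding w Mv .
  then show ?thesis using that[of w] vf_eqD by blast
qed

section \<open>The two spectraballs coincide\<close>

lemma nsq_Plus:
  assumes "finite R" "finite I"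
  shows "nsq d (R <+> I) v = nsq d R (\<lambda>k s. v k (Inl s)) + nsq d I (\<lambda>k t. v k (Inr t))"
  unfolding nsq_columns using assms by (simp add: sum.Plus)

text \<open>The block matrix with \<open>x\<close> in the upper right corner. It turns a rectangular
  tuple into a square one, to which \<open>p\<close> applies, and any product of two such matrices
  vanishes.\<close>

definition corner :: "(nat \<Rightarrow> 'a \<Rightarrow> 'b \<Rightarrow> complex) \<Rightarrow> nat \<Rightarrow> 'a + 'b \<Rightarrow> 'a + 'b \<Rightarrow> complex" where
  "corner x j s t = (case s of Inl a \<Rightarrow> (case t of Inl _ \<Rightarrow> 0 | Inr b \<Rightarrow> x j a b) | Inr _ \<Rightarrow> 0)"

lemma corner_simps [simp]:
  "corner x j (Inl a) (Inr b) = x j a b" "corner x j s (Inl a) = 0" "corner x j (Inr b) t = 0"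
  unfolding corner_def by (auto split: sum.splits)

lemma lam_corner:
  assumes "finite R" "finite I"
  shows "lam g d A (R <+> I) (corner x) v i (Inl s) = lam g d A I x (\<lambda>k t. v k (Inr t)) i s"
    and "lam g d A (R <+> I) (corner x) v i (Inr t) = 0"
  unfolding lam_def using assms by (simp_all add: sum.Plus)

lemma fball_corner:
  assumes fin: "finite R" "finite I"
  shows "fball g d A (R <+> I) (R <+> I) (corner x) \<longleftrightarrow> fball g d A R I x"
proof
  assume l: "fball g d A (R <+> I) (R <+> I) (corner x)"
  show "fball g d A R I x" unfolding fball_def
  proof
    fix w :: "nat \<Rightarrow> 'b \<Rightarrow> complex"
    have "nsq d R (\<lambda>k s. 0) = 0" "nsq d I (\<lambda>k s. 0) = 0" unfolding nsq_def by simp_all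
    then show "nsq d R (lam g d A I x w) \<le> nsq d I w"
      using l[unfolded fball_def, rule_format, of "\<lambda>k s. case s of Inl _ \<Rightarrow> 0 | Inr t \<Rightarrow> w k t"]
      unfolding nsq_Plus[OF fin] lam_corner[OF fin] by simp
  qed
next
  assume r: "fball g d A R I x"
  show "fball g d A (R <+> I) (R <+> I) (corner x)" unfolding fball_def
  proof
    fix v :: "nat \<Rightarrow> 'a + 'b \<Rightarrow> complex"
    have "nsq d I (\<lambda>k s. 0) = 0" unfolding nsq_def by simp
    moreover have "nsq d R (lam g d A I x (\<lambda>k t. v k (Inr t))) \<le> nsq d I (\<lambda>k t. v k (Inr t))"
      using r unfolding fball_def by blast
    ultimately show "nsq d (R <+> I) (lam g d A (R <+> I) (corner x) v) \<le> nsq d (R <+> I) v"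
      unfolding nsq_Plus[OF fin] lam_corner[OF fin] using nsq_nonneg[of d R "\<lambda>k s. v k (Inl s)"] by linarith
  qed
qed

text \<open>For a fixed \<open>Inr\<close> part \<open>w\<close> the form is minimal at the
  \<open>Inl\<close> part \<open>- \<Lambda>(x) w\<close>, where its value is the squared norm of
  \<open>w\<close> minus that of \<open>\<Lambda>(x) w\<close>.\<close>

lemma spectrahedron_corner:
  assumes fin: "finite R" "finite I" and h: "bij_betw h {..<N} (R <+> I)" and A: "A \<in> mtuples d g"
  shows "tup g N h (corner x) \<in> free_spectrahedron d g A N \<longleftrightarrow> fball g d (cf A) R I x"
proof -
  let ?l = "\<lambda>v. lam g d (cf A) I x (\<lambda>k t. v k (Inr t))"
  have form: "(\<Sum>i<d. \<Sum>s\<in>R <+> I. lam g d (cf A) (R <+> I) (corner x) v i s * cnj (v i s))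
      = (\<Sum>i<d. \<Sum>s\<in>R. ?l v i s * cnj (v i (Inl s)))" for v
    by (simp add: sum.Plus[OF fin] lam_corner[OF fin])
  show ?thesis
  proof
    assume "tup g N h (corner x) \<in> free_spectrahedron d g A N"
    then have s: "0 \<le> nsq d (R <+> I) v + 2 * Re (\<Sum>i<d. \<Sum>s\<in>R. ?l v i s * cnj (v i (Inl s)))" for v
      unfolding spectrahedron_tup[OF h A] form by blast
    show "fball g d (cf A) R I x" unfolding fball_def
    proof
      fix w
      let ?y = "lam g d (cf A) I x w"
      let ?v = "\<lambda>k s. case s of Inl a \<Rightarrow> - ?y k a | Inr t \<Rightarrow> w k t"
      have "(\<Sum>i<d. \<Sum>s\<in>R. ?l ?v i s * cnj (?v i (Inl s))) = - of_real (nsq d R ?y)"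
        unfolding nsq_def of_real_sum
        by (simp only: complex_norm_square) (simp add: sum_negf)
      moreover have "nsq d R (\<lambda>k a. - ?y k a) = nsq d R ?y" unfolding nsq_def by simp
      ultimately show "nsq d R ?y \<le> nsq d I w"
        using s[of ?v] unfolding nsq_Plus[OF fin] by simp
    qed
  next
    assume r: "fball g d (cf A) R I x"
    have "0 \<le> nsq d (R <+> I) v + 2 * Re (\<Sum>i<d. \<Sum>s\<in>R. ?l v i s * cnj (v i (Inl s)))" for v
    proof -
      have "0 \<le> (cmod p)\<^sup>2 + (cmod q)\<^sup>2 + 2 * Re (p * cnj q)" for p q :: complex
      proof -
        have "(cmod p)\<^sup>2 + (cmod q)\<^sup>2 + 2 * Re (p * cnj q) = (cmod (p + q))\<^sup>2"
          unfolding cmod_power2 by (simp add: power2_eq_square algebra_simps)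
        then show ?thesis by simp
      qed
      then have "0 \<le> (\<Sum>i<d. \<Sum>s\<in>R. (cmod (?l v i s))\<^sup>2 + (cmod (v i (Inl s)))\<^sup>2
          + 2 * Re (?l v i s * cnj (v i (Inl s))))" by (intro sum_nonneg) auto
      also have "\<dots> = nsq d R (?l v) + nsq d R (\<lambda>k s. v k (Inl s))
          + 2 * Re (\<Sum>i<d. \<Sum>s\<in>R. ?l v i s * cnj (v i (Inl s)))"
        unfolding nsq_def by (simp only: sum.distrib Re_sum sum_distrib_left)
      also have "nsq d R (?l v) \<le> nsq d I (\<lambda>k t. v k (Inr t))" using r unfolding fball_def by blast
      finally show ?thesis unfolding nsq_Plus[OF fin] by simp
    qed
    then show "tup g N h (corner x) \<in> free_spectrahedron d g A N"
      unfolding spectrahedron_tup[OF h A] form by blast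
  qed
qed

lemma fball_scale:
  assumes "fball g d A R I x" and "cmod c \<le> 1"
  shows "fball g d A R I (\<lambda>j s t. c * x j s t)"
  unfolding fball_def
proof
  fix v
  have "nsq d R (lam g d A I (\<lambda>j s t. c * x j s t) v) = (cmod c)\<^sup>2 * nsq d R (lam g d A I x v)"
    unfolding nsq_scale[symmetric] by (rule nsq_cong) (rule lam_scale)
  also have "\<dots> \<le> 1 * nsq d R (lam g d A I x v)"
    using assms(2) by (intro mult_right_mono) (auto simp: power_le_one)
  also have "\<dots> \<le> nsq d I v" using assms(1) unfolding fball_def by simp
  finally show "nsq d R (lam g d A I (\<lambda>j s t. c * x j s t) v) \<le> nsq d I v" .
qed

text \<open>What hypothesis (iii) says apart from analytic extension, which is assumed separately in
  the lemmas where it enters.\<close>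

locale ball_map =
  fixes g d e :: nat and E B :: "complex mat list"
    and p q :: "nat \<Rightarrow> complex mat list \<Rightarrow> complex mat list"
  assumes E: "E \<in> mtuples d g" and B: "B \<in> mtuples e g"
    and fp: "free_map g g (spectraball d g E) p" and fq: "free_map g g (free_spectrahedron e g B) q"
    and p_mem: "\<And>n X. 0 < n \<Longrightarrow> X \<in> spectraball d g E n \<Longrightarrow> p n X \<in> free_spectrahedron e g B n"
    and q_mem: "\<And>n Y. 0 < n \<Longrightarrow> Y \<in> free_spectrahedron e g B n \<Longrightarrow> q n Y \<in> spectraball d g E n"
    and qp: "\<And>n X. 0 < n \<Longrightarrow> X \<in> spectraball d g E n \<Longrightarrow> q n (p n X) = X"
    and p0: "\<And>n. 0 < n \<Longrightarrow> p n (tzero n g) = tzero n g"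
    and pd: "\<And>n. 0 < n \<Longrightarrow> has_tuple_derivative n g g (p n) (\<lambda>H. H) (tzero n g)"
begin

lemma p_tup:
  assumes h: "bij_betw h {..<N} I" and N: "0 < N" and x: "fball g d (cf E) I I x"
  shows "tup g N h x \<in> spectraball d g E N"
    and "tup g N h (ev g p N h x) = p N (tup g N h x)"
    and "tup g N h (ev g p N h x) \<in> free_spectrahedron e g B N"
proof -
  show X: "tup g N h x \<in> spectraball d g E N" using spectraball_tup[OF h E] x by simp
  then have "p N (tup g N h x) \<in> mtuples N g" using fp N unfolding free_map_def by simp
  then show eq: "tup g N h (ev g p N h x) = p N (tup g N h x)" by (rule tup_ev[OF h])
  show "tup g N h (ev g p N h x) \<in> free_spectrahedron e g B N" unfolding eq by (rule p_mem[OF N X])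
qed

text \<open>By its support, \<open>x\<close> has vanishing products, so \<open>p\<close> acts on it
  as its derivative at 0: intertwining confines \<open>p(x)\<close> to the same block and makes it
  homogeneous there, and \<open>p'(0) = I\<close> fixes the value.\<close>

lemma ev_p_nilpotent:
  assumes h: "bij_betw h {..<N} K" and N: "0 < N" and x: "fball g d (cf E) K K x"
    and supp: "\<And>j s t. x j s t \<noteq> 0 \<Longrightarrow> s \<notin> J \<and> t \<in> J"
    and ist: "i < g" "s \<in> K" "t \<in> K"
  shows "ev g p N h x i s t = x i s t"
proof -
  have fin: "finite K" using bij_betw_finite[OF h] by simp
  have xz: "s \<in> J \<Longrightarrow> x j s t = 0" "t \<notin> J \<Longrightarrow> x j s t = 0" for j s t using supp by blast+
  have X: "tup g N h x \<in> spectraball d g E N" by (rule p_tup(1)[OF h N x])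
  let ?z = "\<lambda>j s t. 0 :: complex"
  have nz: "nsq d K (\<lambda>k s. 0) = 0" unfolding nsq_def by simp
  have "fball g d (cf E) K K ?z"
    unfolding fball_def lam_def by (simp add: nz)
  then have Z: "tup g N h ?z \<in> spectraball d g E N" by (rule p_tup(1)[OF h N])
  have evz: "ev g p N h ?z i s t = 0" if "s \<in> K" "t \<in> K" for s t
  proof -
    have "inv_into {..<N} h s < N" "inv_into {..<N} h t < N"
      using that h inv_into_into[of _ h "{..<N}"] unfolding bij_betw_def by auto
    then show ?thesis unfolding ev_def tzero_tup[symmetric] p0[OF N] using ist(1) by (simp add: tzero_def)
  qed
  define P where "P = ev g p N h x"
  \<comment> \<open>\<open>x\<close> annihilates the projection off \<open>J\<close>, which
    therefore intertwines \<open>x\<close> with the zero tuple, where \<open>p\<close>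
    vanishes.\<close>
  have col: "P i s t = 0" if st: "s \<in> K" "t \<in> K" and t: "t \<notin> J" for s t
  proof -
    let ?T = "\<lambda>r t. if r = t \<and> t \<notin> J then 1 else 0 :: complex"
    have "(\<Sum>r\<in>K. P i s r * ?T r t) = (\<Sum>r\<in>K. ?T s r * ev g p N h ?z i r t)"
      unfolding P_def
    proof (rule ev_intertwine[OF fp h h N N X Z _ ist(1) st])
      fix j s t assume "s \<in> K" "t \<in> K"
      show "(\<Sum>r\<in>K. x j s r * ?T r t) = (\<Sum>r\<in>K. ?T s r * 0)"
        by (intro trans[OF sum.neutral sum.neutral[symmetric]]) (auto simp: xz)
    qed
    also have "\<dots> = 0" using evz st(2) by simp
    also have "(\<Sum>r\<in>K. P i s r * ?T r t) = (\<Sum>r\<in>K. if r = t then P i s t else 0)"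
      using t by (intro sum.cong) auto
    finally show ?thesis using st fin by simp
  qed
  have row: "P i s t = 0" if st: "s \<in> K" "t \<in> K" and s: "s \<in> J" for s t
  proof -
    let ?T = "\<lambda>s r. if r = s \<and> s \<in> J then 1 else 0 :: complex"
    have "(\<Sum>r\<in>K. ev g p N h ?z i s r * ?T r t) = (\<Sum>r\<in>K. ?T s r * P i r t)"
      unfolding P_def
    proof (rule ev_intertwine[OF fp h h N N Z X _ ist(1) st])
      fix j s t assume "s \<in> K" "t \<in> K"
      show "(\<Sum>r\<in>K. 0 * ?T r t) = (\<Sum>r\<in>K. ?T s r * x j r t)"
        by (intro trans[OF sum.neutral sum.neutral[symmetric]]) (auto simp: xz)
    qed
    also have "(\<Sum>r\<in>K. ?T s r * P i r t) = (\<Sum>r\<in>K. if r = s then P i s t else 0)"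
      using s by (intro sum.cong) auto
    finally show ?thesis using st fin evz by simp
  qed
  \<comment> \<open>The diagonal matrix with \<open>c\<close> off \<open>J\<close> and 1 on
    \<open>J\<close> intertwines \<open>c x\<close> with \<open>x\<close>; on this block that says
    that \<open>p\<close> is homogeneous.\<close>
  have scale: "ev g p N h (\<lambda>j s t. of_real c * x j s t) i s t = of_real c * P i s t"
    if st: "s \<in> K" "t \<in> K" and s: "s \<notin> J" and t: "t \<in> J" and c: "0 < c" "c \<le> 1" for s t c
  proof -
    let ?T = "\<lambda>r t. if r = t then (if t \<in> J then 1 else of_real c) else 0 :: complex"
    let ?y = "\<lambda>j s t. of_real c * x j s t"
    have Y: "tup g N h ?y \<in> spectraball d g E N"
      by (rule p_tup(1)[OF h N fball_scale[OF x]]) (use c in simp)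
    have "(\<Sum>r\<in>K. ev g p N h ?y i s r * ?T r t) = (\<Sum>r\<in>K. ?T s r * P i r t)"
      unfolding P_def
    proof (rule ev_intertwine[OF fp h h N N Y X _ ist(1) st])
      fix j s t assume st: "s \<in> K" "t \<in> K"
      have "(\<Sum>r\<in>K. ?y j s r * ?T r t) = (\<Sum>r\<in>K. if r = t then ?y j s t * (if t \<in> J then 1 else of_real c) else 0)"
        by (intro sum.cong) auto
      moreover have "(\<Sum>r\<in>K. ?T s r * x j r t) = (\<Sum>r\<in>K. if r = s then (if s \<in> J then 1 else of_real c) * x j s t else 0)"
        by (intro sum.cong) auto
      ultimately show "(\<Sum>r\<in>K. ?y j s r * ?T r t) = (\<Sum>r\<in>K. ?T s r * x j r t)"
        using st fin supp[of j s t] by (cases "x j s t = 0") auto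
    qed
    also have "(\<Sum>r\<in>K. ev g p N h ?y i s r * ?T r t) = (\<Sum>r\<in>K. if r = t then ev g p N h ?y i s t else 0)"
      using t by (intro sum.cong) auto
    also have "(\<Sum>r\<in>K. ?T s r * P i r t) = (\<Sum>r\<in>K. if r = s then of_real c * P i s t else 0)"
      using s by (intro sum.cong) auto
    finally show ?thesis using st fin by simp
  qed
  have "P i s t = x i s t"
  proof (cases "s \<in> J \<or> t \<notin> J")
    case True
    then have "x i s t = 0" using supp by blast
    then show ?thesis using True row col ist by auto
  next
    case False
    then have sJ: "s \<notin> J" "t \<in> J" by auto
    define M where "M = tnorm (tup g N h x)"
    have M: "M \<ge> 0" unfolding M_def by (rule tnorm_nonneg[OF tup_mtuples])
    have "cmod (P i s t - x i s t) \<le> 0"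
    proof (rule field_le_epsilon)
      fix \<kappa> :: real assume \<kappa>: "0 < \<kappa>"
      define \<epsilon> where "\<epsilon> = \<kappa> / (M + 1)"
      have \<epsilon>: "\<epsilon> > 0" "\<epsilon> * M \<le> \<kappa>" using \<kappa> M unfolding \<epsilon>_def by (auto simp: divide_simps)
      obtain \<delta> where \<delta>: "\<delta> > 0" "\<And>H. H \<in> mtuples N g \<Longrightarrow> tnorm H < \<delta> \<Longrightarrow>
          tnorm (tsub (tsub (p N (tadd (tzero N g) H)) (p N (tzero N g))) H) \<le> \<epsilon> * tnorm H"
        using pd[OF N] \<epsilon>(1) unfolding has_tuple_derivative_def by blast
      \<comment> \<open>Small enough for the estimate at 0; homogeneity divides the factor out again
        afterwards.\<close>
      define c where "c = min 1 (\<delta> / (2 * (M + 1)))"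
      have c: "0 < c" "c \<le> 1" "c * M < \<delta>"
      proof -
        show "0 < c" "c \<le> 1" using \<delta>(1) M unfolding c_def by auto
        have "c * M \<le> \<delta> / (2 * (M + 1)) * M" using M unfolding c_def by (intro mult_right_mono) auto
        also have "\<dots> < \<delta>" using \<delta>(1) M by (simp add: divide_simps)
        finally show "c * M < \<delta>" .
      qed
      let ?y = "\<lambda>j s t. of_real c * x j s t"
      have tn: "tnorm (tup g N h ?y) \<le> c * M"
        using tnorm_tscale[OF tup_mtuples, of "of_real c" g N h x] c(1) unfolding tscale_tup M_def by simp
      have yb: "fball g d (cf E) K K ?y" by (rule fball_scale[OF x]) (use c in simp)
      have eq: "tsub (tsub (p N (tadd (tzero N g) (tup g N h ?y))) (p N (tzero N g))) (tup g N h ?y)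
          = tup g N h (\<lambda>j s t. ev g p N h ?y j s t - ?y j s t)"
        unfolding p0[OF N] unfolding tzero_tup[of _ _ h] tadd_tup
        by (simp add: p_tup(2)[OF h N yb, symmetric] tsub_tup)
      have "tnorm (tup g N h (\<lambda>j s t. ev g p N h ?y j s t - ?y j s t)) \<le> \<epsilon> * tnorm (tup g N h ?y)"
        unfolding eq[symmetric] by (rule \<delta>(2)) (use tn c(3) in auto)
      also have "\<dots> \<le> \<epsilon> * (c * M)" using tn \<epsilon>(1) by simp
      finally have le: "tnorm (tup g N h (\<lambda>j s t. ev g p N h ?y j s t - ?y j s t)) \<le> \<epsilon> * (c * M)" .
      obtain a b where ab: "a < N" "b < N" "h a = s" "h b = t" using ist(2,3) h unfolding bij_betw_def by auto
      have "c * cmod (P i s t - x i s t) = cmod (of_real c * P i s t - of_real c * x i s t)"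
        unfolding right_diff_distrib[symmetric] norm_mult using c(1) by simp
      also have "\<dots> = cmod (tup g N h (\<lambda>j s t. ev g p N h ?y j s t - ?y j s t) ! i $$ (a, b))"
        using ab ist(1) scale[OF ist(2,3) sJ c(1,2)] by (simp add: tup_nth)
      also have "\<dots> \<le> c * (\<epsilon> * M)"
        using cmod_nth_le_tnorm[OF tup_mtuples ist(1) ab(1,2), of h "\<lambda>j s t. ev g p N h ?y j s t - ?y j s t"] le
        by (simp add: mult_ac)
      finally have "cmod (P i s t - x i s t) \<le> \<epsilon> * M" using c(1) by simp
      then show "cmod (P i s t - x i s t) \<le> 0 + \<kappa>" using \<epsilon>(2) by simp
    qed
    then show ?thesis by simp
  qed
  then show ?thesis unfolding P_def .
qed

text \<open>Both balls are read off from the tuples \<open>corner x\<close>, which \<open>p\<close> and \<open>q\<close> fix.\<close>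

lemma fball_eq:
  fixes R :: "'a set" and I :: "'b set"
  assumes fin: "finite R" "finite I"
  shows "fball g d (cf E) R I x \<longleftrightarrow> fball g e (cf B) R I x"
proof (cases "R <+> I = {}")
  case True
  then have "R = {}" "I = {}" by auto
  then show ?thesis unfolding fball_def nsq_def by simp
next
  case False
  define N where "N = card (R <+> I)"
  have N: "0 < N" unfolding N_def using False fin by (simp add: card_gt_0_iff)
  obtain h where h: "bij_betw h {..<N} (R <+> I)"
    using ex_bij_betw_nat_finite[of "R <+> I"] fin unfolding N_def lessThan_atLeast0 by auto
  have supp: "s \<notin> range Inr \<and> t \<in> range Inr" if "corner y j s t \<noteq> 0" for y :: "nat \<Rightarrow> 'a \<Rightarrow> 'b \<Rightarrow> complex" and j s t
    using that unfolding corner_def by (auto split: sum.splits)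
  have pfix: "p N (tup g N h (corner y)) = tup g N h (corner y)" if "fball g d (cf E) R I y" for y
  proof -
    have yb: "fball g d (cf E) (R <+> I) (R <+> I) (corner y)" using that fball_corner[OF fin] by blast
    show ?thesis unfolding p_tup(2)[OF h N yb, symmetric]
    proof (rule tuple_eqI[OF tup_mtuples tup_mtuples])
      fix j a b assume "j < g" "a < N" "b < N"
      moreover from this have "h a \<in> R <+> I" "h b \<in> R <+> I" using h unfolding bij_betw_def by auto
      ultimately show "tup g N h (ev g p N h (corner y)) ! j $$ (a, b) = tup g N h (corner y) ! j $$ (a, b)"
        using ev_p_nilpotent[OF h N yb supp] by (simp add: tup_nth)
    qed
  qed
  show ?thesis
  proof
    assume x: "fball g d (cf E) R I x"
    then have "fball g d (cf E) (R <+> I) (R <+> I) (corner x)" using fball_corner[OF fin] by blast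
    from p_tup(3)[OF h N this] p_tup(2)[OF h N this] pfix[OF x]
    show "fball g e (cf B) R I x" using spectrahedron_corner[OF fin h B] by simp
  next
    assume "fball g e (cf B) R I x"
    then have X: "tup g N h (corner x) \<in> free_spectrahedron e g B N" using spectrahedron_corner[OF fin h B] by simp
    \<comment> \<open>It is not yet known that \<open>p\<close> attains this point of the
      spectrahedron. A scaled copy lies in the ball of \<open>E\<close>, where \<open>p\<close>
      fixes it, and hence \<open>q\<close> does.\<close>
    obtain K where K: "0 < K" "\<And>w. nsq d (R <+> I) (lam g d (cf E) (R <+> I) (corner x) w) \<le> K\<^sup>2 * nsq d (R <+> I) w"
      using lam_bounded[OF h E] by blast
    define c where "c = complex_of_real (1 / K)"
    have c: "c \<noteq> 0" "(cmod c)\<^sup>2 * K\<^sup>2 = 1" using K(1) unfolding c_def by (auto simp: norm_divide power_divide)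
    let ?y = "\<lambda>j s t. c * x j s t"
    have cy: "corner ?y = (\<lambda>j s t. c * corner x j s t)"
      unfolding corner_def by (auto intro!: ext split: sum.splits)
    have "fball g d (cf E) (R <+> I) (R <+> I) (corner ?y)" unfolding fball_def cy
    proof
      fix v
      have "nsq d (R <+> I) (lam g d (cf E) (R <+> I) (\<lambda>j s t. c * corner x j s t) v)
          = (cmod c)\<^sup>2 * nsq d (R <+> I) (lam g d (cf E) (R <+> I) (corner x) v)"
        unfolding nsq_scale[symmetric] by (rule nsq_cong) (rule lam_scale)
      also have "\<dots> \<le> (cmod c)\<^sup>2 * (K\<^sup>2 * nsq d (R <+> I) v)" by (intro mult_left_mono K(2)) simp
      finally show "nsq d (R <+> I) (lam g d (cf E) (R <+> I) (\<lambda>j s t. c * corner x j s t) v) \<le> nsq d (R <+> I) v"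
        using c(2) by (simp add: mult.assoc[symmetric])
    qed
    then have yb: "fball g d (cf E) R I ?y" using fball_corner[OF fin] by blast
    have yb': "fball g d (cf E) (R <+> I) (R <+> I) (corner ?y)" using yb fball_corner[OF fin] by blast
    have Y: "tup g N h (corner ?y) \<in> free_spectrahedron e g B N"
      using p_tup(2,3)[OF h N yb'] pfix[OF yb] by simp
    have qY: "q N (tup g N h (corner ?y)) = tup g N h (corner ?y)"
      using qp[OF N p_tup(1)[OF h N yb']] pfix[OF yb] by simp
    have evY: "ev g q N h (corner ?y) j s t = corner ?y j s t" if "j < g" "s \<in> R <+> I" "t \<in> R <+> I" for j s t
    proof -
      have "h (inv_into {..<N} h s) = s" "h (inv_into {..<N} h t) = t"
        "inv_into {..<N} h s < N" "inv_into {..<N} h t < N"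
        using that h inv_into_into[of _ h "{..<N}"] by (auto simp: bij_betw_def f_inv_into_f)
      then show ?thesis unfolding ev_def qY using that(1) by (simp add: tup_nth)
    qed
    \<comment> \<open>The diagonal matrix with \<open>c\<close> on the \<open>Inl\<close> part and 1
      on the \<open>Inr\<close> part intertwines the scaled corner tuple with the original one. It
      is invertible, so \<open>q\<close> fixes the original one too.\<close>
    let ?a = "\<lambda>s. (case s of Inl _ \<Rightarrow> c | Inr _ \<Rightarrow> 1)"
    let ?T = "\<lambda>r t. if r = t then ?a t else 0 :: complex"
    have finP: "finite (R <+> I)" using fin by simp
    have a: "?a s \<noteq> 0" for s :: "'a + 'b" using c(1) by (auto split: sum.splits)
    have evX: "ev g q N h (corner x) i s t = corner x i s t" if ist: "i < g" "s \<in> R <+> I" "t \<in> R <+> I" for i s t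
    proof -
      have T1: "(\<Sum>r\<in>R <+> I. f r * ?T r t) = f t * ?a t" if "t \<in> R <+> I" for f t
      proof -
        have "(\<Sum>r\<in>R <+> I. f r * ?T r t) = (\<Sum>r\<in>R <+> I. if r = t then f t * ?a t else 0)"
          by (intro sum.cong) auto
        then show ?thesis using that finP by simp
      qed
      have T2: "(\<Sum>r\<in>R <+> I. ?T s r * f r) = ?a s * f s" if "s \<in> R <+> I" for f s
      proof -
        have "(\<Sum>r\<in>R <+> I. ?T s r * f r) = (\<Sum>r\<in>R <+> I. if r = s then ?a s * f s else 0)"
          by (intro sum.cong) auto
        then show ?thesis using that finP by simp
      qed
      have e: "corner ?y j s t * ?a t = ?a s * corner x j s t" for j s t
        unfolding corner_def by (auto split: sum.splits)
      have "(\<Sum>r\<in>R <+> I. ev g q N h (corner ?y) i s r * ?T r t) = (\<Sum>r\<in>R <+> I. ?T s r * ev g q N h (corner x) i r t)"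
      proof (rule ev_intertwine[OF fq h h N N Y X _ ist])
        fix j s t assume st: "s \<in> R <+> I" "t \<in> R <+> I"
        show "(\<Sum>r\<in>R <+> I. corner ?y j s r * ?T r t) = (\<Sum>r\<in>R <+> I. ?T s r * corner x j r t)"
          unfolding T1[OF st(2)] T2[OF st(1)] by (rule e)
      qed
      then have "ev g q N h (corner ?y) i s t * ?a t = ?a s * ev g q N h (corner x) i s t"
        unfolding T1[OF ist(3)] T2[OF ist(2)] .
      then have "?a s * ev g q N h (corner x) i s t = ?a s * corner x i s t"
        unfolding evY[OF ist] e by (rule sym)
      then show ?thesis using a[of s] by simp
    qed
    have qX: "q N (tup g N h (corner x)) \<in> spectraball d g E N" by (rule q_mem[OF N X])
    have "tup g N h (ev g q N h (corner x)) = q N (tup g N h (corner x))"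
      by (rule tup_ev[OF h]) (use qX in \<open>simp add: spectraball_def\<close>)
    moreover have "tup g N h (ev g q N h (corner x)) = tup g N h (corner x)"
    proof (rule tuple_eqI[OF tup_mtuples tup_mtuples])
      fix j a b assume jab: "j < g" "a < N" "b < N"
      moreover from this have "h a \<in> R <+> I" "h b \<in> R <+> I" using h unfolding bij_betw_def by auto
      ultimately show "tup g N h (ev g q N h (corner x)) ! j $$ (a, b) = tup g N h (corner x) ! j $$ (a, b)"
        using evX by (simp add: tup_nth)
    qed
    ultimately have "tup g N h (corner x) = q N (tup g N h (corner x))" by simp
    then have "tup g N h (corner x) \<in> spectraball d g E N" using qX by simp
    then show "fball g d (cf E) R I x" unfolding spectraball_tup[OF h E] fball_corner[OF fin] .
  qed
qed

end

section \<open>Values on nilpotent tuples\<close>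

text \<open>\<open>shift_tuple m \<epsilon> x\<close> is \<open>x \<otimes> J\<close> for the \<open>m \<times> m\<close> shift \<open>J\<close> with corner entry \<open>\<epsilon>\<close>; \<open>J\<close> is nilpotent for
  \<open>\<epsilon> = 0\<close> and has the \<open>m\<close>-th roots of \<open>\<epsilon>\<close> as its eigenvalues.\<close>

definition shift_tuple :: "nat \<Rightarrow> complex \<Rightarrow> (nat \<Rightarrow> nat \<Rightarrow> nat \<Rightarrow> complex) \<Rightarrow> nat \<Rightarrow> nat \<times> nat \<Rightarrow> nat \<times> nat \<Rightarrow> complex"
where
  "shift_tuple m \<epsilon> x j s t =
     (if fst s = Suc (fst t) then 1 else if fst s = 0 \<and> Suc (fst t) = m then \<epsilon> else 0) * x j (snd s) (snd t)"

text \<open>A nilpotent tuple: the starting column \<open>Inl True\<close> is sent to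
  \<open>Inl False\<close> by \<open>c1 \<alpha>\<close> and to level 1 by \<open>c2 \<xi>\<close>,
  and each level to the next by \<open>x\<close>. With \<open>c1\<close> and \<open>c2\<close>
  balanced, \<open>\<Lambda>\<close> is nearly isometric at a peak vector in the starting column,
  which leaves no room at the levels from 2 on.\<close>

definition test_tuple :: "complex \<Rightarrow> complex \<Rightarrow> (nat \<Rightarrow> complex) \<Rightarrow> (nat \<Rightarrow> nat \<Rightarrow> complex)
    \<Rightarrow> (nat \<Rightarrow> nat \<Rightarrow> nat \<Rightarrow> complex) \<Rightarrow> nat \<Rightarrow> bool + nat \<times> nat \<Rightarrow> bool + nat \<times> nat \<Rightarrow> complex" where
  "test_tuple c1 c2 \<alpha> \<xi> x j s t = (case t of
       Inl r \<Rightarrow> (if r then case s of Inl r' \<Rightarrow> (if r' then 0 else c1 * \<alpha> j)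
                     | Inr kb \<Rightarrow> (if fst kb = 1 then c2 * \<xi> j (snd kb) else 0)
                 else 0)
     | Inr lc \<Rightarrow> (case s of Inl _ \<Rightarrow> 0 | Inr kb \<Rightarrow> if fst kb = Suc (fst lc) then x j (snd kb) (snd lc) else 0))"

abbreviation test_idx :: "nat \<Rightarrow> nat \<Rightarrow> (bool + nat \<times> nat) set" where
  "test_idx m n \<equiv> UNIV <+> {1..<m} \<times> {..<n}"

lemma sum_test_idx:
  "(\<Sum>s\<in>test_idx m n. f s) = f (Inl True) + f (Inl False) + (\<Sum>k\<in>{1..<m}. \<Sum>b<n. f (Inr (k, b)))"
  by (simp add: sum.Plus UNIV_bool sum.cartesian_product add.commute)

lemma lin_lam_sum:
  "lin g d A (\<lambda>j. \<Sum>c<n. x j b c * \<xi> c) y i = (\<Sum>j<g. \<Sum>k<d. \<Sum>c<n. A j i k * x j b c * (y k * \<xi> c))"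
  unfolding lin_def by (simp add: sum_distrib_left sum_distrib_right mult_ac)

lemma lam_test_tuple:
  "lam g d A (test_idx m n) (test_tuple c1 c2 \<alpha> \<xi> x) v i (Inl True) = 0"
  "lam g d A (test_idx m n) (test_tuple c1 c2 \<alpha> \<xi> x) v i (Inl False) = c1 * lin g d A \<alpha> (\<lambda>k. v k (Inl True)) i"
  "lam g d A (test_idx m n) (test_tuple c1 c2 \<alpha> \<xi> x) v i (Inr (1, b))
     = c2 * lin g d A (\<lambda>j. \<xi> j b) (\<lambda>k. v k (Inl True)) i"
  "2 \<le> k \<Longrightarrow> k < m \<Longrightarrow> lam g d A (test_idx m n) (test_tuple c1 c2 \<alpha> \<xi> x) v i (Inr (k, b))
     = lam g d A {..<n} x (\<lambda>h c. v h (Inr (k - 1, c))) i b"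
proof -
  show "lam g d A (test_idx m n) (test_tuple c1 c2 \<alpha> \<xi> x) v i (Inl True) = 0"
    unfolding lam_def sum_test_idx by (simp add: test_tuple_def)
  show "lam g d A (test_idx m n) (test_tuple c1 c2 \<alpha> \<xi> x) v i (Inl False) = c1 * lin g d A \<alpha> (\<lambda>k. v k (Inl True)) i"
    unfolding lam_def sum_test_idx lin_def by (simp add: test_tuple_def sum_distrib_left mult_ac)
  show "lam g d A (test_idx m n) (test_tuple c1 c2 \<alpha> \<xi> x) v i (Inr (1, b))
     = c2 * lin g d A (\<lambda>j. \<xi> j b) (\<lambda>k. v k (Inl True)) i"
  proof -
    have z: "(\<Sum>k\<in>{1..<m}. \<Sum>c<n. A j i h * test_tuple c1 c2 \<alpha> \<xi> x j (Inr (1, b)) (Inr (k, c)) * v h (Inr (k, c))) = 0" for j h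
      by (intro sum.neutral ballI) (auto simp: test_tuple_def)
    show ?thesis unfolding lam_def sum_test_idx lin_def z
      by (simp add: test_tuple_def sum_distrib_left mult_ac)
  qed
  show "lam g d A (test_idx m n) (test_tuple c1 c2 \<alpha> \<xi> x) v i (Inr (k, b))
     = lam g d A {..<n} x (\<lambda>h c. v h (Inr (k - 1, c))) i b" if "2 \<le> k" "k < m"
  proof -
    have z: "(\<Sum>l\<in>{1..<m}. \<Sum>c<n. A j i h * test_tuple c1 c2 \<alpha> \<xi> x j (Inr (k, b)) (Inr (l, c)) * v h (Inr (l, c)))
        = (\<Sum>c<n. A j i h * x j b c * v h (Inr (k - 1, c)))" for j h
    proof -
      have "(\<Sum>l\<in>{1..<m}. \<Sum>c<n. A j i h * test_tuple c1 c2 \<alpha> \<xi> x j (Inr (k, b)) (Inr (l, c)) * v h (Inr (l, c)))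
         = (\<Sum>l\<in>{1..<m}. if l = k - 1 then \<Sum>c<n. A j i h * x j b c * v h (Inr (k - 1, c)) else 0)"
        using that by (intro sum.cong refl) (auto simp: test_tuple_def)
      moreover have "k - 1 \<in> {1..<m}" using that by auto
      ultimately show ?thesis by (simp only: sum.delta finite_atLeastLessThan if_True)
    qed
    show ?thesis unfolding lam_def sum_test_idx z using that by (simp add: test_tuple_def)
  qed
qed

lemma nsq_lam_test_tuple:
  assumes "2 \<le> m"
  shows "nsq d (test_idx m n) (lam g d A (test_idx m n) (test_tuple c1 c2 \<alpha> \<xi> x) v)
    = (cmod c1)\<^sup>2 * nrm d (lin g d A \<alpha> (\<lambda>k. v k (Inl True)))
      + (cmod c2)\<^sup>2 * (\<Sum>b<n. nrm d (lin g d A (\<lambda>j. \<xi> j b) (\<lambda>k. v k (Inl True))))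
      + (\<Sum>k\<in>{2..<m}. nsq d {..<n} (lam g d A {..<n} x (\<lambda>h c. v h (Inr (k - 1, c)))))"
proof -
  have "{1..<m} = insert 1 {2..<m}" using assms by auto
  then have split: "(\<Sum>k\<in>{1..<m}. f k) = f 1 + (\<Sum>k\<in>{2..<m}. f k)" for f :: "nat \<Rightarrow> real" by simp
  have z: "nrm d (\<lambda>i. 0) = 0" unfolding nrm_def by simp
  have "(\<Sum>k\<in>{2..<m}. \<Sum>b<n. nrm d (\<lambda>i. lam g d A (test_idx m n) (test_tuple c1 c2 \<alpha> \<xi> x) v i (Inr (k, b))))
      = (\<Sum>k\<in>{2..<m}. nsq d {..<n} (lam g d A {..<n} x (\<lambda>h c. v h (Inr (k - 1, c)))))"
    unfolding nsq_columns by (intro sum.cong refl) (simp add: lam_test_tuple(4) del: One_nat_def)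
  then show ?thesis
    unfolding nsq_columns[of d "test_idx m n"] sum_test_idx split lam_test_tuple(1,2,3) nrm_scale z sum_distrib_left
    by simp
qed

text \<open>The starting column is bounded by \<open>c\<close>; the levels contribute shifted copies
  of the contraction \<open>\<Lambda>_A(x)\<close>, whose images are orthogonal to each other and to
  the rest.\<close>

lemma fball_test_tuple:
  assumes m: "2 \<le> m" and x: "fball g d A {..<n} {..<n} x"
    and c: "\<And>y. (cmod c1)\<^sup>2 * nrm d (lin g d A \<alpha> y) + (cmod c2)\<^sup>2 * (\<Sum>b<n. nrm d (lin g d A (\<lambda>j. \<xi> j b) y)) \<le> nrm d y"
  shows "fball g d A (test_idx m n) (test_idx m n) (test_tuple c1 c2 \<alpha> \<xi> x)"
  unfolding fball_def
proof
  fix v :: "nat \<Rightarrow> bool + nat \<times> nat \<Rightarrow> complex"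
  let ?v = "\<lambda>k. nsq d {..<n} (\<lambda>h c. v h (Inr (k, c)))"
  have "(\<Sum>k\<in>{2..<m}. nsq d {..<n} (lam g d A {..<n} x (\<lambda>h c. v h (Inr (k - 1, c))))) \<le> (\<Sum>k\<in>{2..<m}. ?v (k - 1))"
    using x unfolding fball_def by (intro sum_mono) auto
  also have "\<dots> = (\<Sum>k\<in>(\<lambda>k. k - 1) ` {2..<m}. ?v k)"
    by (subst sum.reindex) (auto simp: inj_on_def)
  also have "\<dots> \<le> (\<Sum>k\<in>{1..<m}. ?v k)" by (intro sum_mono2) auto
  finally have "(\<Sum>k\<in>{2..<m}. nsq d {..<n} (lam g d A {..<n} x (\<lambda>h c. v h (Inr (k - 1, c))))) \<le> (\<Sum>k\<in>{1..<m}. ?v k)" .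
  moreover have "nsq d (test_idx m n) v = nrm d (\<lambda>k. v k (Inl True)) + nrm d (\<lambda>k. v k (Inl False)) + (\<Sum>k\<in>{1..<m}. ?v k)"
    unfolding nsq_columns sum_test_idx ..
  ultimately show "nsq d (test_idx m n) (lam g d A (test_idx m n) (test_tuple c1 c2 \<alpha> \<xi> x) v) \<le> nsq d (test_idx m n) v"
    unfolding nsq_lam_test_tuple[OF m] using c[of "\<lambda>k. v k (Inl True)"] nrm_nonneg[of d "\<lambda>k. v k (Inl False)"]
    by linarith
qed

lemma sum_grid: "(\<Sum>s\<in>{..<m} \<times> {..<n}. f s) = (\<Sum>k<m. \<Sum>b<n. f (k, b))" for m n :: nat
  by (simp add: sum.cartesian_product)

lemma lam_shift_tuple:
  assumes "k < m"
  shows "lam g d A ({..<m} \<times> {..<n}) (shift_tuple m 0 x) v i (k, b)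
    = (if k = 0 then 0 else lam g d A {..<n} x (\<lambda>h c. v h (k - 1, c)) i b)"
proof -
  have z: "(\<Sum>l<m. \<Sum>c<n. A j i h * shift_tuple m 0 x j (k, b) (l, c) * v h (l, c))
      = (if k = 0 then 0 else \<Sum>c<n. A j i h * x j b c * v h (k - 1, c))" for j h
  proof -
    have "(\<Sum>l<m. \<Sum>c<n. A j i h * shift_tuple m 0 x j (k, b) (l, c) * v h (l, c))
      = (\<Sum>l<m. if l = k - 1 then if k = 0 then 0 else \<Sum>c<n. A j i h * x j b c * v h (k - 1, c) else 0)"
      by (intro sum.cong refl) (auto simp: shift_tuple_def)
    then show ?thesis using assms by simp
  qed
  show ?thesis unfolding lam_def sum_grid z by simp
qed

lemma fball_shift_tuple:
  assumes x: "fball g d A {..<n} {..<n} x"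
  shows "fball g d A ({..<m} \<times> {..<n}) ({..<m} \<times> {..<n}) (shift_tuple m 0 x)"
  unfolding fball_def
proof
  fix v :: "nat \<Rightarrow> nat \<times> nat \<Rightarrow> complex"
  let ?v = "\<lambda>k. nsq d {..<n} (\<lambda>h c. v h (k, c))"
  have cols: "nsq d ({..<m} \<times> {..<n}) w = (\<Sum>k<m. nsq d {..<n} (\<lambda>h c. w h (k, c)))" for w :: "nat \<Rightarrow> nat \<times> nat \<Rightarrow> complex"
    unfolding nsq_columns sum_grid ..
  have "nsq d ({..<m} \<times> {..<n}) (lam g d A ({..<m} \<times> {..<n}) (shift_tuple m 0 x) v)
      = (\<Sum>k<m. if k = 0 then 0 else nsq d {..<n} (lam g d A {..<n} x (\<lambda>h c. v h (k - 1, c))))"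
    unfolding cols by (intro sum.cong refl) (simp add: lam_shift_tuple nsq_def)
  also have "\<dots> \<le> (\<Sum>k<m. if k = 0 then 0 else ?v (k - 1))"
    using x unfolding fball_def by (intro sum_mono) auto
  also have "\<dots> = (\<Sum>k\<in>{1..<m}. ?v (k - 1))"
    by (intro sum.mono_neutral_cong_right) auto
  also have "\<dots> = (\<Sum>k\<in>(\<lambda>k. k - 1) ` {1..<m}. ?v k)"
    by (subst sum.reindex) (auto simp: inj_on_def)
  also have "\<dots> \<le> (\<Sum>k<m. ?v k)" by (intro sum_mono2) auto
  finally show "nsq d ({..<m} \<times> {..<n}) (lam g d A ({..<m} \<times> {..<n}) (shift_tuple m 0 x) v) \<le> nsq d ({..<m} \<times> {..<n}) v"
    unfolding cols .
qed

text \<open>Second order perturbation of the simple maximal singular value of \<open>\<Lambda>_A(\<alpha>_a)\<close>.\<close>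

lemma gen_data_perturbation:
  assumes gd: "gen_data g d A \<alpha> u" and a: "a \<le> d"
    and \<sigma>: "(\<Sum>b<n. nrm d (lin g d A (\<beta> b) (u a))) < \<sigma> * nrm d (u a)"
  obtains \<epsilon> where "0 < \<epsilon>"
    "\<And>y. nrm d (lin g d A (\<alpha> a) y) + \<epsilon> * (\<Sum>b<n. nrm d (lin g d A (\<beta> b) y)) \<le> (1 + \<epsilon> * \<sigma>) * nrm d y"
proof -
  have contr: "\<And>x. nrm d (lin g d A (\<alpha> a) x) \<le> nrm d x"
    and uniq: "\<And>x. nrm d (lin g d A (\<alpha> a) x) = nrm d x \<Longrightarrow> \<exists>c. \<forall>i<d. x i = c * u a i"
    using gd a unfolding gen_data_def by auto
  let ?S = "sphere2 d {()}" and ?c = "\<lambda>v :: nat \<Rightarrow> unit \<Rightarrow> complex. \<lambda>i. v i ()"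
  let ?q0 = "\<lambda>v. nrm d (?c v) - nrm d (lin g d A (\<alpha> a) (?c v))"
  let ?q1 = "\<lambda>v. \<sigma> * nrm d (?c v) - (\<Sum>b<n. nrm d (lin g d A (\<beta> b) (?c v)))"
  have cont: "continuous_on ?S ?q0" "continuous_on ?S ?q1"
    unfolding nrm_def lin_def by (intro continuous_intros)+
  have linc: "lin g d A \<beta> (\<lambda>i. c * x i) = (\<lambda>i. c * lin g d A \<beta> x i)" for \<beta> c x
    unfolding lin_def by (simp add: sum_distrib_left mult_ac)
  have nsq1: "nsq d {()} v = nrm d (?c v)" for v unfolding nsq_columns by simp
  \<comment> \<open>The maximizers of the leading form are the multiples of \<open>u a\<close>, and
    \<open>\<sigma>\<close> exceeds the value of the second form there.\<close>
  have pos: "0 < ?q1 v" if v: "v \<in> ?S" and z: "?q0 v = 0" for v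
  proof -
    obtain c where c: "\<And>i. i < d \<Longrightarrow> v i () = c * u a i" using uniq[of "?c v"] z by auto
    have n: "nrm d (?c v) = 1" using v unfolding sphere2_def nsq1 by simp
    have "nrm d (?c v) = nrm d (\<lambda>i. c * u a i)" by (rule nrm_cong) (rule c)
    then have c0: "(cmod c)\<^sup>2 * nrm d (u a) = 1" using n unfolding nrm_scale by simp
    have "lin g d A (\<beta> b) (?c v) = lin g d A (\<beta> b) (\<lambda>i. c * u a i)" for b
      unfolding lin_def using c by (intro ext sum.cong refl) auto
    then have "?q1 v = (cmod c)\<^sup>2 * (\<sigma> * nrm d (u a) - (\<Sum>b<n. nrm d (lin g d A (\<beta> b) (u a))))"
      unfolding n using c0 by (simp add: linc nrm_scale sum_distrib_left algebra_simps)
    moreover have "(cmod c)\<^sup>2 > 0" using c0 by (cases "c = 0") auto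
    ultimately show ?thesis using \<sigma> by simp
  qed
  have "\<exists>\<epsilon>>0. \<exists>\<delta>>0. \<forall>v\<in>?S. \<delta> \<le> ?q0 v + \<epsilon> * ?q1 v"
    by (rule compact_pos_combination[OF compact_sphere2 cont]) (use contr pos in auto)
  then obtain \<epsilon> \<delta> where ed: "\<epsilon> > 0" "\<delta> > 0" "\<And>v. v \<in> ?S \<Longrightarrow> \<delta> \<le> ?q0 v + \<epsilon> * ?q1 v" by auto
  have b: "\<delta> * nsq d {()} v \<le> ?q0 v + \<epsilon> * ?q1 v" for v
  proof (rule homogeneous_lower_bound[of "{()}" "\<lambda>v. ?q0 v + \<epsilon> * ?q1 v"])
    show "?q0 (\<lambda>i s. of_real c * v i s) + \<epsilon> * ?q1 (\<lambda>i s. of_real c * v i s) = c\<^sup>2 * (?q0 v + \<epsilon> * ?q1 v)" for c v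
      unfolding linc nrm_scale by (simp add: sum_distrib_left[symmetric] algebra_simps)
    show "?q0 v + \<epsilon> * ?q1 v = ?q0 w + \<epsilon> * ?q1 w" if "\<And>i s. i < d \<Longrightarrow> s \<in> {()} \<Longrightarrow> v i s = w i s" for v w
    proof -
      have "lin g d A \<beta> (?c v) = lin g d A \<beta> (?c w)" for \<beta>
        unfolding lin_def using that by (intro ext sum.cong refl) auto
      moreover have "nrm d (?c v) = nrm d (?c w)" using that by (intro nrm_cong) auto
      ultimately show ?thesis by simp
    qed
  qed (use ed in auto)
  have "nrm d (lin g d A (\<alpha> a) y) + \<epsilon> * (\<Sum>b<n. nrm d (lin g d A (\<beta> b) y)) \<le> (1 + \<epsilon> * \<sigma>) * nrm d y" for y
  proof -
    have "0 \<le> \<delta> * nsq d {()} (\<lambda>i s. y i)" using ed(2) by simp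
    then show ?thesis using b[of "\<lambda>i s. y i"] by (simp add: algebra_simps)
  qed
  then show ?thesis using that ed(1) by blast
qed
lemma sum_delta_mult:
  fixes f :: "'a \<Rightarrow> complex"
  assumes "finite R" "t \<in> R"
  shows "(\<Sum>r\<in>R. f r * (if r = t then c else 0)) = f t * c" "(\<Sum>r\<in>R. (if r = t then c else 0) * f r) = c * f t"
proof -
  have "(\<Sum>r\<in>R. f r * (if r = t then c else 0)) = (\<Sum>r\<in>R. if r = t then f t * c else 0)"
    "(\<Sum>r\<in>R. (if r = t then c else 0) * f r) = (\<Sum>r\<in>R. if r = t then c * f t else 0)"
    by (intro sum.cong refl; auto)+
  then show "(\<Sum>r\<in>R. f r * (if r = t then c else 0)) = f t * c" "(\<Sum>r\<in>R. (if r = t then c else 0) * f r) = c * f t"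
    using assms by simp_all
qed

lemma finite_enumeration: "finite I \<Longrightarrow> \<exists>h. bij_betw h {..<card I} I"
  using ex_bij_betw_nat_finite[of I] by (simp add: lessThan_atLeast0)

context ball_map
begin

text \<open>\<open>\<Lambda>_B(p(X)) (I + \<Lambda>_B(p(X)))\<inverse>\<close> at a test tuple
  \<open>X\<close> is a contraction, here applied to \<open>u a\<close> in the starting column. The
  components of the image at \<open>Inl False\<close> and at level 1 are linear in \<open>X\<close>
  and exhaust the norm of \<open>u a\<close> up to a slack \<open>\<kappa>\<close>. Those at the
  levels from 2 on are, up to a factor, the components of the solution \<open>w0\<close> for the
  shift tuple, which therefore vanish.\<close>

lemma shift_kernel_peak:
  fixes x \<xi>
  assumes gd: "gen_data g e (cf B) \<alpha> u" and a: "a \<le> e" and m: "2 \<le> m" and n: "0 < n"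
    and x: "fball g d (cf E) {..<n} {..<n} x" and h: "bij_betw h {..<N} ({..<m} \<times> {..<n})"
    and is0: "i < e" "s \<in> {..<m} \<times> {..<n}"
  defines "z \<equiv> (\<lambda>i (s :: nat \<times> nat). if fst s = 0 then u a i * \<xi> (snd s) else 0)"
    and "Y \<equiv> shift_tuple m 0 x"
  defines "P \<equiv> ev g p N h Y"
  defines "w \<equiv> (\<lambda>i s. z i s - lam g e (cf B) ({..<m} \<times> {..<n}) Y z i s)"
  shows "w i s + lam g e (cf B) ({..<m} \<times> {..<n}) P w i s = z i s"
proof -
  let ?G = "{..<m} \<times> {..<n}" and ?I = "test_idx m n"
  let ?LG = "lam g e (cf B) ?G" and ?LI = "lam g e (cf B) ?I"
  define \<xi>' where "\<xi>' j b = (\<Sum>c<n. x j b c * \<xi> c)" for j b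
  \<comment> \<open>The component at \<open>b\<close> of \<open>\<Lambda>_B(x)\<close> applied to
    the tensor of \<open>u a\<close> and \<open>\<xi>\<close>: the term of degree one.\<close>
  define L where "L b = lin g e (cf B) (\<lambda>j. \<xi>' j b) (u a)" for b
  have upos: "0 < nrm e (u a)" and peak: "nrm e (lin g e (cf B) (\<alpha> a) (u a)) = nrm e (u a)"
    using gd a unfolding gen_data_def by auto
  have N: "0 < N"
  proof (rule ccontr)
    assume "\<not> 0 < N"
    then have "?G = {}" using h unfolding bij_betw_def by auto
    moreover have "(0, 0) \<in> ?G" using m n by simp
    ultimately show False by blast
  qed
  have finG: "finite ?G" and finI: "finite ?I" by auto
  have Y: "fball g d (cf E) ?G ?G Y" unfolding Y_def by (rule fball_shift_tuple[OF x])
  have xB: "fball g e (cf B) {..<n} {..<n} x" using x fball_eq[of "{..<n}" "{..<n}" x] by simp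
  note YG = p_tup[OF h N Y, folded P_def]
  have LYz: "?LG Y z i (k, b) = (if k = 1 then L b i else 0)" if "k < m" "b < n" for i k b
  proof -
    have "?LG Y z i (k, b) = (if k = 0 then 0 else lam g e (cf B) {..<n} x (\<lambda>h c. z h (k - 1, c)) i b)"
      unfolding Y_def by (rule lam_shift_tuple[OF that(1)])
    also have "\<dots> = (if k = 1 then L b i else 0)"
    proof (cases "k = 1")
      case True
      then show ?thesis unfolding L_def \<xi>'_def lin_lam_sum by (simp add: lam_def z_def)
    next
      case False
      then show ?thesis by (cases "k = 0") (auto simp: lam_def z_def)
    qed
    finally show ?thesis .
  qed
  obtain w0 where w0: "\<And>i s. i < e \<Longrightarrow> s \<in> ?G \<Longrightarrow> w0 i s + ?LG P w0 i s = z i s"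
    using spectrahedron_solve[OF h B YG(3), of z] by blast

  have key: "w0 i (0, b) = u a i * \<xi> b" "w0 i (1, b) = - L b i"
    "(\<Sum>k\<in>{2..<m}. \<Sum>b<n. nrm e (\<lambda>i. w0 i (k, b))) \<le> \<kappa> * nrm e (u a)"
    if \<kappa>: "0 < \<kappa>" and ib: "i < e" "b < n" for \<kappa> i b
  proof -
    \<comment> \<open>The quotient of the second form at \<open>u a\<close>, raised by \<kappa> to
      get the strict inequality that \<open>gen_data_perturbation\<close> asks for.\<close>
    define \<sigma> where "\<sigma> = (\<Sum>b<n. nrm e (L b)) / nrm e (u a) + \<kappa>"
    have \<sigma>: "\<sigma> * nrm e (u a) = (\<Sum>b<n. nrm e (L b)) + \<kappa> * nrm e (u a)"
      using upos unfolding \<sigma>_def by (simp add: field_simps)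
    then have "(\<Sum>b<n. nrm e (lin g e (cf B) (\<lambda>j. \<xi>' j b) (u a))) < \<sigma> * nrm e (u a)"
      using \<kappa> upos unfolding L_def by simp
    from gen_data_perturbation[OF gd a, where n = n and \<beta> = "\<lambda>b j. \<xi>' j b", OF this] obtain \<epsilon> where \<epsilon>: "0 < \<epsilon>"
      and pert: "\<And>y. nrm e (lin g e (cf B) (\<alpha> a) y) + \<epsilon> * (\<Sum>b<n. nrm e (lin g e (cf B) (\<lambda>j. \<xi>' j b) y))
        \<le> (1 + \<epsilon> * \<sigma>) * nrm e y" by auto
    have "0 \<le> (\<Sum>b<n. nrm e (L b))" by (intro sum_nonneg) simp
    then have \<sigma>0: "0 \<le> \<sigma>" using \<kappa> upos unfolding \<sigma>_def by simp
    \<comment> \<open>Normalizes the perturbed bound \<open>1 + \<epsilon> * \<sigma>\<close> to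
      1.\<close>
    define \<tau> where "\<tau> = 1 / sqrt (1 + \<epsilon> * \<sigma>)"
    have pos: "0 < 1 + \<epsilon> * \<sigma>" using \<epsilon> \<sigma>0 by (simp add: add_pos_nonneg)
    have \<tau>: "0 < \<tau>" "\<tau>\<^sup>2 * (1 + \<epsilon> * \<sigma>) = 1" using pos unfolding \<tau>_def by (auto simp: power_divide)
    define c1 where "c1 = complex_of_real \<tau>"
    define c2 where "c2 = complex_of_real (\<tau> * sqrt \<epsilon>)"
    have c: "(cmod c1)\<^sup>2 = \<tau>\<^sup>2" "(cmod c2)\<^sup>2 = \<tau>\<^sup>2 * \<epsilon>" "c2 \<noteq> 0"
      using \<tau>(1) \<epsilon> unfolding c1_def c2_def by (auto simp: norm_mult power_mult_distrib)
    have bound: "(cmod c1)\<^sup>2 * nrm e (lin g e (cf B) (\<alpha> a) y)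
        + (cmod c2)\<^sup>2 * (\<Sum>b<n. nrm e (lin g e (cf B) (\<lambda>j. \<xi>' j b) y)) \<le> nrm e y" for y
    proof -
      have "\<tau>\<^sup>2 * (nrm e (lin g e (cf B) (\<alpha> a) y) + \<epsilon> * (\<Sum>b<n. nrm e (lin g e (cf B) (\<lambda>j. \<xi>' j b) y)))
          \<le> \<tau>\<^sup>2 * ((1 + \<epsilon> * \<sigma>) * nrm e y)" by (intro mult_left_mono pert) simp
      then show ?thesis unfolding c using \<tau>(2) by (simp add: distrib_left mult.assoc[symmetric])
    qed
    define X where "X = test_tuple c1 c2 (\<alpha> a) \<xi>' x"
    have "fball g e (cf B) ?I ?I X" unfolding X_def by (rule fball_test_tuple[OF m xB bound])
    then have X: "fball g d (cf E) ?I ?I X" using fball_eq[OF finI finI] by blast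
    obtain h' and N' :: nat where h': "bij_betw h' {..<N'} ?I"
      using finite_enumeration[OF finI] by blast
    have N': "0 < N'"
    proof (rule ccontr)
      assume "\<not> 0 < N'"
      then have "?I = {}" using h' unfolding bij_betw_def by auto
      then show False by auto
    qed
    define Q where "Q = ev g p N' h' X"
    note XG = p_tup[OF h' N' X, folded Q_def]
    define zz where "zz i (s :: bool + nat \<times> nat) = (if s = Inl True then u a i else 0)" for i s
    obtain w' where w': "\<And>i s. i < e \<Longrightarrow> s \<in> ?I \<Longrightarrow> w' i s + ?LI Q w' i s = zz i s"
      using spectrahedron_solve[OF h' B XG(3), of zz] by blast

    \<comment> \<open>Sends the starting column to \<open>c2 \<xi>\<close> at level 0, drops
      \<open>Inl False\<close> and is the identity on the other levels. It intertwines the shift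
      tuple with the test tuple and thereby turns \<open>w'\<close> into \<open>c2\<close> times
      \<open>w0\<close>.\<close>
    define T1 :: "nat \<times> nat \<Rightarrow> bool + nat \<times> nat \<Rightarrow> complex" where
      "T1 s t = (case t of Inl r \<Rightarrow> if r \<and> fst s = 0 then c2 * \<xi> (snd s) else 0
         | Inr lc \<Rightarrow> if lc = s then 1 else 0)" for s t
    have tenT1: "ten ?I T1 v i (k, b) = (if k = 0 then c2 * \<xi> b * v i (Inl True) else v i (Inr (k, b)))"
      if "k < m" "b < n" for v i k b
    proof -
      have "(\<Sum>l\<in>{1..<m}. \<Sum>c<n. T1 (k, b) (Inr (l, c)) * v i (Inr (l, c)))
          = (\<Sum>lc\<in>{1..<m} \<times> {..<n}. if lc = (k, b) then v i (Inr (k, b)) else 0)"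
        unfolding sum.cartesian_product by (intro sum.cong) (auto simp: T1_def split: if_splits)
      also have "\<dots> = (if k = 0 then 0 else v i (Inr (k, b)))" using that by auto
      finally show ?thesis unfolding ten_def sum_test_idx by (simp add: T1_def)
    qed
    have T1: "(\<Sum>r\<in>?G. Y j s r * T1 r t) = (\<Sum>r\<in>?I. T1 s r * X j r t)"
      if j: "j < g" and s: "s \<in> ?G" and t: "t \<in> ?I" for j s t
    proof -
      obtain k b where kb: "s = (k, b)" "k < m" "b < n" using s by auto
      have "(\<Sum>r\<in>?I. T1 s r * X j r t) = ten ?I T1 (\<lambda>i r. X j r t) 0 s" unfolding ten_def ..
      also have "\<dots> = (if k = 0 then c2 * \<xi> b * X j (Inl True) t else X j (Inr (k, b)) t)"
        unfolding kb(1) by (rule tenT1[OF kb(2,3)])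
      finally have rhs: "(\<Sum>r\<in>?I. T1 s r * X j r t) = (if k = 0 then c2 * \<xi> b * X j (Inl True) t else X j (Inr (k, b)) t)" .
      show ?thesis
      proof (cases t)
        case (Inl r)
        have "(\<Sum>l<m. \<Sum>c<n. Y j s (l, c) * T1 (l, c) t)
            = (\<Sum>l<m. if l = 0 then if r \<and> k = 1 then c2 * \<xi>' j b else 0 else 0)"
          by (intro sum.cong refl) (auto simp: Inl T1_def Y_def shift_tuple_def kb(1) \<xi>'_def sum_distrib_left mult_ac)
        then show ?thesis unfolding sum_grid rhs using m
          by (auto simp: Inl X_def test_tuple_def)
      next
        case (Inr lc)
        then have lc: "lc \<in> ?G" "fst lc \<noteq> 0" using t by auto
        have "(\<Sum>r\<in>?G. Y j s r * T1 r t) = (\<Sum>r\<in>?G. Y j s r * (if r = lc then 1 else 0))"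
          by (intro sum.cong) (auto simp: Inr T1_def)
        also have "\<dots> = Y j s lc" using sum_delta_mult(1)[OF finG lc(1), of "Y j s" 1] by simp
        finally show ?thesis unfolding rhs using lc(2)
          by (auto simp: Inr X_def test_tuple_def Y_def shift_tuple_def kb(1))
      qed
    qed
    have PQ: "(\<Sum>r\<in>?G. P j s r * T1 r t) = (\<Sum>r\<in>?I. T1 s r * Q j r t)"
      if "j < g" "s \<in> ?G" "t \<in> ?I" for j s t
      unfolding P_def Q_def
      by (rule ev_intertwine[OF fp h h' N N' YG(1) XG(1) T1 that])
    have link: "ten ?I T1 w' i s = c2 * w0 i s" if is1: "i < e" "s \<in> ?G" for i s
    proof (rule spectrahedron_inj[OF h B YG(3) _ is1])
      fix i s assume i1: "i < e" "s \<in> ?G"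
      obtain k b where kb: "s = (k, b)" "k < m" "b < n" using i1(2) by auto
      have "?LG P (ten ?I T1 w') i s = ten ?I T1 (?LI Q w') i s"
        by (rule lam_intertwine) (rule PQ[OF _ i1(2)])
      then have "ten ?I T1 w' i s + ?LG P (ten ?I T1 w') i s = (\<Sum>t\<in>?I. T1 s t * (w' i t + ?LI Q w' i t))"
        unfolding ten_def by (simp add: sum.distrib distrib_left)
      also have "\<dots> = ten ?I T1 zz i s" unfolding ten_def using w'[OF i1(1)] by simp
      also have "\<dots> = c2 * z i s" unfolding kb(1) tenT1[OF kb(2,3)] by (simp add: zz_def z_def)
      also have "\<dots> = c2 * w0 i s + ?LG P (\<lambda>i s. c2 * w0 i s) i s"
        unfolding lam_scale_vec w0[OF i1, symmetric] by (simp add: distrib_left)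
      finally show "ten ?I T1 w' i s + ?LG P (ten ?I T1 w') i s = c2 * w0 i s + ?LG P (\<lambda>i s. c2 * w0 i s) i s" .
    qed

    \<comment> \<open>Only the starting column of \<open>X\<close>. This tuple is fixed by
      \<open>p\<close>, so the components that the projection \<open>T2\<close> keeps, the two
      \<open>Inl\<close> ones and level 1, can be computed exactly.\<close>
    define X2 where "X2 j s t = (if t = Inl True then X j s t else 0)" for j s t
    have X2: "fball g d (cf E) ?I ?I X2"
    proof -
      have "X2 = test_tuple c1 c2 (\<alpha> a) \<xi>' (\<lambda>j b c. 0)"
        unfolding X2_def X_def test_tuple_def by (auto intro!: ext split: sum.splits)
      moreover have "fball g e (cf B) {..<n} {..<n} (\<lambda>j b c. 0)"
        unfolding fball_def lam_def by (simp add: nsq_def sum_nonneg)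
      ultimately have "fball g e (cf B) ?I ?I X2" using fball_test_tuple[OF m _ bound] by simp
      then show ?thesis using fball_eq[OF finI finI] by blast
    qed
    have evX2: "ev g p N' h' X2 j s t = X2 j s t" if "j < g" "s \<in> ?I" "t \<in> ?I" for j s t
      by (rule ev_p_nilpotent[OF h' N' X2 _ that, where J = "{Inl True}"])
        (auto simp: X2_def X_def test_tuple_def split: sum.splits if_splits)
    let ?keep = "\<lambda>s :: bool + nat \<times> nat. case s of Inl _ \<Rightarrow> True | Inr kb \<Rightarrow> fst kb = 1"
    define T2 where "T2 s t = (if t = s then if ?keep s then 1 else 0 else 0 :: complex)" for s t :: "bool + nat \<times> nat"
    have T2l: "(\<Sum>r\<in>?I. T2 s r * f r) = (if ?keep s then 1 else 0) * f s" if "s \<in> ?I" for f s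
      unfolding T2_def by (rule sum_delta_mult(2)[OF finI that])
    have T2r: "(\<Sum>r\<in>?I. f r * T2 r t) = f t * (if ?keep t then 1 else 0)" if "t \<in> ?I" for f t
    proof -
      have "(\<Sum>r\<in>?I. f r * T2 r t) = (\<Sum>r\<in>?I. f r * (if r = t then if ?keep t then 1 else 0 else 0))"
        unfolding T2_def by (intro sum.cong) auto
      then show ?thesis using sum_delta_mult(1)[OF finI that] by simp
    qed
    have XX2: "(\<Sum>r\<in>?I. ev g p N' h' X2 j s r * T2 r t) = (\<Sum>r\<in>?I. T2 s r * Q j r t)"
      if "j < g" "s \<in> ?I" "t \<in> ?I" for j s t
      unfolding Q_def
    proof (rule ev_intertwine[OF fp h' h' N' N' p_tup(1)[OF h' N' X2] XG(1) _ that])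
      fix j s t assume st: "s \<in> ?I" "t \<in> ?I"
      show "(\<Sum>r\<in>?I. X2 j s r * T2 r t) = (\<Sum>r\<in>?I. T2 s r * X j r t)"
        unfolding T2l[OF st(1)] T2r[OF st(2)] using st
        by (auto simp: X2_def X_def test_tuple_def split: sum.splits)
    qed
    have w'eq: "w' i s = zz i s - ?LI X2 w' i s" if is1: "i < e" "s \<in> ?I" and k: "?keep s" for i s
    proof -
      have "?LI (ev g p N' h' X2) (ten ?I T2 w') i s = ten ?I T2 (?LI Q w') i s"
        by (rule lam_intertwine) (rule XX2[OF _ is1(2)])
      also have "?LI (ev g p N' h' X2) (ten ?I T2 w') i s = ?LI X2 (ten ?I T2 w') i s"
        by (rule lam_cong) (simp add: evX2[OF _ is1(2)])
      also have "\<dots> = ?LI X2 w' i s"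
        by (rule lam_cong) (auto simp: X2_def ten_def T2l simp del: One_nat_def)
      also have "ten ?I T2 (?LI Q w') i s = ?LI Q w' i s"
        unfolding ten_def T2l[OF is1(2)] using k by simp
      finally show ?thesis using w'[OF is1] by (simp add: algebra_simps)
    qed
    have memI: "Inl r \<in> ?I" "1 \<le> k \<Longrightarrow> k < m \<Longrightarrow> b < n \<Longrightarrow> Inr (k, b) \<in> ?I" for r k b by auto
    have X2e: "X2 j s (Inl True) = X j s (Inl True)" "t \<noteq> Inl True \<Longrightarrow> X2 j s t = 0" for j s t unfolding X2_def by auto
    have LX2: "?LI X2 w' i s = (\<Sum>j<g. \<Sum>k<e. cf B j i k * X j s (Inl True) * w' k (Inl True))" for i s
      unfolding lam_def sum_test_idx by (simp add: X2e)
    have e0: "w' i (Inl True) = u a i" if "i < e" for i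
      using w'eq[OF that memI(1), of True] unfolding LX2 by (simp add: X_def test_tuple_def zz_def)
    have lin0: "(\<Sum>j<g. \<Sum>k<e. cf B j i k * (c * \<beta> j) * w' k (Inl True)) = c * lin g e (cf B) \<beta> (u a) i" for i \<beta> c
      unfolding lin_def using e0 by (simp add: sum_distrib_left mult_ac)
    have e1: "w' i (Inl False) = - (c1 * lin g e (cf B) (\<alpha> a) (u a) i)" if "i < e" for i
      using w'eq[OF that memI(1), of False] lin0[of i c1 "\<alpha> a"] unfolding LX2 by (simp add: X_def test_tuple_def zz_def)
    have e2: "w' i (Inr (1, b)) = - (c2 * L b i)" if "i < e" "b < n" for i b
      using w'eq[OF that(1) memI(2)[of 1 b]] lin0[of i c2 "\<lambda>j. \<xi>' j b"] that m unfolding LX2 L_def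
      by (simp add: X_def test_tuple_def zz_def)
    have e3: "w' i (Inr (k, b)) = c2 * w0 i (k, b)" if "i < e" "b < n" "1 \<le> k" "k < m" for i k b
      using link[OF that(1), of "(k, b)"] tenT1[OF that(4,2), of w' i] that by simp
    show "w0 i (0, b) = u a i * \<xi> b"
      using link[OF ib(1), of "(0, b)"] tenT1[of 0 b w' i] ib m c(3) e0[OF ib(1)] by simp
    have "c2 * w0 i (1, b) = c2 * (- L b i)"
      using e3[OF ib, of 1] e2[OF ib] m by simp
    then show "w0 i (1, b) = - L b i" using c(3) by (simp only: mult_cancel_left) simp
    \<comment> \<open>The contraction estimate; its right-hand side is exactly the squared norm of
      \<open>u a\<close>.\<close>
    have "nsq e ?I (?LI Q w') \<le> nsq e ?I (\<lambda>i s. w' i s + ?LI Q w' i s)"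
      by (rule spectrahedron_contraction[OF h' B XG(3)])
    also have "\<dots> = nsq e ?I zz" by (rule nsq_cong) (rule w')
    also have "\<dots> = nrm e (u a)"
      unfolding nsq_columns sum_test_idx by (simp add: zz_def nrm_def)
    finally have le: "nsq e ?I (?LI Q w') \<le> nrm e (u a)" .
    have val: "?LI Q w' i s = zz i s - w' i s" if "i < e" "s \<in> ?I" for i s
      using w'[OF that] by (simp add: algebra_simps)
    have neg: "nrm e (\<lambda>i. - f i) = nrm e f" for f unfolding nrm_def by simp
    have "nrm e (\<lambda>i. ?LI Q w' i (Inl False)) = nrm e (\<lambda>i. c1 * lin g e (cf B) (\<alpha> a) (u a) i)"
      by (rule nrm_cong) (simp add: val memI(1) e1 zz_def del: One_nat_def)
    then have n1: "nrm e (\<lambda>i. ?LI Q w' i (Inl False)) = \<tau>\<^sup>2 * nrm e (u a)"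
      unfolding nrm_scale c peak .
    have n2: "nrm e (\<lambda>i. ?LI Q w' i (Inr (1, b))) = \<tau>\<^sup>2 * \<epsilon> * nrm e (L b)" if "b < n" for b
    proof -
      have "nrm e (\<lambda>i. ?LI Q w' i (Inr (1, b))) = nrm e (\<lambda>i. c2 * L b i)"
        using that m by (intro nrm_cong) (simp add: val memI(2) e2 zz_def del: One_nat_def)
      then show ?thesis unfolding nrm_scale c .
    qed
    have n3: "nrm e (\<lambda>i. ?LI Q w' i (Inr (k, b))) = \<tau>\<^sup>2 * \<epsilon> * nrm e (\<lambda>i. w0 i (k, b))"
      if "k \<in> {2..<m}" "b < n" for k b
    proof -
      have "nrm e (\<lambda>i. ?LI Q w' i (Inr (k, b))) = nrm e (\<lambda>i. - (c2 * w0 i (k, b)))"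
        using that by (intro nrm_cong) (simp add: val memI(2) e3 zz_def del: One_nat_def)
      then show ?thesis unfolding neg nrm_scale c .
    qed
    have split: "(\<Sum>k\<in>{1..<m}. f k) = f 1 + (\<Sum>k\<in>{2..<m}. f k)" for f :: "nat \<Rightarrow> real"
    proof -
      have "{1..<m} = insert 1 {2..<m}" using m by auto
      then show ?thesis by simp
    qed
    let ?S = "\<Sum>k\<in>{2..<m}. \<Sum>b<n. nrm e (\<lambda>i. w0 i (k, b))"
    have "\<tau>\<^sup>2 * nrm e (u a) + (\<tau>\<^sup>2 * \<epsilon> * (\<Sum>b<n. nrm e (L b)) + \<tau>\<^sup>2 * \<epsilon> * ?S)
        \<le> nsq e ?I (?LI Q w')"
    proof -
      have "nsq e ?I (?LI Q w') = nrm e (\<lambda>i. ?LI Q w' i (Inl True)) + \<tau>\<^sup>2 * nrm e (u a)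
          + ((\<Sum>b<n. \<tau>\<^sup>2 * \<epsilon> * nrm e (L b)) + (\<Sum>k\<in>{2..<m}. \<Sum>b<n. \<tau>\<^sup>2 * \<epsilon> * nrm e (\<lambda>i. w0 i (k, b))))"
        unfolding nsq_columns sum_test_idx n1 split using n2 n3 by simp
      then show ?thesis by (simp add: sum_distrib_left)
    qed
    also note le
    \<comment> \<open>\<open>\<tau>\<^sup>2 * (1 + \<epsilon> * \<sigma>) = 1\<close> rewrites the
      bound. By the choice of \<open>\<sigma>\<close> all terms of degree one then cancel, and only
      the slack \<open>\<kappa>\<close> remains for the levels from 2 on.\<close>
    finally have "\<tau>\<^sup>2 * (nrm e (u a) + \<epsilon> * (\<Sum>b<n. nrm e (L b)) + \<epsilon> * ?S) \<le> \<tau>\<^sup>2 * ((1 + \<epsilon> * \<sigma>) * nrm e (u a))"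
      unfolding mult.assoc[symmetric] \<tau>(2) by (simp add: distrib_left mult.assoc)
    then have "nrm e (u a) + \<epsilon> * (\<Sum>b<n. nrm e (L b)) + \<epsilon> * ?S \<le> (1 + \<epsilon> * \<sigma>) * nrm e (u a)"
      using \<tau>(1) by simp
    also have "\<dots> = nrm e (u a) + \<epsilon> * (\<sigma> * nrm e (u a))" by (simp add: algebra_simps)
    finally have "\<epsilon> * ?S \<le> \<epsilon> * (\<kappa> * nrm e (u a))" unfolding \<sigma> by (simp add: algebra_simps)
    then show "?S \<le> \<kappa> * nrm e (u a)" using \<epsilon> by simp
  qed
  let ?S = "\<Sum>k\<in>{2..<m}. \<Sum>b<n. nrm e (\<lambda>i. w0 i (k, b))"
  have "?S \<le> 0"
  proof (rule field_le_epsilon)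
    fix \<kappa> :: real assume \<kappa>: "0 < \<kappa>"
    have "?S \<le> \<kappa> / nrm e (u a) * nrm e (u a)"
      by (rule key(3)[OF _ is0(1) n]) (use \<kappa> upos in simp)
    then show "?S \<le> 0 + \<kappa>" using upos by simp
  qed
  moreover have "?S \<ge> 0" by (intro sum_nonneg) simp
  ultimately have "?S = 0" by simp
  then have high: "w0 i (k, b) = 0" if "i < e" "2 \<le> k" "k < m" "b < n" for i k b
  proof -
    have "(\<Sum>b<n. nrm e (\<lambda>i. w0 i (k, b))) = 0"
      using \<open>?S = 0\<close> that by (subst (asm) sum_nonneg_eq_0_iff) (auto intro: sum_nonneg)
    then have "nrm e (\<lambda>i. w0 i (k, b)) = 0" using that by (subst (asm) sum_nonneg_eq_0_iff) auto
    then show ?thesis using nrm_zero that(1) by blast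
  qed
  have ww0: "w i s = w0 i s" if is1: "i < e" "s \<in> ?G" for i s
  proof -
    obtain k b where kb: "s = (k, b)" "k < m" "b < n" using is1(2) by auto
    consider "k = 0" | "k = 1" | "2 \<le> k" by linarith
    then show ?thesis
      using key(1,2)[of 1 i b] high[of i k b] is1 kb LYz[OF kb(2,3), of i] unfolding w_def
      by cases (auto simp: z_def)
  qed
  have "?LG P w i s = ?LG P w0 i s" by (rule lam_cong) (simp add: ww0)
  then show ?thesis using w0[OF is0] ww0[OF is0] by simp
qed

end

section \<open>The identity \<open>(I + \<Lambda>_B(p)) (I - \<Lambda>_B) = I\<close>\<close>

text \<open>\<open>kap\<close> is \<open>(I + P)(I - L) - I\<close> for \<open>P = \<Lambda>_A(p)\<close> and \<open>L = \<Lambda>_A(x)\<close>.\<close>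

definition kap :: "nat \<Rightarrow> nat \<Rightarrow> (nat \<Rightarrow> nat \<Rightarrow> nat \<Rightarrow> complex) \<Rightarrow> 'a set \<Rightarrow> (nat \<Rightarrow> 'a \<Rightarrow> 'a \<Rightarrow> complex)
    \<Rightarrow> (nat \<Rightarrow> 'a \<Rightarrow> 'a \<Rightarrow> complex) \<Rightarrow> (nat \<Rightarrow> 'a \<Rightarrow> complex) \<Rightarrow> nat \<Rightarrow> 'a \<Rightarrow> complex" where
  "kap g d A I P x z i s = lam g d A I P z i s - lam g d A I x z i s - lam g d A I P (lam g d A I x z) i s"

lemma lam_sum:
  "lam g d A I x (\<lambda>k t. \<Sum>r\<in>R. c r * v r k t) i s = (\<Sum>r\<in>R. c r * lam g d A I x (v r) i s)"
proof (cases "finite R")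
  case True
  then show ?thesis
  proof (induction R rule: finite_induct)
    case (insert r R)
    have "lam g d A I x (\<lambda>k t. \<Sum>r\<in>insert r R. c r * v r k t) i s
        = lam g d A I x (\<lambda>k t. (\<Sum>r\<in>R. c r * v r k t) + c r * v r k t) i s"
      using insert by (simp add: add.commute)
    then show ?case unfolding lam_add_scaled using insert by (simp add: add.commute)
  qed (simp add: lam_def)
qed (simp add: lam_def)

lemma kap_sum:
  "kap g d A I P x (\<lambda>k t. \<Sum>r\<in>R. c r * v r k t) i s = (\<Sum>r\<in>R. c r * kap g d A I P x (v r) i s)"
proof -
  have "lam g d A I x (\<lambda>k t. \<Sum>r\<in>R. c r * v r k t) = (\<lambda>i s. \<Sum>r\<in>R. c r * lam g d A I x (v r) i s)"
    by (intro ext) (rule lam_sum)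
  then show ?thesis unfolding kap_def by (simp add: lam_sum sum_subtractf right_diff_distrib)
qed

lemma kap_cong:
  fixes I :: "'a set"
  assumes "\<And>k t. k < d \<Longrightarrow> t \<in> I \<Longrightarrow> z k t = z' k t"
  shows "kap g d A I P x z i s = kap g d A I P x z' i s"
proof -
  have "lam g d A I y z = lam g d A I y z'" for y :: "nat \<Rightarrow> 'a \<Rightarrow> 'a \<Rightarrow> complex"
    by (intro ext lam_cong) (simp add: assms)
  then show ?thesis unfolding kap_def by simp
qed

lemma kap_intertwine:
  assumes x: "\<And>j s t. j < g \<Longrightarrow> s \<in> I \<Longrightarrow> t \<in> I' \<Longrightarrow> (\<Sum>r\<in>I. x j s r * T r t) = (\<Sum>r\<in>I'. T s r * y j r t)"
    and P: "\<And>j s t. j < g \<Longrightarrow> s \<in> I \<Longrightarrow> t \<in> I' \<Longrightarrow> (\<Sum>r\<in>I. P j s r * T r t) = (\<Sum>r\<in>I'. T s r * Q j r t)"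
    and s: "s \<in> I"
  shows "kap g d A I P x (ten I' T v) i s = ten I' T (kap g d A I' Q y v) i s"
proof -
  have e: "lam g d A I x (ten I' T v) k t = ten I' T (lam g d A I' y v) k t" if "t \<in> I" for k t
    by (rule lam_intertwine) (rule x[OF _ that])
  have "lam g d A I P (lam g d A I x (ten I' T v)) i s = lam g d A I P (ten I' T (lam g d A I' y v)) i s"
    by (rule lam_cong) (simp add: e)
  also have "\<dots> = ten I' T (lam g d A I' Q (lam g d A I' y v)) i s"
    by (rule lam_intertwine) (rule P[OF _ s])
  moreover have "lam g d A I x (ten I' T v) i s = ten I' T (lam g d A I' y v) i s"
    by (rule lam_intertwine) (rule x[OF _ s])
  moreover have "lam g d A I P (ten I' T v) i s = ten I' T (lam g d A I' Q v) i s"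
    by (rule lam_intertwine) (rule P[OF _ s])
  ultimately show ?thesis unfolding kap_def by (simp add: ten_def sum_subtractf right_diff_distrib)
qed

section \<open>Analyticity along complex lines\<close>

lemma kap_differentiable:
  assumes P: "\<And>j s t. j < g \<Longrightarrow> s \<in> I \<Longrightarrow> t \<in> I \<Longrightarrow> (\<lambda>w. P w j s t) field_differentiable (at w0)"
    and x: "\<And>j s t. (\<lambda>w. x w j s t) field_differentiable (at w0)" and s: "s \<in> I"
  shows "(\<lambda>w. kap g d A I (P w) (x w) z i s) field_differentiable (at w0)"
proof -
  have l: "(\<lambda>w. lam g d A I (x w) z k t) field_differentiable (at w0)" for k t
    unfolding lam_def
    by (intro field_differentiable_sum field_differentiable_mult field_differentiable_const x)
  have "(\<lambda>w. lam g d A I (P w) (v w) i s) field_differentiable (at w0)"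
    if "\<And>k t. (\<lambda>w. v w k t) field_differentiable (at w0)" for v
    unfolding lam_def using s
    by (intro field_differentiable_sum field_differentiable_mult field_differentiable_const P that) auto
  from this[of "\<lambda>w. z"] this[of "\<lambda>w. lam g d A I (x w) z"] l show ?thesis
    unfolding kap_def by (intro field_differentiable_diff) (auto simp: field_differentiable_const)
qed

lemma tsub_mtuples: "X \<in> mtuples n g \<Longrightarrow> Y \<in> mtuples n g \<Longrightarrow> tsub X Y \<in> mtuples n g"
  unfolding tsub_def mtuples_def by (auto dest!: set_zip_leftD set_zip_rightD intro!: minus_carrier_mat)

lemma tscale_mtuples: "X \<in> mtuples n g \<Longrightarrow> tscale c X \<in> mtuples n g"
  unfolding tscale_def mtuples_def by auto

lemma tsub_nth:
  assumes "X \<in> mtuples n g" "Y \<in> mtuples n g" "j < g" "a < n" "b < n"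
  shows "tsub X Y ! j $$ (a, b) = X ! j $$ (a, b) - Y ! j $$ (a, b)"
  using assms mtuples_nth[OF assms(1,3)] mtuples_nth[OF assms(2,3)] unfolding tsub_def
  by (simp add: mtuples_length)

lemma tscale_nth:
  assumes "X \<in> mtuples n g" "j < g" "a < n" "b < n"
  shows "tscale c X ! j $$ (a, b) = c * X ! j $$ (a, b)"
  using assms mtuples_nth[OF assms(1,2)] unfolding tscale_def by (simp add: mtuples_length)

text \<open>The Frechet derivative in the direction \<open>y\<close> is the complex derivative along
  the line, since \<open>tnorm\<close> dominates every entry.\<close>

lemma ev_differentiable:
  assumes F: "free_analytic g g U F" and h: "bij_betw h {..<N} I" and N: "0 < N"
    and mem: "tup g N h (\<lambda>j s t. x j s t + w0 * y j s t) \<in> U N" and ist: "i < g" "s \<in> I" "t \<in> I"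
  shows "(\<lambda>w. ev g F N h (\<lambda>j s t. x j s t + w * y j s t) i s t) field_differentiable (at w0)"
proof -
  let ?X = "\<lambda>w. tup g N h (\<lambda>j s t. x j s t + w * y j s t)" and ?Y = "tup g N h y"
  define a b where "a = inv_into {..<N} h s" and "b = inv_into {..<N} h t"
  have ab: "a < N" "b < N" using ist h inv_into_into[of _ h "{..<N}"] unfolding a_def b_def bij_betw_def by auto
  obtain L where L: "has_tuple_derivative N g g (F N) L (?X w0)"
    using F N mem unfolding free_analytic_def by blast
  have "\<forall>H \<in> mtuples N g. L H \<in> mtuples N g" "\<forall>c. \<forall>H \<in> mtuples N g. L (tscale c H) = tscale c (L H)"
    using L unfolding has_tuple_derivative_def by blast+
  then have LY: "L ?Y \<in> mtuples N g" and Lc: "\<And>c. L (tscale c ?Y) = tscale c (L ?Y)" by simp_all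
  define D where "D = L ?Y ! i $$ (a, b)"
  define f where "f w = F N (?X w) ! i $$ (a, b)" for w
  obtain dl where dl: "dl > 0" "\<And>H. H \<in> mtuples N g \<Longrightarrow> tnorm H < dl \<Longrightarrow> tadd (?X w0) H \<in> U N"
  proof -
    have "tuple_open N g (U N)" using F N unfolding free_analytic_def by blast
    then have "\<exists>\<delta>>0. \<forall>H \<in> mtuples N g. tnorm H < \<delta> \<longrightarrow> tadd (?X w0) H \<in> U N"
      using mem unfolding tuple_open_def by (elim conjE) (erule (1) bspec)
    then show ?thesis using that by blast
  qed
  have FU: "\<And>X. X \<in> U N \<Longrightarrow> F N X \<in> mtuples N g"
  proof -
    have "free_map g g U F" using F unfolding free_analytic_def by blast
    then show "\<And>X. X \<in> U N \<Longrightarrow> F N X \<in> mtuples N g" using N unfolding free_map_def by (elim conjE) blast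
  qed
  define M where "M = tnorm ?Y + 1"
  have M: "M > 0" "tnorm ?Y \<le> M" using tnorm_nonneg[OF tup_mtuples, of g N h y] unfolding M_def by auto
  have "(f has_field_derivative D) (at w0)"
    unfolding DERIV_def
  proof (rule LIM_I)
    fix r :: real assume r: "0 < r"
    define \<epsilon> where "\<epsilon> = r / (2 * M)"
    have \<epsilon>: "\<epsilon> > 0" "\<epsilon> * M < r" using r M unfolding \<epsilon>_def by auto
    obtain \<delta> where \<delta>: "\<delta> > 0" "\<And>H. H \<in> mtuples N g \<Longrightarrow> tnorm H < \<delta> \<Longrightarrow>
        tnorm (tsub (tsub (F N (tadd (?X w0) H)) (F N (?X w0))) (L H)) \<le> \<epsilon> * tnorm H"
      using L \<epsilon>(1) unfolding has_tuple_derivative_def by blast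
    show "\<exists>s>0. \<forall>k. k \<noteq> 0 \<and> norm (k - 0) < s \<longrightarrow> norm ((f (w0 + k) - f w0) / k - D) < r"
    proof (intro exI conjI allI impI)
      show "0 < min \<delta> dl / M" using \<delta> dl M by simp
      fix k :: complex assume k: "k \<noteq> 0 \<and> norm (k - 0) < min \<delta> dl / M"
      let ?H = "tscale k ?Y"
      have H: "?H \<in> mtuples N g" unfolding tscale_tup by simp
      have tn: "tnorm ?H \<le> cmod k * M"
        using tnorm_tscale[OF tup_mtuples, of k g N h y] M(2) mult_left_mono[of "tnorm ?Y" M "cmod k"] by simp
      also have "\<dots> < min \<delta> dl" using k M(1) by (simp add: pos_less_divide_eq)
      finally have tn': "tnorm ?H < \<delta>" "tnorm ?H < dl" by auto
      have add: "tadd (?X w0) ?H = ?X (w0 + k)"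
        unfolding tscale_tup tadd_tup by (simp add: algebra_simps)
      have c: "F N (?X (w0 + k)) \<in> mtuples N g" "F N (?X w0) \<in> mtuples N g"
        using FU mem dl(2)[OF H tn'(2)] unfolding add by auto
      let ?D = "tsub (tsub (F N (?X (w0 + k))) (F N (?X w0))) (tscale k (L ?Y))"
      have Dm: "?D \<in> mtuples N g"
        by (intro tsub_mtuples tscale_mtuples c LY)
      have "?D ! i $$ (a, b) = f (w0 + k) - f w0 - k * D"
        using ab unfolding f_def D_def
        by (simp add: tsub_nth[OF tsub_mtuples[OF c] tscale_mtuples[OF LY] ist(1)] tsub_nth[OF c ist(1)] tscale_nth[OF LY ist(1)])
      then have "cmod (f (w0 + k) - f w0 - k * D) \<le> tnorm ?D"
        using cmod_nth_le_tnorm[OF Dm ist(1) ab] by simp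
      also have "\<dots> \<le> \<epsilon> * tnorm ?H" using \<delta>(2)[OF H tn'(1)] unfolding add Lc .
      also have "\<dots> \<le> \<epsilon> * (cmod k * M)" using tn \<epsilon>(1) by simp
      finally have *: "cmod (f (w0 + k) - f w0 - k * D) \<le> cmod k * (\<epsilon> * M)" by (simp add: mult_ac)
      have "(f (w0 + k) - f w0) / k - D = (f (w0 + k) - f w0 - k * D) / k" using k by (simp add: field_simps)
      then have "norm ((f (w0 + k) - f w0) / k - D) \<le> \<epsilon> * M"
        using * k by (simp add: norm_divide divide_simps mult.commute)
      then show "norm ((f (w0 + k) - f w0) / k - D) < r" using \<epsilon>(2) by simp
    qed
  qed
  then show ?thesis unfolding field_differentiable_def f_def ev_def a_def b_def by blast
qed

text \<open>If \<open>f\<close> is not constant, its zero at 0 has a finite order \<open>n\<close>,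
  with \<open>f w = w ^ n * h w\<close> and \<open>h 0 \<noteq> 0\<close>; a bound of higher order
  forces \<open>h 0 = 0\<close>.\<close>

lemma vanishing_to_all_orders:
  assumes f: "f holomorphic_on ball 0 1"
    and small: "\<And>m::nat. 2 \<le> m \<Longrightarrow> \<exists>C. \<exists>r>0. \<forall>w. cmod w < r \<longrightarrow> cmod (f w) \<le> C * cmod w ^ m"
    and w: "w \<in> ball 0 1"
  shows "f w = 0"
proof -
  have f0: "f 0 = 0"
  proof -
    obtain C r where "r > 0" "\<And>w. cmod w < r \<Longrightarrow> cmod (f w) \<le> C * cmod w ^ 2" using small[of 2] by auto
    from this(2)[of 0] this(1) show ?thesis by simp
  qed
  show ?thesis
  proof (cases "f constant_on ball 0 1")
    case True
    then obtain c where c: "\<And>x. x \<in> ball 0 1 \<Longrightarrow> f x = c" unfolding constant_on_def by blast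
    show ?thesis using c[of 0] c[OF w] f0 by simp
  next
    case False
    have c0: "(0::complex) \<in> ball 0 1" by simp
    obtain h r n where h: "0 < n" "0 < r" "ball (0::complex) r \<subseteq> ball 0 1" "h holomorphic_on ball 0 r"
      "\<And>w. w \<in> ball 0 r \<Longrightarrow> f w = (w - 0) ^ n * h w" "\<And>w. w \<in> ball 0 r \<Longrightarrow> h w \<noteq> 0"
      by (rule holomorphic_factor_zero_nonconstant[OF f open_ball connected_ball c0 f0 False], rule that)
    obtain C r' where C: "r' > 0" "\<And>w. cmod w < r' \<Longrightarrow> cmod (f w) \<le> C * cmod w ^ (n + 2)"
      using small[of "n + 2"] by auto
    have bound: "cmod (h w) \<le> \<bar>C\<bar> * cmod w ^ 2" if "w \<noteq> 0" "cmod w < min r r'" for w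
    proof -
      have "cmod w ^ n * cmod (h w) = cmod (f w)"
        using h(5)[of w] that by (simp add: norm_mult norm_power)
      also have "\<dots> \<le> C * cmod w ^ (n + 2)" using C(2) that by simp
      also have "\<dots> \<le> \<bar>C\<bar> * cmod w ^ (n + 2)" by (intro mult_right_mono) auto
      also have "\<dots> = cmod w ^ n * (\<bar>C\<bar> * cmod w ^ 2)" by (simp add: power_add power2_eq_square)
      finally show ?thesis using that(1) by simp
    qed
    have "isCont h 0" 
      using h(2) holomorphic_on_imp_continuous_on[OF h(4)] by (simp add: continuous_on_eq_continuous_at)
    then have lim: "(h \<longlongrightarrow> h 0) (at 0)" by (simp add: isCont_def)
    have "(h \<longlongrightarrow> 0) (at 0)"
    proof (rule Lim_null_comparison)
      show "\<forall>\<^sub>F w in at 0. norm (h w) \<le> \<bar>C\<bar> * cmod w ^ 2"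
        unfolding eventually_at using bound h(2) C(1) by (intro exI[of _ "min r r'"]) auto
      have "((\<lambda>w. \<bar>C\<bar> * cmod w ^ 2) \<longlongrightarrow> \<bar>C\<bar> * cmod 0 ^ 2) (at (0::complex))" by (intro tendsto_intros)
      then show "((\<lambda>w. \<bar>C\<bar> * cmod w ^ 2) \<longlongrightarrow> 0) (at (0::complex))" by simp
    qed
    then have "h 0 = 0" using lim tendsto_unique trivial_limit_at by blast
    then show ?thesis using h(2) h(6)[of 0] by simp
  qed
qed

context ball_map
begin

text \<open>\<open>kap\<close> is linear and the peak vectors span, so the result for
  \<open>u a\<close> extends to every \<open>y\<close>.\<close>

lemma shift_kernel:
  assumes gd: "gen_data g e (cf B) \<alpha> u" and m: "2 \<le> m" and n: "0 < n"
    and x: "fball g d (cf E) {..<n} {..<n} x" and h: "bij_betw h {..<N} ({..<m} \<times> {..<n})"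
    and is0: "i < e" "s \<in> {..<m} \<times> {..<n}"
  shows "kap g e (cf B) ({..<m} \<times> {..<n}) (ev g p N h (shift_tuple m 0 x)) (shift_tuple m 0 x)
    (\<lambda>i s. if fst s = 0 then y i * \<xi> (snd s) else 0) i s = 0"
proof -
  let ?G = "{..<m} \<times> {..<n}" and ?Y = "shift_tuple m 0 x"
  let ?K = "kap g e (cf B) ?G (ev g p N h ?Y) ?Y"
  let ?z = "\<lambda>a i (s :: nat \<times> nat). if fst s = 0 then u a i * \<xi> (snd s) else 0"
  have peak: "?K (?z a) i s = 0" if "a \<le> e" for a
  proof -
    let ?w = "\<lambda>i s. ?z a i s + (-1) * lam g e (cf B) ?G ?Y (?z a) i s"
    have "?w i s + lam g e (cf B) ?G (ev g p N h ?Y) ?w i s = ?z a i s"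
      using shift_kernel_peak[OF gd that m n x h is0, of \<xi>] by simp
    then show ?thesis unfolding lam_add_scaled kap_def by (simp add: algebra_simps)
  qed
  have "\<forall>x. \<exists>t. \<forall>i<e. x i = (\<Sum>a\<le>e. t a * u a i)"
    using gd unfolding gen_data_def by (elim conjE)
  then obtain t where t: "\<forall>i<e. y i = (\<Sum>a\<le>e. t a * u a i)" by (elim allE[of _ y] exE)
  have "?K (\<lambda>i s. if fst s = 0 then y i * \<xi> (snd s) else 0) i s = ?K (\<lambda>i s. \<Sum>a\<le>e. t a * ?z a i s) i s"
    by (rule kap_cong) (auto simp: t sum_distrib_right mult.assoc)
  also have "\<dots> = 0" unfolding kap_sum using peak by simp
  finally show ?thesis .
qed

text \<open>With corner entry \<open>w ^ m\<close> the shift has the left eigenvector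
  \<open>(1, w, ..., w ^ (m - 1))\<close> for the eigenvalue \<open>w\<close>, so intertwining
  expresses \<open>kap\<close> at \<open>w x\<close> through its levels at the shift tuple. These
  are differentiable in the corner entry and vanish when it is 0, so they are of order
  \<open>w ^ m\<close>.\<close>

lemma kap_order:
  assumes gd: "gen_data g e (cf B) \<alpha> u" and F: "free_analytic g g U F"
    and BU: "\<And>n. 0 < n \<Longrightarrow> spectraball d g E n \<subseteq> U n"
    and Fp: "\<And>n X. 0 < n \<Longrightarrow> X \<in> spectraball d g E n \<Longrightarrow> F n X = p n X"
    and m: "2 \<le> m" and n: "0 < n" and x: "fball g d (cf E) {..<n} {..<n} x" and ib: "i < e" "b < n"
  shows "\<exists>C. \<exists>r>0. \<forall>w. cmod w < r \<longrightarrow>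
    cmod (kap g e (cf B) {..<n} (ev g F n id (\<lambda>j s t. w * x j s t)) (\<lambda>j s t. w * x j s t) (\<lambda>i s. y i * \<xi> s) i b)
      \<le> C * cmod w ^ m"
proof -
  let ?G = "{..<m} \<times> {..<n}" and ?z = "\<lambda>i (s :: nat \<times> nat). if fst s = 0 then y i * \<xi> (snd s) else 0"
  have "finite ?G" by simp
  from finite_enumeration[OF this] obtain h where h: "bij_betw h {..<m * n} ?G" by (auto simp: card_cartesian_product)
  have N: "0 < m * n" using m n by simp
  have id: "bij_betw id {..<n} {..<n}" by simp
  define Y1 where "Y1 j s t = (if fst s = 0 \<and> Suc (fst t) = m then x j (snd s) (snd t) else 0)"
    for j and s t :: "nat \<times> nat"
  have Y: "shift_tuple m \<epsilon> x = (\<lambda>j s t. shift_tuple m 0 x j s t + \<epsilon> * Y1 j s t)" for \<epsilon>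
    using m by (auto intro!: ext simp: shift_tuple_def Y1_def)
  have Yf: "(\<lambda>w. shift_tuple m w x j s t) = (\<lambda>w. shift_tuple m 0 x j s t + w * Y1 j s t)" for j s t
    by (rule ext) (rule arg_cong[where f = "\<lambda>q. q j s t", OF Y])
  have Yev: "(\<lambda>w. ev g F (m * n) h (shift_tuple m w x) j s t)
      = (\<lambda>w. ev g F (m * n) h (\<lambda>j s t. shift_tuple m 0 x j s t + w * Y1 j s t) j s t)" for j s t
    by (rule ext) (rule arg_cong[where f = "\<lambda>q. ev g F (m * n) h q j s t", OF Y])
  have Y0: "fball g d (cf E) ?G ?G (shift_tuple m 0 x)" by (rule fball_shift_tuple[OF x])
  have Y0U: "tup g (m * n) h (shift_tuple m 0 x) \<in> U (m * n)" using p_tup(1)[OF h N Y0] BU[OF N] by blast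
  obtain dl where dl: "dl > 0" "\<And>H. H \<in> mtuples (m * n) g \<Longrightarrow> tnorm H < dl \<Longrightarrow> tadd (tup g (m * n) h (shift_tuple m 0 x)) H \<in> U (m * n)"
  proof -
    have "tuple_open (m * n) g (U (m * n))" using F N unfolding free_analytic_def by blast
    then have "\<exists>\<delta>>0. \<forall>H \<in> mtuples (m * n) g. tnorm H < \<delta> \<longrightarrow> tadd (tup g (m * n) h (shift_tuple m 0 x)) H \<in> U (m * n)"
      using Y0U unfolding tuple_open_def by (elim conjE) (erule (1) bspec)
    then show ?thesis using that by blast
  qed
  define M where "M = tnorm (tup g (m * n) h Y1) + 1"
  have M: "M > 0" "tnorm (tup g (m * n) h Y1) \<le> M"
    using tnorm_nonneg[OF tup_mtuples, of g "m * n" h Y1] unfolding M_def by auto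
  \<comment> \<open>For nonzero \<epsilon> the shift tuple may leave the ball of \<open>E\<close>,
    so the extension \<open>F\<close> on the open set \<open>U\<close> takes the place of
    \<open>p\<close>.\<close>
  have YU: "tup g (m * n) h (shift_tuple m \<epsilon> x) \<in> U (m * n)" if "cmod \<epsilon> < dl / M" for \<epsilon>
  proof -
    have "tnorm (tscale \<epsilon> (tup g (m * n) h Y1)) \<le> cmod \<epsilon> * M"
      using tnorm_tscale[OF tup_mtuples, of \<epsilon> g "m * n" h Y1] M(2)
        mult_left_mono[of "tnorm (tup g (m * n) h Y1)" M "cmod \<epsilon>"] by simp
    also have "\<dots> < dl" using that M(1) by (simp add: pos_less_divide_eq)
    finally have "tadd (tup g (m * n) h (shift_tuple m 0 x)) (tscale \<epsilon> (tup g (m * n) h Y1)) \<in> U (m * n)"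
      by (intro dl(2)) (simp_all add: tscale_tup)
    then show ?thesis unfolding tscale_tup tadd_tup Y[of \<epsilon>] .
  qed
  define \<psi> where "\<psi> k \<epsilon> = kap g e (cf B) ?G (ev g F (m * n) h (shift_tuple m \<epsilon> x)) (shift_tuple m \<epsilon> x) ?z i (k, b)" for k \<epsilon>
  have \<psi>0: "\<psi> k 0 = 0" if "k < m" for k
  proof -
    have "ev g F (m * n) h (shift_tuple m 0 x) = ev g p (m * n) h (shift_tuple m 0 x)"
      unfolding ev_def using Fp[OF N p_tup(1)[OF h N Y0]] by simp
    then show ?thesis unfolding \<psi>_def using shift_kernel[OF gd m n x h ib(1), of "(k, b)" y \<xi>] that ib(2) by simp
  qed
  have "\<exists>C. \<exists>r>0. \<forall>\<epsilon>. cmod \<epsilon> < r \<longrightarrow> cmod (\<psi> k \<epsilon>) \<le> C * cmod \<epsilon>" if k: "k < m" for k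
  proof -
    have "\<psi> k field_differentiable (at 0)"
      unfolding \<psi>_def
    proof (rule kap_differentiable)
      show "(k, b) \<in> ?G" using k ib by simp
      show "(\<lambda>w. shift_tuple m w x j s t) field_differentiable (at 0)" for j s t
        by (subst Yf) (intro field_differentiable_add field_differentiable_mult field_differentiable_const field_differentiable_ident)
      show "(\<lambda>w. ev g F (m * n) h (shift_tuple m w x) j s t) field_differentiable (at 0)"
        if "j < g" "s \<in> ?G" "t \<in> ?G" for j s t
        by (subst Yev) (rule ev_differentiable[OF F h N _ that], use Y0U in simp)
    qed
    then obtain D where "(\<psi> k has_field_derivative D) (at 0)" unfolding field_differentiable_def by blast
    then have "((\<lambda>\<epsilon>. \<psi> k \<epsilon> / \<epsilon>) \<longlongrightarrow> D) (at 0)" unfolding DERIV_def using \<psi>0[OF k] by simp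
    then obtain r where r: "r > 0" "\<And>\<epsilon>. \<epsilon> \<noteq> 0 \<Longrightarrow> norm (\<epsilon> - 0) < r \<Longrightarrow> norm (\<psi> k \<epsilon> / \<epsilon> - D) < 1"
      using LIM_D[of "\<lambda>\<epsilon>. \<psi> k \<epsilon> / \<epsilon>" D 0 1] by auto
    have "cmod (\<psi> k \<epsilon>) \<le> (cmod D + 1) * cmod \<epsilon>" if "cmod \<epsilon> < r" for \<epsilon>
    proof (cases "\<epsilon> = 0")
      case False
      then have "norm (\<psi> k \<epsilon> / \<epsilon> - D) < 1" using r(2) that by simp
      then have "norm (\<psi> k \<epsilon> / \<epsilon>) \<le> norm D + 1" using norm_triangle_sub[of "\<psi> k \<epsilon> / \<epsilon>" D] by linarith
      then show ?thesis using False by (simp add: norm_divide divide_simps)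
    qed (simp add: \<psi>0[OF k])
    then show ?thesis using r(1) by blast
  qed
  then have "\<forall>k. \<exists>C r. k < m \<longrightarrow> 0 < r \<and> (\<forall>\<epsilon>. cmod \<epsilon> < r \<longrightarrow> cmod (\<psi> k \<epsilon>) \<le> C * cmod \<epsilon>)" by blast
  then obtain C r where Cr: "\<And>k. k < m \<Longrightarrow> 0 < r k" "\<And>k \<epsilon>. k < m \<Longrightarrow> cmod \<epsilon> < r k \<Longrightarrow> cmod (\<psi> k \<epsilon>) \<le> C k * cmod \<epsilon>"
    by metis
  \<comment> \<open>The cap 1 gives \<open>|w ^ m| \<le> |w|\<close>, so that smallness of
    \<open>w\<close> passes to the corner entry.\<close>
  define r0 where "r0 = Min (insert (dl / M) (insert 1 (r ` {..<m})))"
  have r0: "0 < r0" "r0 \<le> dl / M" "r0 \<le> 1" "\<And>k. k < m \<Longrightarrow> r0 \<le> r k"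
  proof -
    show "0 < r0" unfolding r0_def using dl(1) M(1) Cr(1) by auto
    show "r0 \<le> dl / M" "r0 \<le> 1" "\<And>k. k < m \<Longrightarrow> r0 \<le> r k" unfolding r0_def by (intro Min_le; simp)+
  qed
  define C0 where "C0 = (\<Sum>k<m. \<bar>C k\<bar>)"
  have "cmod (kap g e (cf B) {..<n} (ev g F n id (\<lambda>j s t. w * x j s t)) (\<lambda>j s t. w * x j s t) (\<lambda>i s. y i * \<xi> s) i b)
      \<le> C0 * cmod w ^ m" if w: "cmod w < r0" for w
  proof -
    let ?\<epsilon> = "w ^ m" and ?wx = "\<lambda>j s t. w * x j s t"
    have w1: "cmod w \<le> 1" using w r0(3) by simp
    have "cmod ?\<epsilon> \<le> cmod w"
      using w1 m power_decreasing[of 1 m "cmod w"] by (simp add: norm_power)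
    then have \<epsilon>: "cmod ?\<epsilon> < r0" using w by simp
    have wx: "fball g d (cf E) {..<n} {..<n} ?wx" by (rule fball_scale[OF x w1])
    have wxU: "tup g n id ?wx \<in> U n" using p_tup(1)[OF id n wx] BU[OF n] by blast
    have YeU: "tup g (m * n) h (shift_tuple m ?\<epsilon> x) \<in> U (m * n)" using YU \<epsilon> r0(2) by simp
    define T where "T s t = (if snd t = s then w ^ fst t else 0)" for s :: nat and t :: "nat \<times> nat"
    have tenT: "ten ?G T v i s = (\<Sum>k<m. w ^ k * v i (k, s))" if "s < n" for v i s
    proof -
      have "ten ?G T v i s = (\<Sum>k<m. \<Sum>c<n. if c = s then w ^ k * v i (k, c) else 0)"
        unfolding ten_def sum_grid by (intro sum.cong refl) (auto simp: T_def)
      then show ?thesis using that by simp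
    qed
    have int: "(\<Sum>r\<in>{..<n}. ?wx j s r * T r t) = (\<Sum>r\<in>?G. T s r * shift_tuple m ?\<epsilon> x j r t)"
      if jst: "j < g" "s \<in> {..<n}" "t \<in> ?G" for j s t
    proof -
      obtain l c where lc: "t = (l, c)" "l < m" "c < n" using jst(3) by auto
      have "(\<Sum>r\<in>{..<n}. ?wx j s r * T r t) = (\<Sum>r<n. if r = c then w * w ^ l * x j s c else 0)"
        by (intro sum.cong) (auto simp: T_def lc)
      then have lhs: "(\<Sum>r\<in>{..<n}. ?wx j s r * T r t) = w * w ^ l * x j s c" using lc by simp
      have "(\<Sum>r\<in>?G. T s r * shift_tuple m ?\<epsilon> x j r t) = ten ?G T (\<lambda>i r. shift_tuple m ?\<epsilon> x j r t) 0 s"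
        unfolding ten_def ..
      also have "\<dots> = (\<Sum>k<m. w ^ k * shift_tuple m ?\<epsilon> x j (k, s) t)" using tenT jst(2) by simp
      also have "\<dots> = w * w ^ l * x j s c"
      proof (cases "Suc l = m")
        case True
        then have "(\<Sum>k<m. w ^ k * shift_tuple m ?\<epsilon> x j (k, s) t) = (\<Sum>k<m. if k = 0 then w * w ^ l * x j s c else 0)"
          by (intro sum.cong refl) (auto simp: shift_tuple_def lc)
        then show ?thesis using m by simp
      next
        case False
        then have "(\<Sum>k<m. w ^ k * shift_tuple m ?\<epsilon> x j (k, s) t) = (\<Sum>k<m. if k = Suc l then w * w ^ l * x j s c else 0)"
          by (intro sum.cong refl) (auto simp: shift_tuple_def lc)
        then show ?thesis using False lc by simp
      qed
      finally show ?thesis using lhs by simp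
    qed
    have fmF: "free_map g g U F" using F unfolding free_analytic_def by simp
    have intF: "(\<Sum>r\<in>{..<n}. ev g F n id ?wx j s r * T r t) = (\<Sum>r\<in>?G. T s r * ev g F (m * n) h (shift_tuple m ?\<epsilon> x) j r t)"
      if "j < g" "s \<in> {..<n}" "t \<in> ?G" for j s t
      by (rule ev_intertwine[OF fmF id h n N wxU YeU int that])
    have "kap g e (cf B) {..<n} (ev g F n id ?wx) ?wx (\<lambda>i s. y i * \<xi> s) i b
        = kap g e (cf B) {..<n} (ev g F n id ?wx) ?wx (ten ?G T ?z) i b"
    proof (rule kap_cong)
      fix k t assume "t \<in> {..<n}"
      then have "ten ?G T ?z k t = (\<Sum>l<m. w ^ l * ?z k (l, t))" by (intro tenT) simp
      also have "\<dots> = (\<Sum>l<m. if l = 0 then y k * \<xi> t else 0)" by (intro sum.cong) auto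
      finally have "ten ?G T ?z k t = (\<Sum>l<m. if l = 0 then y k * \<xi> t else 0)" .
      then show "y k * \<xi> t = ten ?G T ?z k t" using m by simp
    qed
    also have "\<dots> = ten ?G T (kap g e (cf B) ?G (ev g F (m * n) h (shift_tuple m ?\<epsilon> x)) (shift_tuple m ?\<epsilon> x) ?z) i b"
      by (rule kap_intertwine[OF int intF]) (use ib in auto)
    also have "\<dots> = (\<Sum>k<m. w ^ k * \<psi> k ?\<epsilon>)" unfolding tenT[OF ib(2)] \<psi>_def ..
    finally have eq: "kap g e (cf B) {..<n} (ev g F n id ?wx) ?wx (\<lambda>i s. y i * \<xi> s) i b = (\<Sum>k<m. w ^ k * \<psi> k ?\<epsilon>)" .
    have "cmod (\<Sum>k<m. w ^ k * \<psi> k ?\<epsilon>) \<le> (\<Sum>k<m. cmod (w ^ k * \<psi> k ?\<epsilon>))" by (rule norm_sum)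
    also have "\<dots> \<le> (\<Sum>k<m. \<bar>C k\<bar> * cmod w ^ m)"
    proof (rule sum_mono)
      fix k assume k: "k \<in> {..<m}"
      have "cmod (w ^ k * \<psi> k ?\<epsilon>) \<le> 1 * cmod (\<psi> k ?\<epsilon>)"
        unfolding norm_mult using w1 by (intro mult_right_mono) (auto simp: norm_power power_le_one)
      also have "\<dots> \<le> C k * cmod ?\<epsilon>" using Cr(2)[of k ?\<epsilon>] r0(4)[of k] \<epsilon> k by simp
      also have "\<dots> \<le> \<bar>C k\<bar> * cmod ?\<epsilon>" by (intro mult_right_mono) auto
      finally show "cmod (w ^ k * \<psi> k ?\<epsilon>) \<le> \<bar>C k\<bar> * cmod w ^ m" by (simp add: norm_power)
    qed
    finally show ?thesis unfolding eq C0_def by (simp add: sum_distrib_right)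
  qed
  then show ?thesis using r0(1) by blast
qed

text \<open>Along \<open>w \<mapsto> w x\<close> the value is holomorphic on the unit disc and
  vanishes to all orders at 0. The tuple \<open>x\<close> itself, \<open>w = 1\<close>, may lie on
  the boundary of the ball; it is reached because the extension is continuous there.\<close>

lemma kap_zero:
  assumes gd: "gen_data g e (cf B) \<alpha> u" and near: "analytic_near g g (spectraball d g E) p"
    and n: "0 < n" and x: "fball g d (cf E) {..<n} {..<n} x" and ib: "i < e" "b < n"
  shows "kap g e (cf B) {..<n} (ev g p n id x) x z i b = 0"
proof -
  obtain U F where F: "free_analytic g g U F" and BU: "\<And>n. 0 < n \<Longrightarrow> spectraball d g E n \<subseteq> U n"
    and Fp: "\<And>n X. 0 < n \<Longrightarrow> X \<in> spectraball d g E n \<Longrightarrow> F n X = p n X"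
    using near unfolding analytic_near_def by blast
  have id: "bij_betw id {..<n} {..<n}" by simp
  have "kap g e (cf B) {..<n} (ev g p n id x) x (\<lambda>i s. y i * \<xi> s) i b = 0" for y \<xi>
  proof -
    define f where "f w = kap g e (cf B) {..<n} (ev g F n id (\<lambda>j s t. w * x j s t)) (\<lambda>j s t. w * x j s t) (\<lambda>i s. y i * \<xi> s) i b" for w
    have diff: "f field_differentiable (at w)" if w: "cmod w \<le> 1" for w
      unfolding f_def
    proof (rule kap_differentiable)
      show "(\<lambda>w. w * x j s t) field_differentiable (at w)" for j s t
        by (intro field_differentiable_mult field_differentiable_const field_differentiable_ident)
      show "(\<lambda>w. ev g F n id (\<lambda>j s t. w * x j s t) j s t) field_differentiable (at w)"
        if "j < g" "s \<in> {..<n}" "t \<in> {..<n}" for j s t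
      proof -
        have "tup g n id (\<lambda>j s t. w * x j s t) \<in> U n"
          using p_tup(1)[OF id n fball_scale[OF x w]] BU[OF n] by blast
        then show ?thesis using ev_differentiable[OF F id n _ that, of "\<lambda>j s t. 0" w x] by simp
      qed
    qed (use ib in simp)
    have hol: "f holomorphic_on ball 0 1"
      unfolding holomorphic_on_def using diff by (auto intro: field_differentiable_at_within)
    have zero: "f w = 0" if "w \<in> ball 0 1" for w
      by (rule vanishing_to_all_orders[OF hol _ that]) (unfold f_def, rule kap_order[OF gd F BU Fp _ n x ib], auto)
    have "isCont f 1" using diff[of 1] by (simp add: field_differentiable_imp_continuous_at)
    then have "(\<lambda>k. f (1 - 1 / of_nat (Suc k))) \<longlonglongrightarrow> f 1"
    proof (rule isCont_tendsto_compose)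
      have "(\<lambda>k. 1 - 1 / of_nat (Suc k) :: complex) \<longlonglongrightarrow> 1 - 0"
        by (intro tendsto_intros LIMSEQ_Suc[OF lim_1_over_n])
      then show "(\<lambda>k. 1 - 1 / of_nat (Suc k) :: complex) \<longlonglongrightarrow> 1" by simp
    qed
    moreover have "f (1 - 1 / of_nat (Suc k)) = 0" for k
    proof (rule zero)
      have "(1 - 1 / of_nat (Suc k) :: complex) = of_real (1 - 1 / real (Suc k))" by simp
      then have "cmod (1 - 1 / of_nat (Suc k)) = \<bar>1 - 1 / real (Suc k)\<bar>" by (simp only: norm_of_real)
      also have "\<dots> < 1" by (simp add: abs_if divide_simps)
      finally show "1 - 1 / of_nat (Suc k) \<in> ball (0 :: complex) 1" by simp
    qed
    ultimately have "f 1 = 0" by (simp add: LIMSEQ_const_iff)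
    moreover have "ev g F n id x = ev g p n id x"
      unfolding ev_def using Fp[OF n p_tup(1)[OF id n x]] by simp
    ultimately show ?thesis unfolding f_def by simp
  qed
  note rank1 = this
  \<comment> \<open>A general vector is a combination of elementary tensors, and \<open>kap\<close>
    is linear.\<close>
  have "kap g e (cf B) {..<n} (ev g p n id x) x z i b
      = kap g e (cf B) {..<n} (ev g p n id x) x
          (\<lambda>k t. \<Sum>r\<in>{..<e} \<times> {..<n}. z (fst r) (snd r) * ((if k = fst r then 1 else 0) * (if t = snd r then 1 else 0))) i b"
  proof (rule kap_cong)
    fix k t assume kt: "k < e" "t \<in> {..<n}"
    have "(\<Sum>r\<in>{..<e} \<times> {..<n}. z (fst r) (snd r) * ((if k = fst r then 1 else 0) * (if t = snd r then 1 else 0)))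
        = (\<Sum>r\<in>{..<e} \<times> {..<n}. if r = (k, t) then z k t else 0)"
      by (intro sum.cong) (auto split: if_splits)
    then show "z k t = (\<Sum>r\<in>{..<e} \<times> {..<n}. z (fst r) (snd r) * ((if k = fst r then 1 else 0) * (if t = snd r then 1 else 0)))"
      using kt by simp
  qed
  then show ?thesis unfolding kap_sum rank1 by simp
qed

end

section \<open>Consequences of sv-genericity and independence\<close>

lemma vec_span_coeffs:
  fixes S :: "complex Matrix.vec set"
  assumes S: "finite S" "S \<subseteq> carrier_vec d"
    and x: "x \<in> LinearCombinations.module.span class_ring (module_vec TYPE(complex) d) S"
  shows "\<exists>a. \<forall>i<d. vec_index x i = (\<Sum>v\<in>S. a v * vec_index v i)"
proof -
  interpret vec_space "TYPE(complex)" d .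
  obtain a where "x = lincomb a S" using x finite_span[OF S(1)] S(2) by auto
  then show ?thesis using lincomb_index[OF _ S(2)] by blast
qed

lemma vbasis_indep:
  assumes b: "vbasis d (v ` I)" and inj: "inj_on v I" and I: "finite I"
    and z: "\<And>i. i < d \<Longrightarrow> (\<Sum>a\<in>I. t a * vec_index (v a) i) = 0" and a: "a \<in> I"
  shows "t a = (0::complex)"
proof (rule ccontr)
  assume ta: "t a \<noteq> 0"
  interpret vec_space "TYPE(complex)" d .
  have li: "\<not> lin_dep (v ` I)" and car: "v ` I \<subseteq> carrier_vec d" using b unfolding basis_def by auto
  define c where "c w = t (inv_into I v w)" for w
  have c: "c (v a) = t a" if "a \<in> I" for a using inj that unfolding c_def by simp
  have "lincomb c (v ` I) = 0\<^sub>v d"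
  proof (rule eq_vecI)
    show "dim_vec (lincomb c (v ` I)) = dim_vec (0\<^sub>v d)" using lincomb_dim[of "v ` I" c] I car by simp
    fix i assume "i < dim_vec (0\<^sub>v d)"
    then have i: "i < d" by simp
    have "vec_index (lincomb c (v ` I)) i = (\<Sum>w\<in>v ` I. c w * vec_index w i)" by (rule lincomb_index[OF i car])
    also have "\<dots> = (\<Sum>a\<in>I. t a * vec_index (v a) i)" using c by (simp add: sum.reindex[OF inj])
    finally show "vec_index (lincomb c (v ` I)) i = vec_index (0\<^sub>v d) i" using z[OF i] i by simp
  qed
  then have "lin_dep (v ` I)"
    using lin_dep_crit[where A = "v ` I" and S = "v ` I" and a = c and v = "v a"] I a ta c[OF a] by (auto simp: class_ring_simps)
  then show False using li by simp
qed

lemma vbasis_span: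
  fixes x :: "nat \<Rightarrow> complex"
  assumes b: "vbasis d (v ` I)" and inj: "inj_on v I" and I: "finite I"
  shows "\<exists>t. \<forall>i<d. x i = (\<Sum>a\<in>I. t a * vec_index (v a) i)"
proof -
  interpret vec_space "TYPE(complex)" d .
  have sp: "span (v ` I) = carrier_vec d" and car: "v ` I \<subseteq> carrier_vec d" using b unfolding basis_def by auto
  have "Matrix.vec d x \<in> span (v ` I)" unfolding sp by simp
  from vec_span_coeffs[OF _ car this] obtain c where
    c: "\<forall>i<d. vec_index (Matrix.vec d x) i = (\<Sum>w\<in>v ` I. c w * vec_index w i)" using I by blast
  have "x i = (\<Sum>a\<in>I. c (v a) * vec_index (v a) i)" if "i < d" for i
    using c that by (simp add: sum.reindex[OF inj])
  then show ?thesis by (intro exI[of _ "\<lambda>a. c (v a)"]) simp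
qed

lemma mult_Lambda_scalar:
  assumes A: "A \<in> mtuples d g" and \<alpha>: "\<alpha> \<in> mtuples 1 g" and v: "v \<in> carrier_vec d" and i: "i < d"
  shows "vec_index (Lambda d 1 A \<alpha> *\<^sub>v v) i = lin g d (cf A) (\<lambda>j. \<alpha> ! j $$ (0, 0)) (\<lambda>k. vec_index v k) i"
proof -
  have L: "Lambda d 1 A \<alpha> \<in> carrier_mat d d" using Lambda_carrier[of d 1 A \<alpha>] by simp
  have "vec_index (Lambda d 1 A \<alpha> *\<^sub>v v) i = (\<Sum>k<d. (\<Sum>j<g. A ! j $$ (i, k) * \<alpha> ! j $$ (0, 0)) * vec_index v k)"
    unfolding mult_mat_vec_nth[OF L v i] using i by (intro sum.cong refl) (simp add: Lambda_nth[OF A \<alpha>] del: One_nat_def)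
  also have "\<dots> = (\<Sum>k<d. \<Sum>j<g. \<alpha> ! j $$ (0, 0) * A ! j $$ (i, k) * vec_index v k)"
    unfolding sum_distrib_right by (simp add: mult_ac)
  also have "\<dots> = lin g d (cf A) (\<lambda>j. \<alpha> ! j $$ (0, 0)) (\<lambda>k. vec_index v k) i" unfolding lin_def by (rule sum.swap)
  finally show ?thesis .
qed

lemma nrm_vec: "v \<in> carrier_vec d \<Longrightarrow> nrm d (\<lambda>k. vec_index v k) = (vnorm v)\<^sup>2"
  unfolding nrm_def vnorm_power2 by auto

text \<open>The quadratic form of the matrix is \<open>nrm d x - nrm d (l x)\<close>: positivity
  means that \<open>l\<close> is a contraction, and the kernel consists of the vectors at which
  \<open>l\<close> attains its norm.\<close>

lemma psd_kernel_peak: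
  assumes A: "A \<in> mtuples d g" and \<alpha>: "\<alpha> \<in> mtuples 1 g"
    and K: "psd_with_kernel d (1\<^sub>m d - mat_adjoint (Lambda d 1 A \<alpha>) * Lambda d 1 A \<alpha>) u"
  defines "l \<equiv> lin g d (cf A) (\<lambda>j. \<alpha> ! j $$ (0, 0))" and "u' \<equiv> \<lambda>k. vec_index u k"
  shows "nrm d (l x) \<le> nrm d x" and "nrm d (l u') = nrm d u'" and "0 < nrm d u'"
    and "nrm d (l x) = nrm d x \<Longrightarrow> \<exists>c. \<forall>i<d. x i = c * u' i"
proof -
  let ?L = "Lambda d 1 A \<alpha>" and ?H = "1\<^sub>m d - mat_adjoint (Lambda d 1 A \<alpha>) * Lambda d 1 A \<alpha>"
  have L: "?L \<in> carrier_mat d d" using Lambda_carrier[of d 1 A \<alpha>] by simp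
  have La: "mat_adjoint ?L \<in> carrier_mat d d" using L by simp
  have H: "?H \<in> carrier_mat d d" by (rule minus_carrier_mat[OF mult_carrier_mat[OF La L]])
  have psd: "\<And>v. v \<in> carrier_vec d \<Longrightarrow> 0 \<le> Re ((?H *\<^sub>v v) \<bullet>c v)" and u: "u \<in> carrier_vec d" "u \<noteq> 0\<^sub>v d"
    and ker: "mat_kernel ?H = LinearCombinations.module.span class_ring (module_vec TYPE(complex) d) {u}"
    using K unfolding psd_with_kernel_def psd_def by auto
  have lL: "l (\<lambda>k. vec_index v k) i = vec_index (?L *\<^sub>v v) i" if "v \<in> carrier_vec d" "i < d" for v i
    unfolding l_def using mult_Lambda_scalar[OF A \<alpha> that] by simp
  have nl: "nrm d (l (\<lambda>k. vec_index v k)) = (vnorm (?L *\<^sub>v v))\<^sup>2" if "v \<in> carrier_vec d" for v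
    using nrm_vec[OF mult_mat_vec_carrier[OF L that]] nrm_cong[of d, OF lL[OF that]] by simp
  have HH: "(?H *\<^sub>v v) \<bullet>c w = v \<bullet>c w - (?L *\<^sub>v v) \<bullet>c (?L *\<^sub>v w)" if v: "v \<in> carrier_vec d" and w: "w \<in> carrier_vec d" for v w
  proof -
    have c: "?L *\<^sub>v v \<in> carrier_vec d" "mat_adjoint ?L *\<^sub>v (?L *\<^sub>v v) \<in> carrier_vec d"
      using L La v by (auto intro!: mult_mat_vec_carrier)
    have "?H *\<^sub>v v = 1\<^sub>m d *\<^sub>v v - (mat_adjoint ?L * ?L) *\<^sub>v v"
      by (rule minus_mult_distrib_mat_vec[of _ d d]) (use mult_carrier_mat[OF La L] v in auto)
    then have "?H *\<^sub>v v = v - mat_adjoint ?L *\<^sub>v (?L *\<^sub>v v)"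
      using assoc_mult_mat_vec[OF La L v] v by simp
    then have "(?H *\<^sub>v v) \<bullet>c w = v \<bullet>c w - (mat_adjoint ?L *\<^sub>v (?L *\<^sub>v v)) \<bullet>c w"
      using v w c by (simp add: minus_scalar_prod_distrib[of _ d])
    then show ?thesis unfolding mat_adjoint_cscalar[OF L c(1) w] .
  qed
  have sq: "v \<bullet>c v = of_real ((vnorm v)\<^sup>2)" if "v \<in> carrier_vec d" for v
    unfolding cscalar_sum[OF that that] vnorm_power2 of_real_sum using that
    by (simp only: complex_norm_square carrier_vecD)
  have ve: "\<exists>v. v \<in> carrier_vec d \<and> (\<forall>i<d. vec_index v i = x i)" for x :: "nat \<Rightarrow> complex"
    by (intro exI[of _ "Matrix.vec d x"]) auto
  have lcong: "nrm d (l x) = nrm d (l y)" "nrm d x = nrm d y" if "\<And>i. i < d \<Longrightarrow> x i = y i" for x y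
  proof -
    have "l x = l y" unfolding l_def lin_def using that by (intro ext sum.cong refl) auto
    then show "nrm d (l x) = nrm d (l y)" by simp
    show "nrm d x = nrm d y" using that by (rule nrm_cong)
  qed
  show contr: "nrm d (l x) \<le> nrm d x" for x
  proof -
    obtain v where v: "v \<in> carrier_vec d" "\<And>i. i < d \<Longrightarrow> x i = vec_index v i" using ve[of x] by metis
    have "Re ((?H *\<^sub>v v) \<bullet>c v) = (vnorm v)\<^sup>2 - (vnorm (?L *\<^sub>v v))\<^sup>2"
      unfolding HH[OF v(1) v(1)] sq[OF v(1)] sq[OF mult_mat_vec_carrier[OF L v(1)]] by simp
    then show ?thesis using psd[OF v(1)] lcong[OF v(2)] nl[OF v(1)] nrm_vec[OF v(1)] by simp
  qed
  have "u \<in> mat_kernel ?H"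
  proof -
    interpret vec_space "TYPE(complex)" d .
    show ?thesis unfolding ker using in_own_span[of "{u}"] u(1) by auto
  qed
  then have "?H *\<^sub>v u = 0\<^sub>v d" using H unfolding mat_kernel_def by auto
  then have "u \<bullet>c u = (?L *\<^sub>v u) \<bullet>c (?L *\<^sub>v u)" using HH[OF u(1) u(1)] u(1) by simp
  then have "(of_real ((vnorm u)\<^sup>2) :: complex) = of_real ((vnorm (?L *\<^sub>v u))\<^sup>2)"
    unfolding sq[OF u(1)] sq[OF mult_mat_vec_carrier[OF L u(1)]] .
  then have "(vnorm u)\<^sup>2 = (vnorm (?L *\<^sub>v u))\<^sup>2" by (simp only: of_real_eq_iff)
  then show "nrm d (l u') = nrm d u'" unfolding u'_def nl[OF u(1)] nrm_vec[OF u(1)] by simp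
  show "0 < nrm d u'"
  proof (rule ccontr)
    assume "\<not> ?thesis"
    then have "nrm d u' = 0" using nrm_nonneg[of d u'] by linarith
    then have "u = 0\<^sub>v d" using nrm_zero[of d u'] u(1) unfolding u'_def by (intro eq_vecI) auto
    then show False using u(2) by simp
  qed
  show "\<exists>c. \<forall>i<d. x i = c * u' i" if eq: "nrm d (l x) = nrm d x"
  proof -
    obtain v where v: "v \<in> carrier_vec d" "\<And>i. i < d \<Longrightarrow> x i = vec_index v i" using ve[of x] by metis
    \<comment> \<open>Testing \<open>peak_ip\<close> with the image of \<open>v\<close> under the
      matrix itself shows that this image is orthogonal to itself.\<close>
    let ?w = "?H *\<^sub>v v"
    have w: "?w \<in> carrier_vec d" by (rule mult_mat_vec_carrier[OF H v(1)])
    have "ip d (l (\<lambda>k. vec_index v k)) (l (\<lambda>k. vec_index ?w k)) = ip d (\<lambda>k. vec_index v k) (\<lambda>k. vec_index ?w k)"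
      unfolding l_def
      by (rule peak_ip) (use contr eq lcong[OF v(2)] in \<open>simp_all add: l_def\<close>)
    moreover have "ip d (l (\<lambda>k. vec_index v k)) (l (\<lambda>k. vec_index ?w k)) = (?L *\<^sub>v v) \<bullet>c (?L *\<^sub>v ?w)"
      unfolding cscalar_sum[OF mult_mat_vec_carrier[OF L v(1)] mult_mat_vec_carrier[OF L w]] ip_def
      using lL[OF v(1)] lL[OF w] by (intro sum.cong) auto
    moreover have "ip d (\<lambda>k. vec_index v k) (\<lambda>k. vec_index ?w k) = v \<bullet>c ?w"
      unfolding cscalar_sum[OF v(1) w] ip_def ..
    ultimately have "?w \<bullet>c ?w = 0" using HH[OF v(1) w] by simp
    then have "?w = 0\<^sub>v d" using conjugate_square_eq_0_vec[OF w] by simp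
    then have "v \<in> mat_kernel ?H" using H v(1) unfolding mat_kernel_def by auto
    then have "\<exists>a. \<forall>i<d. vec_index v i = (\<Sum>w\<in>{u}. a w * vec_index w i)"
      unfolding ker using u(1) by (intro vec_span_coeffs) auto
    then show ?thesis using v(2) unfolding u'_def by auto
  qed
qed

text \<open>The linear relation in a hyperbasis has no zero coefficient, so the vectors can absorb
  the coefficients. The vectors \<open>v k\<close> satisfy \<open>v k = L (w k)\<close>, where
  \<open>w k\<close> is the adjoint of \<open>L\<close> applied to \<open>v k\<close>; this puts a
  basis into the sum of the ranges.\<close>

lemma sv_generic_gen_data:
  assumes A: "A \<in> mtuples d g" and sv: "sv_generic d g A"
  obtains \<alpha> u where "gen_data g d (cf A) \<alpha> u"
proof -
  obtain \<alpha> \<beta> :: "nat \<Rightarrow> complex mat list" and u v :: "nat \<Rightarrow> complex Matrix.vec" where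
    \<alpha>K: "\<forall>j<d + 1. \<alpha> j \<in> mtuples 1 g \<and>
      psd_with_kernel d (1\<^sub>m d - mat_adjoint (Lambda d 1 A (\<alpha> j)) * Lambda d 1 A (\<alpha> j)) (u j)" and
    hb: "hyperbasis d (u ` {..<d + 1})" and
    \<beta>K: "\<forall>k<d. \<beta> k \<in> mtuples 1 g \<and>
      psd_with_kernel d (1\<^sub>m d - Lambda d 1 A (\<beta> k) * mat_adjoint (Lambda d 1 A (\<beta> k))) (v k)" and
    vc: "card (v ` {..<d}) = d" and vb: "vbasis d (v ` {..<d})"
    using sv unfolding sv_generic_def by (elim exE conjE) (rule that)
  have \<alpha>: "\<And>j. j < d + 1 \<Longrightarrow> \<alpha> j \<in> mtuples 1 g" and
    K: "\<And>j. j < d + 1 \<Longrightarrow> psd_with_kernel d (1\<^sub>m d - mat_adjoint (Lambda d 1 A (\<alpha> j)) * Lambda d 1 A (\<alpha> j)) (u j)" and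
    \<beta>: "\<And>k. k < d \<Longrightarrow> \<beta> k \<in> mtuples 1 g" and
    K': "\<And>k. k < d \<Longrightarrow> psd_with_kernel d (1\<^sub>m d - Lambda d 1 A (\<beta> k) * mat_adjoint (Lambda d 1 A (\<beta> k))) (v k)"
    using \<alpha>K \<beta>K by blast+
  define ua where "ua a i = vec_index (u a) i" for a i
  define \<alpha>' where "\<alpha>' a j = \<alpha> a ! j $$ (0, 0)" for a j
  let ?l = "\<lambda>a. lin g d (cf A) (\<alpha>' a)"
  have pk: "nrm d (?l a x) \<le> nrm d x" "nrm d (?l a (ua a)) = nrm d (ua a)" "0 < nrm d (ua a)"
    "nrm d (?l a x) = nrm d x \<Longrightarrow> \<exists>c. \<forall>i<d. x i = c * ua a i" if "a \<le> d" for a x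
    using psd_kernel_peak[OF A \<alpha> K, of a] that unfolding \<alpha>'_def ua_def by auto
  have inj: "inj_on u {..<d + 1}" using hb unfolding hyperbasis_def by (intro eq_card_imp_inj_on) auto
  have sub: "vbasis d (u ` T)" if "T \<subseteq> {..<d + 1}" "card T = d" for T
  proof -
    have "card (u ` T) = d" using that card_image inj_on_subset[OF inj] by metis
    then show ?thesis using hb image_mono[OF that(1), of u] unfolding hyperbasis_def by blast
  qed
  \<comment> \<open>A relation with one coefficient zero involves only \<open>d\<close> of the
    vectors, and these form a basis.\<close>
  have van: "t a = 0" if z: "\<And>i. i < d \<Longrightarrow> (\<Sum>a\<le>d. t a * ua a i) = 0" and b: "b \<le> d" "t b = 0" and a: "a \<le> d" for t a b
  proof (cases "a = b")
    case False
    let ?T = "{..<d + 1} - {b}"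
    have T: "?T \<subseteq> {..<d + 1}" "card ?T = d" using b by auto
    show ?thesis
    proof (rule vbasis_indep[OF sub[OF T] inj_on_subset[OF inj T(1)]])
      fix i assume i: "i < d"
      have "(\<Sum>a\<in>?T. t a * vec_index (u a) i) = (\<Sum>a\<in>{..<d + 1}. t a * vec_index (u a) i)"
        using b by (intro sum.mono_neutral_left) auto
      then show "(\<Sum>a\<in>?T. t a * vec_index (u a) i) = 0" using z[OF i] unfolding ua_def by (simp add: lessThan_Suc_atMost)
    qed (use False a in auto)
  qed (use b in simp)
  have bas: "\<exists>t. \<forall>i<d. x i = (\<Sum>a<d. t a * ua a i)" for x
    unfolding ua_def by (rule vbasis_span[OF sub]) (auto intro: inj_on_subset[OF inj])
  obtain c where c: "\<And>i. i < d \<Longrightarrow> ua d i = (\<Sum>a<d. c a * ua a i)" using bas[of "ua d"] by blast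
  \<comment> \<open>The last vector expressed by the others and moved to the other side;
    \<open>van\<close> then shows that no coefficient is zero.\<close>
  define t where "t a = (if a = d then - 1 else c a)" for a
  have split: "(\<Sum>a\<le>d. f a) = (\<Sum>a<d. f a) + f d" for f :: "nat \<Rightarrow> complex"
    by (simp add: lessThan_Suc_atMost[symmetric])
  have t0: "(\<Sum>a\<le>d. t a * ua a i) = 0" if "i < d" for i
    unfolding split using c[OF that] by (simp add: t_def)
  have tn: "t a \<noteq> 0" if "a \<le> d" for a
    using van[of t a d] t0 that by (auto simp: t_def)
  define \<nu> where "\<nu> = (\<Sum>a\<le>d. nrm d (\<lambda>i. t a * ua a i))"
  have "0 < nrm d (\<lambda>i. t a * ua a i)" if "a \<le> d" for a
    unfolding nrm_scale using tn[OF that] pk(3)[OF that] by simp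
  then have \<nu>: "0 < \<nu>" unfolding \<nu>_def by (intro sum_pos) auto
  \<comment> \<open>The factor makes the squared norms of the rescaled vectors add up to 1.\<close>
  define s where "s a = of_real (1 / sqrt \<nu>) * t a" for a
  have s: "s a \<noteq> 0" if "a \<le> d" for a using tn[OF that] \<nu> unfolding s_def by simp
  have s0: "(\<Sum>a\<le>d. s a * ua a i) = 0" if "i < d" for i
    using t0[OF that] unfolding s_def mult.assoc sum_distrib_left[symmetric] by simp
  have lc: "?l a (\<lambda>i. k * x i) = (\<lambda>i. k * ?l a x i)" for a k x
    unfolding lin_def by (simp add: sum_distrib_left mult_ac)
  have "gen_data g d (cf A) \<alpha>' (\<lambda>a i. s a * ua a i)"
    unfolding gen_data_def
  proof (intro conjI allI impI)
    show "nrm d (?l a x) \<le> nrm d x" if "a \<le> d" for a x by (rule pk(1)[OF that])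
    show "nrm d (?l a (\<lambda>i. s a * ua a i)) = nrm d (\<lambda>i. s a * ua a i)" if "a \<le> d" for a
      unfolding lc nrm_scale pk(2)[OF that] ..
    show "0 < nrm d (\<lambda>i. s a * ua a i)" if "a \<le> d" for a
      unfolding nrm_scale using s[OF that] pk(3)[OF that] by simp
    show "\<exists>c. \<forall>i<d. x i = c * (s a * ua a i)" if a: "a \<le> d" and eq: "nrm d (?l a x) = nrm d x" for a x
    proof -
      obtain c where "\<forall>i<d. x i = c * ua a i" using pk(4)[OF a eq] by blast
      then show ?thesis using s[OF a] by (intro exI[of _ "c / s a"]) simp
    qed
    show "(\<Sum>a\<le>d. s a * ua a i) = 0" if "i < d" for i by (rule s0[OF that])
    show "(\<Sum>a\<le>d. nrm d (\<lambda>i. s a * ua a i)) = 1"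
    proof -
      have "nrm d (\<lambda>i. s a * ua a i) = (1 / \<nu>) * nrm d (\<lambda>i. t a * ua a i)" for a
        unfolding nrm_scale s_def using \<nu> by (simp add: norm_mult norm_divide power_mult_distrib power_divide)
      then show ?thesis using \<nu> by (simp add: sum_divide_distrib[symmetric] \<nu>_def[symmetric])
    qed
    \<comment> \<open>Subtracting \<open>\<tau> 0\<close> times the known relation leaves a relation
      whose coefficient at index 0 is zero.\<close>
    show "\<tau> a = \<tau> 0" if z: "\<forall>i<d. (\<Sum>a\<le>d. \<tau> a * (s a * ua a i)) = 0" and a: "a \<le> d" for \<tau> a
    proof -
      have "(\<lambda>a. (\<tau> a - \<tau> 0) * s a) a = 0"
      proof (rule van[of _ 0])
        fix i assume i: "i < d"
        have "(\<Sum>a\<le>d. (\<tau> a - \<tau> 0) * s a * ua a i) = (\<Sum>a\<le>d. \<tau> a * (s a * ua a i)) - \<tau> 0 * (\<Sum>a\<le>d. s a * ua a i)"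
          by (simp add: sum_subtractf sum_distrib_left algebra_simps)
        then show "(\<Sum>a\<le>d. (\<tau> a - \<tau> 0) * s a * ua a i) = 0" using z i s0[OF i] by simp
      qed (use a in auto)
      then show ?thesis using s[OF a] by simp
    qed
    show "\<exists>t. \<forall>i<d. x i = (\<Sum>a\<le>d. t a * (s a * ua a i))" for x
    proof -
      obtain c where c: "\<And>i. i < d \<Longrightarrow> x i = (\<Sum>a<d. c a * ua a i)" using bas[of x] by blast
      show ?thesis
      proof (intro exI allI impI)
        fix i assume i: "i < d"
        show "x i = (\<Sum>a\<le>d. (if a = d then 0 else c a / s a) * (s a * ua a i))"
          unfolding split c[OF i] using s by (auto intro!: sum.cong)
      qed
    qed
    show "\<exists>\<kappa>. \<forall>i<d. x i = (\<Sum>j<g. mv d (cf A j) (\<kappa> j) i)" for x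
    proof -
      have vinj: "inj_on v {..<d}" using vc by (intro eq_card_imp_inj_on) auto
      obtain c where c: "\<And>i. i < d \<Longrightarrow> x i = (\<Sum>k<d. c k * vec_index (v k) i)"
        using vbasis_span[OF vb vinj, of x] by auto
      let ?L = "\<lambda>k. Lambda d 1 A (\<beta> k)"
      define w where "w k = mat_adjoint (?L k) *\<^sub>v v k" for k
      have vw: "vec_index (v k) i = (\<Sum>j<g. \<beta> k ! j $$ (0, 0) * mv d (cf A j) (\<lambda>h. vec_index (w k) h) i)"
        if k: "k < d" and i: "i < d" for k i
      proof -
        have L: "?L k \<in> carrier_mat d d" using Lambda_carrier[of d 1 A "\<beta> k"] by simp
        have La: "mat_adjoint (?L k) \<in> carrier_mat d d" using L by simp
        have vk: "v k \<in> carrier_vec d"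
          and ker: "mat_kernel (1\<^sub>m d - ?L k * mat_adjoint (?L k))
            = LinearCombinations.module.span class_ring (module_vec TYPE(complex) d) {v k}"
          using K'[OF k] unfolding psd_with_kernel_def by auto
        have wk: "w k \<in> carrier_vec d" unfolding w_def by (rule mult_mat_vec_carrier[OF La vk])
        have "v k \<in> mat_kernel (1\<^sub>m d - ?L k * mat_adjoint (?L k))"
        proof -
          interpret vec_space "TYPE(complex)" d .
          show ?thesis unfolding ker using in_own_span[of "{v k}"] vk by auto
        qed
        then have "(1\<^sub>m d - ?L k * mat_adjoint (?L k)) *\<^sub>v v k = 0\<^sub>v d"
          using L La unfolding mat_kernel_def by auto
        moreover have "(1\<^sub>m d - ?L k * mat_adjoint (?L k)) *\<^sub>v v k = 1\<^sub>m d *\<^sub>v v k - (?L k * mat_adjoint (?L k)) *\<^sub>v v k"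
          by (rule minus_mult_distrib_mat_vec[of _ d d]) (use mult_carrier_mat[OF L La] vk in auto)
        moreover have "(?L k * mat_adjoint (?L k)) *\<^sub>v v k = ?L k *\<^sub>v w k"
          unfolding w_def by (rule assoc_mult_mat_vec[OF L La vk])
        ultimately have "v k - ?L k *\<^sub>v w k = 0\<^sub>v d" using vk by simp
        then have "vec_index (v k - ?L k *\<^sub>v w k) i = 0" using i by simp
        moreover have "i < dim_vec (?L k *\<^sub>v w k)"
          unfolding carrier_vecD[OF mult_mat_vec_carrier[OF L wk]] by (rule i)
        ultimately have "vec_index (v k) i = vec_index (?L k *\<^sub>v w k) i"
          by (simp only: index_minus_vec(1) right_minus_eq)
        then show ?thesis unfolding mult_Lambda_scalar[OF A \<beta>[OF k] wk i] lin_mv .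
      qed
      have "x i = (\<Sum>j<g. mv d (cf A j) (\<lambda>h. \<Sum>k<d. (c k * \<beta> k ! j $$ (0, 0)) * vec_index (w k) h) i)" if i: "i < d" for i
      proof -
        have "x i = (\<Sum>k<d. c k * (\<Sum>j<g. \<beta> k ! j $$ (0, 0) * mv d (cf A j) (\<lambda>h. vec_index (w k) h) i))"
          unfolding c[OF i] using vw i by (intro sum.cong refl) auto
        also have "\<dots> = (\<Sum>j<g. \<Sum>k<d. (c k * \<beta> k ! j $$ (0, 0)) * mv d (cf A j) (\<lambda>h. vec_index (w k) h) i)"
          unfolding sum_distrib_left mult.assoc by (rule sum.swap)
        finally show ?thesis unfolding mv_sum .
      qed
      then show ?thesis by (intro exI[of _ "\<lambda>j h. \<Sum>k<d. (c k * \<beta> k ! j $$ (0, 0)) * vec_index (w k) h"]) simp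
    qed
  qed
  then show ?thesis using that by blast
qed

section \<open>Spans and independence of matrices, read off from entries\<close>

lemma matrix_span_lincomb:
  fixes S :: "complex mat set"
  assumes S: "finite S" "S \<subseteq> carrier_mat d d"
  shows "P \<in> LinearCombinations.module.span class_ring (module_mat TYPE(complex) d d) S \<longleftrightarrow>
     P \<in> carrier_mat d d \<and> (\<exists>a. \<forall>i<d. \<forall>k<d. P $$ (i, k) = (\<Sum>M\<in>S. a M * M $$ (i, k)))"
    and "LinearCombinations.module.lin_dep class_ring (module_mat TYPE(complex) d d) S \<longleftrightarrow>
     (\<exists>a. (\<exists>M\<in>S. a M \<noteq> 0) \<and> (\<forall>i<d. \<forall>k<d. (\<Sum>M\<in>S. a M * M $$ (i, k)) = 0))"
proof -
  interpret vectorspace class_ring "module_mat TYPE(complex) d d" by (rule VS_Connect.matrix_vs)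
  have lc: "lincomb a T \<in> carrier_mat d d \<and> (\<forall>i<d. \<forall>k<d. lincomb a T $$ (i, k) = (\<Sum>M\<in>T. a M * M $$ (i, k)))"
    if "finite T" "T \<subseteq> carrier_mat d d" for T a
    using that
  proof (induction T rule: finite_induct)
    case empty
    show ?case unfolding lincomb_def by (simp add: module_mat_simps)
  next
    case (insert M T)
    have "lincomb a (insert M T) = a M \<cdot>\<^sub>m M + lincomb a T"
      unfolding lincomb_def using insert
      by (subst M.finsum_insert) (auto simp: module_mat_simps Pi_def)
    then show ?case using insert by (auto simp: carrier_matD)
  qed
  show "P \<in> span S \<longleftrightarrow> P \<in> carrier_mat d d \<and> (\<exists>a. \<forall>i<d. \<forall>k<d. P $$ (i, k) = (\<Sum>M\<in>S. a M * M $$ (i, k)))"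
  proof -
    have sp: "span S = {lincomb a S |a. True}"
      using finite_span[OF S(1)] S(2) by (auto simp: module_mat_simps class_ring_simps)
    show ?thesis
    proof
      assume "P \<in> span S"
      then obtain a where a: "P = lincomb a S" unfolding sp by auto
      show "P \<in> carrier_mat d d \<and> (\<exists>a. \<forall>i<d. \<forall>k<d. P $$ (i, k) = (\<Sum>M\<in>S. a M * M $$ (i, k)))"
        unfolding a using lc[OF S, of a] by (intro conjI exI[of _ a]) auto
    next
      assume "P \<in> carrier_mat d d \<and> (\<exists>a. \<forall>i<d. \<forall>k<d. P $$ (i, k) = (\<Sum>M\<in>S. a M * M $$ (i, k)))"
      then obtain a where P: "P \<in> carrier_mat d d" "\<forall>i<d. \<forall>k<d. P $$ (i, k) = (\<Sum>M\<in>S. a M * M $$ (i, k))" by (elim conjE exE)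
      have "P = lincomb a S" using lc[OF S, of a] P by (intro eq_matI) auto
      then show "P \<in> span S" unfolding sp by auto
    qed
  qed
  show "lin_dep S \<longleftrightarrow> (\<exists>a. (\<exists>M\<in>S. a M \<noteq> 0) \<and> (\<forall>i<d. \<forall>k<d. (\<Sum>M\<in>S. a M * M $$ (i, k)) = 0))"
  proof
    assume "lin_dep S"
    then obtain T a M where T: "finite T" "T \<subseteq> S" "lincomb a T = 0\<^sub>m d d" "M \<in> T" "a M \<noteq> 0"
      unfolding lin_dep_def by (auto simp: module_mat_simps class_ring_simps)
    let ?a = "\<lambda>M. if M \<in> T then a M else 0"
    have "(\<Sum>M\<in>S. ?a M * M $$ (i, k)) = 0" if "i < d" "k < d" for i k
    proof -
      have "(\<Sum>M\<in>S. ?a M * M $$ (i, k)) = (\<Sum>M\<in>T. a M * M $$ (i, k))"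
        using T(2) S(1) by (intro sum.mono_neutral_cong_right) auto
      also have "\<dots> = lincomb a T $$ (i, k)" using lc[OF T(1), of a] T(2) S(2) that by auto
      finally show ?thesis using T(3) that by simp
    qed
    then show "\<exists>a. (\<exists>M\<in>S. a M \<noteq> 0) \<and> (\<forall>i<d. \<forall>k<d. (\<Sum>M\<in>S. a M * M $$ (i, k)) = 0)"
      using T(2,4,5) by (intro exI[of _ ?a]) auto
  next
    assume "\<exists>a. (\<exists>M\<in>S. a M \<noteq> 0) \<and> (\<forall>i<d. \<forall>k<d. (\<Sum>M\<in>S. a M * M $$ (i, k)) = 0)"
    then obtain a M where a: "M \<in> S" "a M \<noteq> 0" "\<forall>i<d. \<forall>k<d. (\<Sum>M\<in>S. a M * M $$ (i, k)) = 0" by blast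
    have "lincomb a S = 0\<^sub>m d d" using lc[OF S, of a] a(3) by (intro eq_matI) auto
    then show "lin_dep S" unfolding lin_dep_def using a(1,2) S(1)
      by (auto simp: module_mat_simps class_ring_simps)
  qed
qed

text \<open>Distinctness makes indices and matrices correspond one to one, so that coefficients on
  indices become coefficients on the set of matrices.\<close>

lemma lin_indep_tuple_coeffs:
  assumes A: "A \<in> mtuples d g" and li: "lin_indep_tuple d A"
    and z: "\<And>i k. i < d \<Longrightarrow> k < d \<Longrightarrow> (\<Sum>j<g. c j * A ! j $$ (i, k)) = 0" and j: "j < g"
  shows "c j = 0"
proof (rule ccontr)
  assume cj: "c j \<noteq> 0"
  have S: "finite (set A)" "set A \<subseteq> carrier_mat d d" using A unfolding mtuples_def by auto
  have b: "bij_betw ((!) A) {..<g} (set A)"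
    using li A bij_betw_nth[of A "{..<g}" "set A"] unfolding lin_indep_tuple_def mtuples_def by auto
  let ?a = "\<lambda>M. c (inv_into {..<g} ((!) A) M)"
  have zero: "(\<Sum>M\<in>set A. ?a M * M $$ (i, k)) = 0" if "i < d" "k < d" for i k
    using z[OF that] sum.reindex_bij_betw[OF b, of "\<lambda>M. ?a M * M $$ (i, k)"] bij_betw_inv_into_left[OF b] by simp
  have "?a (A ! j) \<noteq> 0" "A ! j \<in> set A"
    using cj j bij_betw_inv_into_left[OF b] A unfolding mtuples_def by auto
  then have "\<exists>a. (\<exists>M\<in>set A. a M \<noteq> 0) \<and> (\<forall>i<d. \<forall>k<d. (\<Sum>M\<in>set A. a M * M $$ (i, k)) = 0)"
    using zero by (intro exI[of _ ?a] conjI bexI[of _ "A ! j"]) auto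
  then show False using li unfolding lin_indep_tuple_def matrix_span_lincomb(2)[OF S] by (elim conjE notE)
qed

section \<open>The convexotonic formula\<close>

lemma mult_mat_nth:
  assumes "A \<in> carrier_mat r c" "B \<in> carrier_mat c k" "i < r" "j < k"
  shows "(A * B) $$ (i, j) = (\<Sum>m<c. A $$ (i, m) * B $$ (m, j))"
  using assms by (auto simp: scalar_prod_def lessThan_atLeast0 intro!: sum.cong)

lemma sum_rotate:
  "(\<Sum>h\<in>A. \<Sum>c\<in>B. \<Sum>j\<in>C. \<Sum>k\<in>D. \<Sum>b\<in>E. T h c j k b) = (\<Sum>c\<in>B. \<Sum>j\<in>C. \<Sum>k\<in>D. \<Sum>b\<in>E. \<Sum>h\<in>A. T h c j k b)"
  for T :: "_ \<Rightarrow> _ \<Rightarrow> _ \<Rightarrow> _ \<Rightarrow> _ \<Rightarrow> complex"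
proof -
  have "(\<Sum>h\<in>A. \<Sum>k\<in>D. \<Sum>b\<in>E. S h k b) = (\<Sum>k\<in>D. \<Sum>b\<in>E. \<Sum>h\<in>A. S h k b)" for S :: "_ \<Rightarrow> _ \<Rightarrow> _ \<Rightarrow> complex"
    by (subst sum.swap) (rule sum.cong[OF refl], rule sum.swap)
  note r2 = this
  have "(\<Sum>h\<in>A. \<Sum>c\<in>B. \<Sum>j\<in>C. \<Sum>k\<in>D. \<Sum>b\<in>E. T h c j k b) = (\<Sum>c\<in>B. \<Sum>h\<in>A. \<Sum>j\<in>C. \<Sum>k\<in>D. \<Sum>b\<in>E. T h c j k b)"
    by (rule sum.swap)
  also have "\<dots> = (\<Sum>c\<in>B. \<Sum>j\<in>C. \<Sum>h\<in>A. \<Sum>k\<in>D. \<Sum>b\<in>E. T h c j k b)"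
    by (rule sum.cong[OF refl]) (rule sum.swap)
  also have "\<dots> = (\<Sum>c\<in>B. \<Sum>j\<in>C. \<Sum>k\<in>D. \<Sum>b\<in>E. \<Sum>h\<in>A. T h c j k b)"
    by (rule sum.cong[OF refl], rule sum.cong[OF refl], rule r2)
  finally show ?thesis .
qed

lemma lam_mv: "lam g d A I x w i s = (\<Sum>j<g. \<Sum>t\<in>I. x j s t * mv d (A j) (\<lambda>k. w k t) i)"
  unfolding lam_def mv_def sum_distrib_left by (rule sum.cong[OF refl], subst sum.swap) (simp add: mult_ac)

text \<open>\<open>\<xi> k j s\<close> are the structure constants of \<open>A_k A_j = \<Sum>_s \<xi> k j s A_s\<close>.\<close>

lemma lam_comp:
  assumes prod: "\<And>k j i h. k < g \<Longrightarrow> j < g \<Longrightarrow> i < d \<Longrightarrow> h < d \<Longrightarrow>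
      (\<Sum>l<d. A k i l * A j l h) = (\<Sum>s<g. \<xi> k j s * A s i h)" and i: "i < d"
  shows "lam g d A I \<rho> (lam g d A I x z) i a
    = lam g d A I (\<lambda>t a b. \<Sum>s<g. \<Sum>j<g. \<Sum>c\<in>I. \<xi> s j t * \<rho> s a c * x j c b) z i a"
proof -
  have mvmv: "mv d (A k) (mv d (A j) y) i = (\<Sum>t<g. \<xi> k j t * mv d (A t) y i)" if "k < g" "j < g" for k j y
  proof -
    have "mv d (A k) (mv d (A j) y) i = (\<Sum>h<d. (\<Sum>l<d. A k i l * A j l h) * y h)"
      unfolding mv_def by (simp add: sum_distrib_left sum_distrib_right) (subst sum.swap, simp add: mult_ac)
    also have "\<dots> = (\<Sum>h<d. (\<Sum>t<g. \<xi> k j t * A t i h) * y h)" using prod that i by simp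
    also have "\<dots> = (\<Sum>t<g. \<xi> k j t * mv d (A t) y i)"
      unfolding mv_def by (simp add: sum_distrib_left sum_distrib_right) (subst sum.swap, simp add: mult_ac)
    finally show ?thesis .
  qed
  let ?m = "\<lambda>t b. mv d (A t) (\<lambda>k. z k b) i"
  have inner: "mv d (A s) (\<lambda>h. lam g d A I x z h c) i = (\<Sum>j<g. \<Sum>b\<in>I. \<Sum>t<g. x j c b * (\<xi> s j t * ?m t b))"
    if "s < g" for s c
  proof -
    have "mv d (A s) (\<lambda>h. lam g d A I x z h c) i = (\<Sum>j<g. \<Sum>b\<in>I. x j c b * mv d (A s) (mv d (A j) (\<lambda>k. z k b)) i)"
    proof -
      have "mv d (A s) (\<lambda>h. \<Sum>j<g. 1 * (\<Sum>b\<in>I. x j c b * mv d (A j) (\<lambda>k. z k b) h)) i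
          = (\<Sum>j<g. 1 * (\<Sum>b\<in>I. x j c b * mv d (A s) (mv d (A j) (\<lambda>k. z k b)) i))"
        unfolding mv_sum ..
      then show ?thesis unfolding lam_mv by simp
    qed
    also have "\<dots> = (\<Sum>j<g. \<Sum>b\<in>I. \<Sum>t<g. x j c b * (\<xi> s j t * ?m t b))"
      using that by (intro sum.cong refl) (simp add: mvmv sum_distrib_left)
    finally show ?thesis .
  qed
  have "lam g d A I \<rho> (lam g d A I x z) i a
      = (\<Sum>s<g. \<Sum>c\<in>I. \<rho> s a c * mv d (A s) (\<lambda>h. lam g d A I x z h c) i)" by (rule lam_mv)
  also have "\<dots> = (\<Sum>s<g. \<Sum>c\<in>I. \<Sum>j<g. \<Sum>b\<in>I. \<Sum>t<g. \<rho> s a c * (x j c b * (\<xi> s j t * ?m t b)))"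
    by (intro sum.cong refl) (simp add: inner sum_distrib_left)
  also have "\<dots> = (\<Sum>s<g. \<Sum>j<g. \<Sum>c\<in>I. \<Sum>t<g. \<Sum>b\<in>I. \<rho> s a c * (x j c b * (\<xi> s j t * ?m t b)))"
    by (rule sum.cong[OF refl], subst sum.swap, rule sum.cong[OF refl], rule sum.cong[OF refl], rule sum.swap)
  also have "\<dots> = (\<Sum>b\<in>I. \<Sum>s<g. \<Sum>j<g. \<Sum>c\<in>I. \<Sum>t<g. \<rho> s a c * (x j c b * (\<xi> s j t * ?m t b)))"
    by (rule sum_rotate[symmetric])
  also have "\<dots> = (\<Sum>t<g. \<Sum>b\<in>I. \<Sum>s<g. \<Sum>j<g. \<Sum>c\<in>I. \<rho> s a c * (x j c b * (\<xi> s j t * ?m t b)))"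
    by (rule sum_rotate[symmetric])
  also have "\<dots> = (\<Sum>t<g. \<Sum>b\<in>I. (\<Sum>s<g. \<Sum>j<g. \<Sum>c\<in>I. \<xi> s j t * \<rho> s a c * x j c b) * ?m t b)"
    unfolding sum_distrib_right by (simp add: mult_ac)
  finally show ?thesis unfolding lam_mv[of g d A I _ z] .
qed

context ball_map
begin

lemma fball_small:
  assumes h: "bij_betw h {..<N::nat} I"
  obtains c where "c \<noteq> 0" "fball g d (cf E) I I (\<lambda>j s t. c * x j s t)"
proof -
  obtain K where K: "0 < K" "\<And>w. nsq d I (lam g d (cf E) I x w) \<le> K\<^sup>2 * nsq d I w"
    using lam_bounded[OF h E, of x] by blast
  define c where "c = complex_of_real (1 / K)"
  have c: "c \<noteq> 0" "(cmod c)\<^sup>2 * K\<^sup>2 = 1" using K(1) unfolding c_def by (auto simp: norm_divide power_divide)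
  have "fball g d (cf E) I I (\<lambda>j s t. c * x j s t)" unfolding fball_def
  proof
    fix v
    have "nsq d I (lam g d (cf E) I (\<lambda>j s t. c * x j s t) v) = (cmod c)\<^sup>2 * nsq d I (lam g d (cf E) I x v)"
      unfolding nsq_scale[symmetric] by (rule nsq_cong) (rule lam_scale)
    also have "\<dots> \<le> (cmod c)\<^sup>2 * (K\<^sup>2 * nsq d I v)" by (intro mult_left_mono K(2)) simp
    finally show "nsq d I (lam g d (cf E) I (\<lambda>j s t. c * x j s t) v) \<le> nsq d I v"
      using c(2) by (simp add: mult.assoc[symmetric])
  qed
  then show ?thesis using that c(1) by blast
qed

text \<open>\<open>kap_zero\<close> in the form \<open>P = L + P L\<close>, which can be
  iterated.\<close>

lemma kernel_identity:
  assumes gd: "gen_data g e (cf B) \<alpha> u" and near: "analytic_near g g (spectraball d g E) p"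
    and n: "0 < (n::nat)" and x: "fball g d (cf E) {..<n} {..<n} x" and ib: "i < e" "b < n"
  shows "lam g e (cf B) {..<n} (ev g p n id x) z i b = lam g e (cf B) {..<n} x z i b
     + lam g e (cf B) {..<n} (ev g p n id x) (lam g e (cf B) {..<n} x z) i b"
  using kap_zero[OF gd near n x ib, of z] unfolding kap_def by (simp add: algebra_simps)

text \<open>Evaluation at the strictly upper triangular \<open>3 \<times> 3\<close> tuple with \<open>x_k\<close> and \<open>x_j\<close> above the diagonal.\<close>

lemma structure_constants:
  assumes gd: "gen_data g e (cf B) \<alpha> u" and near: "analytic_near g g (spectraball d g E) p"
    and kj: "k < g" "j < g"
  shows "\<exists>\<xi>. \<forall>i<e. \<forall>h<e. (\<Sum>l<e. cf B k i l * cf B j l h) = (\<Sum>s<g. \<xi> s * cf B s i h)"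
proof -
  let ?I = "{..<3 :: nat}"
  have id: "bij_betw id ?I ?I" by simp
  let ?x1 = "\<lambda>(l::nat) (s::nat) (t::nat). (if l = k \<and> s = 0 \<and> t = 1 then 1 else 0) + (if l = j \<and> s = 1 \<and> t = 2 then 1 else 0) :: complex"
  obtain r where r: "r \<noteq> 0" "fball g d (cf E) ?I ?I (\<lambda>l s t. r * ?x1 l s t)"
    by (rule fball_small[OF id])
  let ?x = "\<lambda>l s t. r * ?x1 l s t"
  define P where "P = ev g p 3 id ?x"
  let ?L = "lam g e (cf B) ?I"
  have three: "(\<Sum>t\<in>?I. f t) = f 0 + f 1 + f 2" for f :: "nat \<Rightarrow> complex"
    by (simp add: eval_nat_numeral)
  have K: "?L P z i b = ?L ?x z i b + ?L P (?L ?x z) i b" if "i < e" "b < 3" for z i b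
    unfolding P_def by (rule kernel_identity[OF gd near _ r(2) that]) simp
  have pick: "(\<Sum>l<g. if l = m then c l else 0) = c m" if "m < g" for m and c :: "nat \<Rightarrow> complex" using that by simp
  have Lx: "?L ?x z = (\<lambda>i s. if s = 0 then r * mv e (cf B k) (\<lambda>h. z h 1) i
      else if s = 1 then r * mv e (cf B j) (\<lambda>h. z h 2) i else 0)" for z
  proof (intro ext)
    fix i and s :: nat
    have "?L ?x z i s = (\<Sum>l<g. (if l = k then if s = 0 then r * mv e (cf B l) (\<lambda>h. z h 1) i else 0 else 0)
        + (if l = j then if s = 1 then r * mv e (cf B l) (\<lambda>h. z h 2) i else 0 else 0))"
      unfolding lam_mv three by (intro sum.cong refl) auto
    also have "\<dots> = (if s = 0 then r * mv e (cf B k) (\<lambda>h. z h 1) i else 0)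
        + (if s = 1 then r * mv e (cf B j) (\<lambda>h. z h 2) i else 0)"
      unfolding sum.distrib pick[OF kj(1)] pick[OF kj(2)] ..
    finally show "?L ?x z i s = (if s = 0 then r * mv e (cf B k) (\<lambda>h. z h 1) i
      else if s = 1 then r * mv e (cf B j) (\<lambda>h. z h 2) i else 0)" by auto
  qed
  have mv0: "mv e M (\<lambda>h. 0) = (\<lambda>i. 0)" for M unfolding mv_def by simp
  have L0: "?L P (\<lambda>i s. 0) i b = 0" for i b unfolding lam_def by simp
  have "(\<Sum>l<e. cf B k i l * cf B j l h) = (\<Sum>s<g. (P s 0 2 / r\<^sup>2) * cf B s i h)" if ih: "i < e" "h < e" for i h
  proof -
    \<comment> \<open>For a vector in column 2 the identity \<open>P = L + P L\<close> is iterated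
      until the third power of \<open>L\<close> vanishes. Row 0 then isolates
      \<open>B_k B_j\<close>, and the scaling \<open>r\<close> enters squared.\<close>
    define u' where "u' = (\<lambda>i. if i = h then 1 else 0 :: complex)"
    define z where "z = (\<lambda>i s. if s = (2::nat) then u' i else 0)"
    define z1 where "z1 = (\<lambda>i s. if s = (1::nat) then r * mv e (cf B j) u' i else 0)"
    define z2 where "z2 = (\<lambda>i s. if s = (0::nat) then r * mv e (cf B k) (\<lambda>i. r * mv e (cf B j) u' i) i else 0)"
    have "?L ?x z = z1" unfolding Lx z_def z1_def by (intro ext) (auto simp: mv0)
    moreover have "?L ?x z1 = z2" unfolding Lx z1_def z2_def by (intro ext) (auto simp: mv0)
    moreover have "?L ?x z2 = (\<lambda>i s. 0)" unfolding Lx z2_def by (intro ext) (auto simp: mv0)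
    ultimately have "?L P z i 0 = z1 i 0 + ?L P z1 i 0" "?L P z1 i 0 = z2 i 0 + ?L P z2 i 0" "?L P z2 i 0 = 0"
      using K[OF ih(1), of 0 z] K[OF ih(1), of 0 z1] K[OF ih(1), of 0 z2] L0 by simp_all
    then have "?L P z i 0 = r\<^sup>2 * mv e (cf B k) (mv e (cf B j) u') i"
      unfolding z1_def z2_def mv_scale by (simp add: power2_eq_square)
    moreover have "mv e M u' l = M l h" for M l
      using ih(2) unfolding mv_def u'_def by (simp add: if_distrib cong: if_cong)
    then have "mv e (cf B k) (mv e (cf B j) u') i = (\<Sum>l<e. cf B k i l * cf B j l h)" and
      "?L P z i 0 = (\<Sum>s<g. P s 0 2 * cf B s i h)"
      unfolding lam_mv three z_def mv_def[of e "cf B k"] by (simp_all add: mv0)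
    ultimately have "r\<^sup>2 * (\<Sum>l<e. cf B k i l * cf B j l h) = (\<Sum>s<g. P s 0 2 * cf B s i h)" by simp
    then have "(\<Sum>l<e. cf B k i l * cf B j l h) = (\<Sum>s<g. P s 0 2 * cf B s i h) / r\<^sup>2"
      using r(1) by (simp add: field_simps)
    then show ?thesis by (simp add: sum_divide_distrib)
  qed
  then show ?thesis by (intro exI[of _ "\<lambda>s. P s 0 2 / r\<^sup>2"] allI impI)
qed

text \<open>\<open>I - \<Lambda>_B(x)\<close> is onto, being a right factor of \<open>I\<close>, and the \<open>B_s\<close> are independent.\<close>

lemma row_zero:
  assumes gd: "gen_data g e (cf B) \<alpha> u" and near: "analytic_near g g (spectraball d g E) p"
    and n: "0 < (n::nat)" and x: "fball g d (cf E) {..<n} {..<n} x"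
    and indep: "\<forall>c. (\<forall>i<e. \<forall>k<e. (\<Sum>j<g. c j * cf B j i k) = 0) \<longrightarrow> (\<forall>j<g. c j = 0)"
    and z: "\<And>z i. i < e \<Longrightarrow> lam g e (cf B) {..<n} \<rho> (\<lambda>h b. z h b + (-1) * lam g e (cf B) {..<n} x z h b) i a = 0"
    and sb: "s < g" "b < n"
  shows "\<rho> s a b = 0"
proof -
  have "(\<Sum>s<g. \<rho> s a b * cf B s i h) = 0" if ih: "i < e" "h < e" for i h
  proof -
  have id: "bij_betw id {..<n} {..<n}" by simp
  let ?L = "lam g e (cf B) {..<n}" and ?P = "ev g p n id x"
  define w where "w = (\<lambda>k c. if k = h \<and> c = b then 1 else 0 :: complex)"
  \<comment> \<open>\<open>y = (I + P) w\<close> solves \<open>(I - L) y = w\<close>: by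
    \<open>(I + P) (I - L) = I\<close> both sides agree after applying \<open>I + P\<close>, which
    is injective.\<close>
  define y where "y = (\<lambda>k c. w k c + ?L ?P w k c)"
  have "y k c + (-1) * ?L x y k c = w k c" if kc: "k < e" "c < n" for k c
  proof (rule spectrahedron_inj[OF id B p_tup(3)[OF id n x]])
    show "k < e" "c \<in> {..<n}" using kc by auto
    fix i s assume is1: "i < e" "s \<in> {..<n}"
    have "?L ?P (\<lambda>k c. y k c + (-1) * ?L x y k c) i s = ?L ?P y i s - ?L ?P (?L x y) i s"
      unfolding lam_add_scaled by simp
    also have "\<dots> = ?L x y i s"
      using kernel_identity[OF gd near n x is1(1), of s y] is1(2) by simp
    finally show "y i s + (-1) * ?L x y i s + ?L ?P (\<lambda>k c. y k c + (-1) * ?L x y k c) i s = w i s + ?L ?P w i s"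
      unfolding y_def by simp
  qed
  then have "?L \<rho> (\<lambda>h b. y h b + (-1) * ?L x y h b) i a = ?L \<rho> w i a"
    by (intro lam_cong) auto
  then have "?L \<rho> w i a = 0" using z[OF ih(1), of y] by simp
  moreover have "?L \<rho> w i a = (\<Sum>s<g. \<rho> s a b * cf B s i h)"
    unfolding lam_def
  proof (rule sum.cong[OF refl])
    fix s
    have "(\<Sum>t<n. cf B s i k * \<rho> s a t * w k t) = (if k = h then cf B s i h * \<rho> s a b else 0)" for k
      using sum_delta_mult(1)[of "{..<n}" b "\<lambda>t. cf B s i k * \<rho> s a t" 1] sb(2)
      by (cases "k = h") (simp_all add: w_def)
    then show "(\<Sum>k<e. \<Sum>t<n. cf B s i k * \<rho> s a t * w k t) = \<rho> s a b * cf B s i h"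
      using ih(2) sb(2) by (simp add: mult.commute)
  qed
  ultimately show "(\<Sum>s<g. \<rho> s a b * cf B s i h) = 0" by simp
  qed
  then show ?thesis using indep[THEN spec, of "\<lambda>s. \<rho> s a b"] sb(1) by blast
qed

text \<open>By the structure constants, multiplying \<open>\<Lambda>_B(\<rho>)\<close> by
  \<open>\<Lambda>_B(x)\<close> from the right multiplies the row \<open>\<rho>\<close> by
  \<open>\<Lambda>_\<Xi>(x)\<close>. So \<open>p(x)\<close> and the convexotonic expression both
  solve \<open>\<Lambda>_B(\<rho>) (I - \<Lambda>_B(x)) = \<Lambda>_B(x)\<close>, whose solution is
  unique by \<open>row_zero\<close>.\<close>

lemma convexotonic_formula:
  assumes gd: "gen_data g e (cf B) \<alpha> u" and near: "analytic_near g g (spectraball d g E) p"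
    and indep: "\<forall>c. (\<forall>i<e. \<forall>k<e. (\<Sum>j<g. c j * cf B j i k) = 0) \<longrightarrow> (\<forall>j<g. c j = 0)"
    and prod: "\<And>k j i h. k < g \<Longrightarrow> j < g \<Longrightarrow> i < e \<Longrightarrow> h < e \<Longrightarrow>
      (\<Sum>l<e. cf B k i l * cf B j l h) = (\<Sum>s<g. \<Xi> ! j $$ (k, s) * cf B s i h)"
    and \<Xi>: "\<Xi> \<in> mtuples g g" and n: "0 < n" and X: "X \<in> spectraball d g E n"
  shows "X \<in> convexotonic_domain g \<Xi> n" and "p n X = convexotonic_map g \<Xi> n X"
proof -
  have Xm: "X \<in> mtuples n g" using X unfolding spectraball_def by simp
  define x where "x = cf X"
  have id: "bij_betw id {..<n} {..<n}" by simp
  have tx: "tup g n id x = X" unfolding x_def by (rule tup_id[OF Xm])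
  have xb: "fball g d (cf E) {..<n} {..<n} x" using X spectraball_tup[OF id E, of x] unfolding tx by simp
  let ?L = "lam g e (cf B) {..<n}" and ?P = "ev g p n id x"
  \<comment> \<open>For each \<open>a\<close>, the row vector \<open>\<rho>\<close> times
    \<open>\<Lambda>_\<Xi>(x)\<close>.\<close>
  define conj' where "conj' \<rho> t a b = (\<Sum>s<g. \<Sum>j<g. \<Sum>c<n. \<Xi> ! j $$ (s, t) * \<rho> s a c * x j c b)"
    for \<rho> :: "nat \<Rightarrow> nat \<Rightarrow> nat \<Rightarrow> complex" and t a b
  have comp: "?L \<rho> (?L x z) i a = ?L (conj' \<rho>) z i a" if "i < e" for \<rho> z i a
    unfolding conj'_def by (rule lam_comp[OF prod that])
  let ?M = "1\<^sub>m (g * n) - Lambda g n \<Xi> X"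
  have M: "?M \<in> carrier_mat (g * n) (g * n)" by (rule minus_carrier_mat) simp
  have Mn: "?M $$ (s * n + c, t * n + b) = (if s = t \<and> c = b then 1 else 0) - (\<Sum>j<g. \<Xi> ! j $$ (s, t) * x j c b)"
    if "s < g" "t < g" "c < n" "b < n" for s t c b
  proof -
    have i: "s * n + c < g * n" "t * n + b < g * n" using that by (auto intro: block_index_less)
    have "(s * n + c = t * n + b) = (s = t \<and> c = b)"
    proof
      assume eq: "s * n + c = t * n + b"
      have "(s * n + c) div n = s" "(t * n + b) div n = t" using that by auto
      then show "s = t \<and> c = b" using eq by auto
    qed auto
    then show ?thesis using i carrier_matD[OF Lambda_carrier[of g n \<Xi> X]] that
      by (simp add: Lambda_nth[OF \<Xi> Xm i] x_def)
  qed
  have entry: "?M $$ (s * n + c, t * n + b) * \<eta> = (if s = t then if c = b then \<eta>' else 0 else 0)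
      - (\<Sum>j<g. \<Xi> ! j $$ (s, t) * \<eta> * x j c b)"
    if "s < g" "t < g" "c < n" "b < n" "s = t \<Longrightarrow> c = b \<Longrightarrow> \<eta> = \<eta>'" for s t c b \<eta> \<eta>'
    unfolding Mn[OF that(1-4)] left_diff_distrib sum_distrib_right using that(5)
    by (cases "s = t"; cases "c = b") (simp_all add: mult_ac)
  have "Determinant.det ?M \<noteq> 0"
  proof
    assume "Determinant.det ?M = 0"
    \<comment> \<open>The transpose provides a row vector in the left kernel; it is fixed by
      \<open>conj'\<close>, and \<open>row_zero\<close> will show that it vanishes.\<close>
    then have "Determinant.det (transpose_mat ?M) = 0" using Determinant.det_transpose[OF M] by simp
    moreover have MT: "transpose_mat ?M \<in> carrier_mat (g * n) (g * n)" using M by simp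
    ultimately obtain v where v: "v \<in> carrier_vec (g * n)" "v \<noteq> 0\<^sub>v (g * n)" "transpose_mat ?M *\<^sub>v v = 0\<^sub>v (g * n)"
      using det_0_iff_vec_prod_zero_field[OF MT] by blast
    have tr: "transpose_mat ?M $$ (i, j) = ?M $$ (j, i)" if "i < g * n" "j < g * n" for i j
      by (rule index_transpose_mat(1)) (unfold carrier_matD[OF M], rule that(1), rule that(2))
    define \<rho> where "\<rho> s a c = vec_index v (s * n + c)" for s and a :: nat and c
    have fixed: "conj' \<rho> t a b = \<rho> t a b" if tb: "t < g" "b < n" for t a b
    proof -
      have i: "t * n + b < g * n" by (rule block_index_less[OF tb])
      have "0 = vec_index (transpose_mat ?M *\<^sub>v v) (t * n + b)" unfolding v(3) using i by simp
      also have "\<dots> = (\<Sum>l<g * n. transpose_mat ?M $$ (t * n + b, l) * vec_index v l)"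
        by (rule mult_mat_vec_nth[OF MT v(1) i])
      also have "\<dots> = (\<Sum>s<g. \<Sum>c<n. ?M $$ (s * n + c, t * n + b) * \<rho> s a c)"
        unfolding sum_blocks \<rho>_def using i by (intro sum.cong refl) (auto simp: block_index_less tr)
      also have "\<dots> = (\<Sum>s<g. \<Sum>c<n. (if s = t then if c = b then \<rho> t a b else 0 else 0)
          - (\<Sum>j<g. \<Xi> ! j $$ (s, t) * \<rho> s a c * x j c b))"
        by (rule sum.cong[OF refl], rule sum.cong[OF refl]) (use entry[OF _ tb(1) _ tb(2), of _ _ "\<rho> _ a _" "\<rho> t a b"] in simp)
      also have "\<dots> = (\<Sum>s<g. if s = t then \<rho> t a b else 0)
          - (\<Sum>s<g. \<Sum>c<n. \<Sum>j<g. \<Xi> ! j $$ (s, t) * \<rho> s a c * x j c b)"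
        unfolding sum_subtractf using tb by (intro arg_cong2[where f = "(-)"] sum.cong refl) auto
      also have "(\<Sum>s<g. \<Sum>c<n. \<Sum>j<g. \<Xi> ! j $$ (s, t) * \<rho> s a c * x j c b) = conj' \<rho> t a b"
        unfolding conj'_def by (rule sum.cong[OF refl], rule sum.swap)
      finally show ?thesis using tb by simp
    qed
    \<comment> \<open>The index 0 is a placeholder, since this \<open>\<rho>\<close> does not depend
      on its row index.\<close>
    have "\<rho> s 0 b = 0" if "s < g" "b < n" for s b
    proof (rule row_zero[where \<rho> = \<rho> and s = s and a = 0 and b = b, OF gd near n xb indep _ that])
      fix z i assume i: "i < e"
      have "?L \<rho> (\<lambda>h b. z h b + (-1) * ?L x z h b) i 0 = ?L \<rho> z i 0 - ?L (conj' \<rho>) z i 0"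
        unfolding lam_add_scaled comp[OF i] by simp
      also have "?L (conj' \<rho>) z i 0 = ?L \<rho> z i 0" by (rule lam_cong) (use fixed in auto)
      finally show "?L \<rho> (\<lambda>h b. z h b + (-1) * ?L x z h b) i 0 = 0" by simp
    qed
    then have "v = 0\<^sub>v (g * n)"
      using v(1) unfolding \<rho>_def by (intro eq_vecI) (auto elim!: block_index_cases)
    then show False using v(2) by simp
  qed
  then have U: "?M \<in> Units (ring_mat TYPE(complex) (g * n) ())" by (rule det_non_zero_imp_unit[OF M])
  then obtain R where R: "mat_inverse ?M = Some R" using mat_inverse(1)[OF M, where b = "()"] by (cases "mat_inverse ?M") auto
  have inv: "?M * R = 1\<^sub>m (g * n)" "R * ?M = 1\<^sub>m (g * n)" "R \<in> carrier_mat (g * n) (g * n)"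
    using mat_inverse(2)[OF M R] by auto
  show "X \<in> convexotonic_domain g \<Xi> n"
    unfolding convexotonic_domain_def invertible_mat_def inverts_mat_def
    using Xm inv carrier_matD[OF inv(3)] carrier_matD[OF Lambda_carrier[of g n \<Xi> X]]
    by (auto intro!: exI[of _ R])
  define c where "c s a b = (\<Sum>j<g. \<Sum>l<n. x j a l * R $$ (j * n + l, s * n + b))" for s a b
  have cm: "convexotonic_map g \<Xi> n X ! s $$ (a, b) = c s a b" if "s < g" "a < n" "b < n" for s a b
  proof -
    have "(X ! j * mat_block n R j s) $$ (a, b) = (\<Sum>l<n. x j a l * R $$ (j * n + l, s * n + b))" if "j < g" for j
      using mtuples_nth[OF Xm that] \<open>a < n\<close> \<open>b < n\<close> unfolding mat_block_def x_def
      by (auto simp: scalar_prod_def lessThan_atLeast0 intro!: sum.cong)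
    then show ?thesis using that unfolding convexotonic_map_def Let_def R option.sel mat_sum_def c_def by simp
  qed
  \<comment> \<open>The identity \<open>R (I - \<Lambda>_\<Xi>(x)) = I\<close>, multiplied from the
    left by the row \<open>x\<close>.\<close>
  have ceq: "c t a b - conj' c t a b = x t a b" if tab: "t < g" "a < n" "b < n" for t a b
  proof -
    have RM: "(\<Sum>s<g. \<Sum>l'<n. R $$ (j * n + l, s * n + l') * ?M $$ (s * n + l', t * n + b)) = (if j = t \<and> l = b then 1 else 0)"
      if "j < g" "l < n" for j l
    proof -
      have i: "j * n + l < g * n" "t * n + b < g * n" using that tab by (auto intro: block_index_less)
      have "(R * ?M) $$ (j * n + l, t * n + b) = (\<Sum>m<g * n. R $$ (j * n + l, m) * ?M $$ (m, t * n + b))"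
        by (rule mult_mat_nth[OF inv(3) M i])
      moreover have "(j * n + l = t * n + b) = (j = t \<and> l = b)"
      proof
        assume eq: "j * n + l = t * n + b"
        have "(j * n + l) div n = j" "(t * n + b) div n = t" using that tab by auto
        then show "j = t \<and> l = b" using eq by auto
      qed auto
      ultimately show ?thesis unfolding inv(2) sum_blocks using i by simp
    qed
    have "(\<Sum>s<g. \<Sum>l'<n. c s a l' * ?M $$ (s * n + l', t * n + b))
        = (\<Sum>s<g. \<Sum>l'<n. \<Sum>j<g. \<Sum>l<n. x j a l * (R $$ (j * n + l, s * n + l') * ?M $$ (s * n + l', t * n + b)))"
      unfolding c_def sum_distrib_right by (simp only: mult.assoc)
    also have "\<dots> = (\<Sum>j<g. \<Sum>l<n. \<Sum>s<g. \<Sum>l'<n. x j a l * (R $$ (j * n + l, s * n + l') * ?M $$ (s * n + l', t * n + b)))"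
    proof -
      have r: "(\<Sum>h\<in>A. \<Sum>j<g. \<Sum>l<n. S h j l) = (\<Sum>j<g. \<Sum>l<n. \<Sum>h\<in>A. S h j l)"
        for A :: "nat set" and S :: "nat \<Rightarrow> nat \<Rightarrow> nat \<Rightarrow> complex"
        by (subst sum.swap, rule sum.cong[OF refl], rule sum.swap)
      show ?thesis by (subst r, subst r, rule refl)
    qed
    also have "\<dots> = (\<Sum>j<g. \<Sum>l<n. x j a l * (if j = t \<and> l = b then 1 else 0))"
      by (intro sum.cong refl) (simp add: RM sum_distrib_left[symmetric])
    also have "\<dots> = (\<Sum>j<g. if j = t then x t a b else 0)"
    proof (rule sum.cong[OF refl])
      fix j
      show "(\<Sum>l<n. x j a l * (if j = t \<and> l = b then 1 else 0)) = (if j = t then x t a b else 0)"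
        using tab by (cases "j = t") (simp_all add: mult_delta_right)
    qed
    also have "\<dots> = x t a b" using tab by simp
    finally have 1: "(\<Sum>s<g. \<Sum>l'<n. c s a l' * ?M $$ (s * n + l', t * n + b)) = x t a b" .
    have "(\<Sum>s<g. \<Sum>l'<n. c s a l' * ?M $$ (s * n + l', t * n + b))
        = (\<Sum>s<g. \<Sum>l'<n. (if s = t then if l' = b then c t a b else 0 else 0)
            - (\<Sum>j<g. \<Xi> ! j $$ (s, t) * c s a l' * x j l' b))"
      by (rule sum.cong[OF refl], rule sum.cong[OF refl], subst mult.commute)
        (use entry[OF _ tab(1) _ tab(3), of _ _ "c _ a _" "c t a b"] in simp)
    also have "\<dots> = (\<Sum>s<g. if s = t then c t a b else 0) - (\<Sum>s<g. \<Sum>l'<n. \<Sum>j<g. \<Xi> ! j $$ (s, t) * c s a l' * x j l' b)"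
      unfolding sum_subtractf using tab by (intro arg_cong2[where f = "(-)"] sum.cong refl) auto
    also have "(\<Sum>s<g. \<Sum>l'<n. \<Sum>j<g. \<Xi> ! j $$ (s, t) * c s a l' * x j l' b) = conj' c t a b"
      unfolding conj'_def by (rule sum.cong[OF refl], rule sum.swap)
    finally show ?thesis using 1 tab by simp
  qed
  have eq: "c s a b = ?P s a b" if sab: "s < g" "a < n" "b < n" for s a b
  proof -
    have "(\<lambda>s a b. c s a b + (-1) * ?P s a b) s a b = 0"
    proof (rule row_zero[where \<rho> = "\<lambda>s a b. c s a b + (-1) * ?P s a b" and s = s and a = a and b = b,
          OF gd near n xb indep _ sab(1,3)])
      fix z i assume i: "i < e"
      let ?y = "\<lambda>h b. z h b + (-1) * ?L x z h b"
      have sub: "?L (\<lambda>s a b. \<rho> s a b + (-1) * \<rho>' s a b) y i a = ?L \<rho> y i a - ?L \<rho>' y i a" for \<rho> \<rho>' y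
        unfolding lam_def by (simp add: sum_subtractf algebra_simps)
      have "?L c ?y i a = ?L c z i a - ?L (conj' c) z i a" unfolding lam_add_scaled comp[OF i] by simp
      also have "\<dots> = ?L (\<lambda>s a b. c s a b + (-1) * conj' c s a b) z i a" unfolding sub ..
      also have "\<dots> = ?L x z i a" by (rule lam_cong) (use ceq sab(2) in auto)
      finally have 1: "?L c ?y i a = ?L x z i a" .
      have "?L ?P ?y i a = ?L ?P z i a - ?L ?P (?L x z) i a" unfolding lam_add_scaled by simp
      also have "\<dots> = ?L x z i a" using kernel_identity[OF gd near n xb i sab(2), of z] by simp
      finally show "?L (\<lambda>s a b. c s a b + (-1) * ?P s a b) ?y i a = 0" unfolding sub using 1 by simp
    qed
    then show ?thesis by simp
  qed
  have pm: "p n X \<in> mtuples n g" using fp n X unfolding free_map_def by blast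
  have cmm: "convexotonic_map g \<Xi> n X \<in> mtuples n g"
    unfolding convexotonic_map_def Let_def mtuples_def mat_sum_def by auto
  show "p n X = convexotonic_map g \<Xi> n X"
  proof (rule tuple_eqI[OF pm cmm])
    fix j a b assume jab: "j < g" "a < n" "b < n"
    have "p n X = tup g n id ?P" using p_tup(2)[OF id n xb] unfolding tx by simp
    then show "p n X ! j $$ (a, b) = convexotonic_map g \<Xi> n X ! j $$ (a, b)"
      using jab cm[OF jab] eq[OF jab] by (simp add: tup_nth)
  qed
qed

end

section \<open>The unitary equivalence\<close>

lemma mat_sum_carrier [simp]: "mat_sum r c I F \<in> carrier_mat r c"
  unfolding mat_sum_def by simp

lemma mat_sum_nth: "i < r \<Longrightarrow> j < c \<Longrightarrow> mat_sum r c I F $$ (i, j) = (\<Sum>s\<in>I. F s $$ (i, j))"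
  unfolding mat_sum_def by simp

lemma mult_mat_sum:
  assumes A: "A \<in> carrier_mat d d" and F: "\<And>s. s \<in> I \<Longrightarrow> F s \<in> carrier_mat d d"
  shows "A * mat_sum d d I F = mat_sum d d I (\<lambda>s. A * F s)" "mat_sum d d I F * A = mat_sum d d I (\<lambda>s. F s * A)"
proof -
  have "(A * mat_sum d d I F) $$ (i, k) = mat_sum d d I (\<lambda>s. A * F s) $$ (i, k)"
    "(mat_sum d d I F * A) $$ (i, k) = mat_sum d d I (\<lambda>s. F s * A) $$ (i, k)" if ik: "i < d" "k < d" for i k
  proof -
    have "(A * mat_sum d d I F) $$ (i, k) = (\<Sum>m<d. \<Sum>s\<in>I. A $$ (i, m) * F s $$ (m, k))"
      unfolding mult_mat_nth[OF A mat_sum_carrier ik] using ik by (simp add: mat_sum_nth sum_distrib_left)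
    also have "\<dots> = (\<Sum>s\<in>I. (A * F s) $$ (i, k))"
      by (subst sum.swap) (simp add: mult_mat_nth[OF A F ik])
    finally show "(A * mat_sum d d I F) $$ (i, k) = mat_sum d d I (\<lambda>s. A * F s) $$ (i, k)"
      using ik by (simp add: mat_sum_nth)
    have "(mat_sum d d I F * A) $$ (i, k) = (\<Sum>m<d. \<Sum>s\<in>I. F s $$ (i, m) * A $$ (m, k))"
      unfolding mult_mat_nth[OF mat_sum_carrier A ik] using ik by (simp add: mat_sum_nth sum_distrib_right)
    also have "\<dots> = (\<Sum>s\<in>I. (F s * A) $$ (i, k))"
      by (subst sum.swap) (simp add: mult_mat_nth[OF F A ik])
    finally show "(mat_sum d d I F * A) $$ (i, k) = mat_sum d d I (\<lambda>s. F s * A) $$ (i, k)"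
      using ik by (simp add: mat_sum_nth)
  qed
  then show "A * mat_sum d d I F = mat_sum d d I (\<lambda>s. A * F s)" "mat_sum d d I F * A = mat_sum d d I (\<lambda>s. F s * A)"
    using A by (auto intro!: eq_matI simp: mat_sum_def)
qed

lemma mat_adjoint_adjoint:
  fixes A :: "complex mat"
  assumes A: "A \<in> carrier_mat r c"
  shows "mat_adjoint (mat_adjoint A) = A"
proof -
  have A': "mat_adjoint A \<in> carrier_mat c r" and A'': "mat_adjoint (mat_adjoint A) \<in> carrier_mat r c" using A by auto
  show ?thesis
    by (rule eq_matI) (unfold carrier_matD[OF A] carrier_matD[OF A''],
      simp_all add: mat_adjoint_nth[OF A'] mat_adjoint_nth[OF A])
qed

lemma mat_adjoint_mult:
  fixes A C :: "complex mat"
  assumes A: "A \<in> carrier_mat d d" and C: "C \<in> carrier_mat d d"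
  shows "mat_adjoint (A * C) = mat_adjoint C * mat_adjoint A"
proof (rule eq_matI)
  have AC: "A * C \<in> carrier_mat d d" by (rule mult_carrier_mat[OF A C])
  have aAC: "mat_adjoint (A * C) \<in> carrier_mat d d" "mat_adjoint C * mat_adjoint A \<in> carrier_mat d d"
    using mat_adjoint_carrier[OF AC] mult_carrier_mat[OF mat_adjoint_carrier[OF C] mat_adjoint_carrier[OF A]] by auto
  show "dim_row (mat_adjoint (A * C)) = dim_row (mat_adjoint C * mat_adjoint A)"
    "dim_col (mat_adjoint (A * C)) = dim_col (mat_adjoint C * mat_adjoint A)"
    unfolding carrier_matD[OF aAC(1)] carrier_matD[OF aAC(2)] by simp_all
  fix i j assume "i < dim_row (mat_adjoint C * mat_adjoint A)" "j < dim_col (mat_adjoint C * mat_adjoint A)"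
  then have ij: "i < d" "j < d" unfolding carrier_matD[OF aAC(2)] by auto
  show "mat_adjoint (A * C) $$ (i, j) = (mat_adjoint C * mat_adjoint A) $$ (i, j)"
    unfolding mat_adjoint_nth[OF AC ij] mult_mat_nth[OF A C ij(2,1)]
      mult_mat_nth[OF mat_adjoint_carrier[OF C] mat_adjoint_carrier[OF A] ij]
    using ij by (simp add: mat_adjoint_nth[OF A] mat_adjoint_nth[OF C] mult.commute)
qed

text \<open>Orthonormal columns give a left inverse, which in square size is two-sided.\<close>

lemma unitary_mat_isometry:
  assumes iso: "\<And>y z. ip d (mv d W y) (mv d W z) = ip d y z"
  shows "unitary_mat d (Matrix.mat d d (\<lambda>(i, k). W i k))"
proof -
  let ?W = "Matrix.mat d d (\<lambda>(i, k). W i k)"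
  have W: "?W \<in> carrier_mat d d" by simp
  have Wa: "mat_adjoint ?W \<in> carrier_mat d d" using W by simp
  have "mat_adjoint ?W * ?W = 1\<^sub>m d"
  proof (rule eq_matI)
    fix k l assume "k < dim_row (1\<^sub>m d :: complex mat)" "l < dim_col (1\<^sub>m d :: complex mat)"
    then have kl: "k < d" "l < d" by auto
    have "(mat_adjoint ?W * ?W) $$ (k, l) = (\<Sum>i<d. W i l * cnj (W i k))"
      unfolding mult_mat_nth[OF Wa W kl] using kl by (simp add: mat_adjoint_nth[OF W] mult.commute)
    then show "(mat_adjoint ?W * ?W) $$ (k, l) = 1\<^sub>m d $$ (k, l)"
      using isometry_columns[OF iso kl(2,1)] kl by auto
  qed (use carrier_matD[OF mult_carrier_mat[OF Wa W]] in auto)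
  moreover from this have "?W * mat_adjoint ?W = 1\<^sub>m d" by (rule mat_mult_left_right_inverse[OF Wa W])
  ultimately show ?thesis unfolding unitary_mat_def using W by simp
qed

lemma unitary_mat_adjoint: "unitary_mat d U \<Longrightarrow> unitary_mat d (mat_adjoint U)"
  unfolding unitary_mat_def by (simp add: mat_adjoint_adjoint[of U d d])

lemma unitary_mat_mult:
  assumes U: "unitary_mat d U" and V: "unitary_mat d V"
  shows "unitary_mat d (U * V)"
proof -
  have c: "U \<in> carrier_mat d d" "V \<in> carrier_mat d d" using U V unfolding unitary_mat_def by auto
  have UV: "U * V \<in> carrier_mat d d" by (rule mult_carrier_mat[OF c])
  have ca: "mat_adjoint U \<in> carrier_mat d d" "mat_adjoint V \<in> carrier_mat d d" using c by auto
  have "mat_adjoint (U * V) * (U * V) = mat_adjoint V * (mat_adjoint U * (U * V))"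
    unfolding mat_adjoint_mult[OF c] by (rule assoc_mult_mat[OF ca(2,1) UV])
  also have "mat_adjoint U * (U * V) = (mat_adjoint U * U) * V" by (rule assoc_mult_mat[OF ca(1) c, symmetric])
  also have "\<dots> = V" using U c unfolding unitary_mat_def by simp
  finally have 1: "mat_adjoint (U * V) * (U * V) = 1\<^sub>m d" using V unfolding unitary_mat_def by simp
  moreover have "(U * V) * mat_adjoint (U * V) = 1\<^sub>m d"
    by (rule mat_mult_left_right_inverse[OF mat_adjoint_carrier[OF UV] UV 1])
  ultimately show ?thesis unfolding unitary_mat_def using UV by simp
qed

text \<open>The tuple may repeat a matrix, so coefficients on indices are summed over all indices of
  the same matrix to give coefficients on the set.\<close>

lemma spans_algebraI:
  assumes B: "B \<in> mtuples d g"
    and prod: "\<And>k j i h. k < g \<Longrightarrow> j < g \<Longrightarrow> i < d \<Longrightarrow> h < d \<Longrightarrow>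
      (\<Sum>l<d. B ! k $$ (i, l) * B ! j $$ (l, h)) = (\<Sum>s<g. \<xi> k j s * B ! s $$ (i, h))"
  shows "spans_algebra d B"
proof -
  let ?S = "set B"
  have S: "finite ?S" "?S \<subseteq> carrier_mat d d" and len: "length B = g" using B unfolding mtuples_def by auto
  have ex: "\<exists>c. \<forall>i<d. \<forall>h<d. (\<Sum>l<d. M $$ (i, l) * M' $$ (l, h)) = (\<Sum>N\<in>?S. c N * N $$ (i, h))"
    if MM: "M \<in> ?S" "M' \<in> ?S" for M M'
  proof -
    obtain k j where kj: "k < g" "M = B ! k" "j < g" "M' = B ! j" using MM len by (metis in_set_conv_nth)
    have "(\<Sum>N\<in>?S. (\<Sum>s | s \<in> {..<g} \<and> B ! s = N. \<xi> k j s) * N $$ (i, h)) = (\<Sum>s<g. \<xi> k j s * B ! s $$ (i, h))" for i h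
    proof -
      have "(\<Sum>N\<in>?S. (\<Sum>s | s \<in> {..<g} \<and> B ! s = N. \<xi> k j s) * N $$ (i, h))
          = (\<Sum>N\<in>?S. \<Sum>s | s \<in> {..<g} \<and> B ! s = N. \<xi> k j s * B ! s $$ (i, h))"
        unfolding sum_distrib_right by (intro sum.cong refl) auto
      also have "\<dots> = (\<Sum>s<g. \<xi> k j s * B ! s $$ (i, h))" using len by (intro sum.group S(1)) auto
      finally show ?thesis .
    qed
    then show ?thesis using prod[OF kj(1,3)] unfolding kj(2,4)
      by (intro exI[of _ "\<lambda>N. \<Sum>s | s \<in> {..<g} \<and> B ! s = N. \<xi> k j s"]) simp
  qed
  define c where "c M M' = (SOME c. \<forall>i<d. \<forall>h<d. (\<Sum>l<d. M $$ (i, l) * M' $$ (l, h)) = (\<Sum>N\<in>?S. c N * N $$ (i, h)))" for M M'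
  have c: "(\<Sum>l<d. M $$ (i, l) * M' $$ (l, h)) = (\<Sum>N\<in>?S. c M M' N * N $$ (i, h))"
    if "M \<in> ?S" "M' \<in> ?S" "i < d" "h < d" for M M' i h
    using someI_ex[OF ex[OF that(1,2)], folded c_def] that(3,4) by blast
  show ?thesis unfolding spans_algebra_def Let_def
  proof (intro ballI)
    fix P R
    assume "P \<in> LinearCombinations.module.span class_ring (module_mat TYPE(complex) d d) ?S"
      "R \<in> LinearCombinations.module.span class_ring (module_mat TYPE(complex) d d) ?S"
    then obtain a a' where P: "P \<in> carrier_mat d d" "\<And>i k. i < d \<Longrightarrow> k < d \<Longrightarrow> P $$ (i, k) = (\<Sum>M\<in>?S. a M * M $$ (i, k))"
      and R: "R \<in> carrier_mat d d" "\<And>i k. i < d \<Longrightarrow> k < d \<Longrightarrow> R $$ (i, k) = (\<Sum>M\<in>?S. a' M * M $$ (i, k))"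
      unfolding matrix_span_lincomb(1)[OF S] by blast
    have "(P * R) $$ (i, h) = (\<Sum>N\<in>?S. (\<Sum>M\<in>?S. \<Sum>M'\<in>?S. a M * a' M' * c M M' N) * N $$ (i, h))"
      if ih: "i < d" "h < d" for i h
    proof -
      have "(P * R) $$ (i, h) = (\<Sum>l<d. \<Sum>M\<in>?S. \<Sum>M'\<in>?S. a M * a' M' * (M $$ (i, l) * M' $$ (l, h)))"
        unfolding mult_mat_nth[OF P(1) R(1) ih] using ih
        by (intro sum.cong refl) (simp add: P(2) R(2) sum_product, intro sum.cong refl, simp add: mult_ac)
      also have "\<dots> = (\<Sum>M\<in>?S. \<Sum>M'\<in>?S. \<Sum>l<d. a M * a' M' * (M $$ (i, l) * M' $$ (l, h)))"
        by (subst sum.swap) (rule sum.cong[OF refl], rule sum.swap)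
      also have "\<dots> = (\<Sum>M\<in>?S. \<Sum>M'\<in>?S. \<Sum>N\<in>?S. a M * a' M' * (c M M' N * N $$ (i, h)))"
        using ih by (intro sum.cong refl) (simp add: c sum_distrib_left[symmetric])
      also have "\<dots> = (\<Sum>M\<in>?S. \<Sum>N\<in>?S. \<Sum>M'\<in>?S. a M * a' M' * (c M M' N * N $$ (i, h)))"
        by (rule sum.cong[OF refl], rule sum.swap)
      also have "\<dots> = (\<Sum>N\<in>?S. \<Sum>M\<in>?S. \<Sum>M'\<in>?S. a M * a' M' * (c M M' N * N $$ (i, h)))" by (rule sum.swap)
      finally show ?thesis by (simp add: sum_distrib_right mult.assoc)
    qed
    then show "P * R \<in> LinearCombinations.module.span class_ring (module_mat TYPE(complex) d d) ?S"
      unfolding matrix_span_lincomb(1)[OF S] using mult_carrier_mat[OF P(1) R(1)]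
      by (intro conjI exI[of _ "\<lambda>N. \<Sum>M\<in>?S. \<Sum>M'\<in>?S. a M * a' M' * c M M' N"] allI impI) auto
  qed
qed

theorem theorem1p1:
  fixes g d e :: nat
    and E B :: "complex mat list"
    and p q :: "nat \<Rightarrow> complex mat list \<Rightarrow> complex mat list"
  assumes "0 < g" and "0 < d" and "0 < e"
    and "E \<in> mtuples d g" and "B \<in> mtuples e g"
    and i: "sv_generic d g E" "lin_indep_tuple d E"
    and ii: "sv_generic e g B" "free_bounded g (free_spectrahedron e g B)"
    and iii: "free_bianalytic g (spectraball d g E) (free_spectrahedron e g B) p q"
      "\<forall>n>0. p n (tzero n g) = tzero n g"
      "\<forall>n>0. has_tuple_derivative n g g (p n) (\<lambda>H. H) (tzero n g)"
    and iv: "analytic_near g g (spectraball d g E) p"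
      "analytic_near g g (free_spectrahedron e g B) q"
  shows "d = e \<and>
    (\<exists>Z M \<Xi>. unitary_mat d Z \<and> unitary_mat d M \<and> \<Xi> \<in> mtuples g g \<and>
       (\<forall>j<g. B ! j = mat_adjoint M * Z * E ! j * M) \<and>
       (\<forall>j<g. \<forall>k<g. E ! k * Z * E ! j =
          mat_sum d d {..<g} (\<lambda>s. (\<Xi> ! j) $$ (k, s) \<cdot>\<^sub>m E ! s)) \<and>
       spans_algebra d B \<and>
       (\<forall>j<g. \<forall>k<g. B ! k * B ! j =
          mat_sum d d {..<g} (\<lambda>s. (\<Xi> ! j) $$ (k, s) \<cdot>\<^sub>m B ! s)) \<and>
       convexotonic g \<Xi> \<and>
       (\<forall>n>0. \<forall>X \<in> spectraball d g E n.
          X \<in> convexotonic_domain g \<Xi> n \<and> p n X = convexotonic_map g \<Xi> n X))"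
proof -
  have ball: "ball_map g d e E B p q"
  proof
    show "E \<in> mtuples d g" "B \<in> mtuples e g" by fact+
    show "free_map g g (spectraball d g E) p" "free_map g g (free_spectrahedron e g B) q"
      using iii(1) unfolding free_bianalytic_def by blast+
    have bij: "bij_betw (p n) (spectraball d g E n) (free_spectrahedron e g B n)"
      and qp: "\<And>X. X \<in> spectraball d g E n \<Longrightarrow> q n (p n X) = X" if "0 < n" for n
      using iii(1) that unfolding free_bianalytic_def by blast+
    show "p n X \<in> free_spectrahedron e g B n" if "0 < n" "X \<in> spectraball d g E n" for n X
      using bij[OF that(1)] that(2) unfolding bij_betw_def by blast
    show "q n (p n X) = X" if "0 < n" "X \<in> spectraball d g E n" for n X by (rule qp[OF that])
    show "q n Y \<in> spectraball d g E n" if n: "0 < n" and Y: "Y \<in> free_spectrahedron e g B n" for n Y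
    proof -
      obtain X where "X \<in> spectraball d g E n" "Y = p n X"
        using bij[OF n] Y unfolding bij_betw_def by blast
      then show ?thesis using qp[OF n] by simp
    qed
    show "p n (tzero n g) = tzero n g" if "0 < n" for n using iii(2) that by blast
    show "has_tuple_derivative n g g (p n) (\<lambda>H. H) (tzero n g)" if "0 < n" for n using iii(3) that by blast
  qed
  interpret ball_map g d e E B p q by (rule ball)
  obtain \<alpha> u where gE: "gen_data g d (cf E) \<alpha> u" by (rule sv_generic_gen_data[OF E i(1)])
  obtain \<alpha>' u' where gB: "gen_data g e (cf B) \<alpha>' u'" by (rule sv_generic_gen_data[OF B ii(1)])
  obtain W V where de: "d \<le> e" and isoW: "\<And>y z. ip e (mv d W y) (mv d W z) = ip d y z"
    and isoV: "\<And>y z. ip e (mv d V y) (mv d V z) = ip d y z"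
    and WV: "\<And>j y i. j < g \<Longrightarrow> i < e \<Longrightarrow> mv e (cf B j) (mv d V y) i = mv d W (mv d (cf E j) y) i"
  proof (rule gen_data_equivalence[OF gE gB fball_eq[OF _ finite_atMost]], goal_cases)
    case (2 W V)
    show ?case by (rule 2(1)[OF 2(2-5)])
  qed
  \<comment> \<open>The same construction with the roles of \<open>E\<close> and \<open>B\<close>
    exchanged.\<close>
  have "e \<le> d"
    by (rule gen_data_equivalence[OF gB gE fball_eq[OF _ finite_atMost, symmetric]])
  then have ed: "e = d" using de by simp
  define Wm where "Wm = Matrix.mat d d (\<lambda>(i, k). W i k)"
  define Vm where "Vm = Matrix.mat d d (\<lambda>(i, k). V i k)"
  have uW: "unitary_mat d Wm" unfolding Wm_def by (rule unitary_mat_isometry) (use isoW ed in simp)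
  have uV: "unitary_mat d Vm" unfolding Vm_def by (rule unitary_mat_isometry) (use isoV ed in simp)
  have Wc: "Wm \<in> carrier_mat d d" and Vc: "Vm \<in> carrier_mat d d" unfolding Wm_def Vm_def by auto
  have Wac: "mat_adjoint Wm \<in> carrier_mat d d" and Vac: "mat_adjoint Vm \<in> carrier_mat d d" using Wc Vc by auto
  have Ec: "E ! j \<in> carrier_mat d d" and Bc: "B ! j \<in> carrier_mat d d" if "j < g" for j
    using mtuples_nth[OF E that] mtuples_nth[OF B that] ed by auto
  note mc = mult_carrier_mat[of _ d d _ d]
  note as = assoc_mult_mat[of _ d d _ d _ d]
  have BV: "B ! j * Vm = Wm * E ! j" if j: "j < g" for j
  proof (rule eq_matI)
    have c: "B ! j * Vm \<in> carrier_mat d d" "Wm * E ! j \<in> carrier_mat d d"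
      using mc[OF Bc[OF j] Vc] mc[OF Wc Ec[OF j]] by auto
    show "dim_row (B ! j * Vm) = dim_row (Wm * E ! j)" "dim_col (B ! j * Vm) = dim_col (Wm * E ! j)"
      unfolding carrier_matD[OF c(1)] carrier_matD[OF c(2)] by simp_all
    fix i k assume "i < dim_row (Wm * E ! j)" "k < dim_col (Wm * E ! j)"
    then have ik: "i < d" "k < d" unfolding carrier_matD[OF c(2)] by auto
    have unit: "mv d M (\<lambda>h. if h = k then 1 else 0) = (\<lambda>i. M i k)" for M
      using ik unfolding mv_def by (simp add: if_distrib cong: if_cong)
    have "(B ! j * Vm) $$ (i, k) = (\<Sum>m<d. B ! j $$ (i, m) * V m k)"
      unfolding mult_mat_nth[OF Bc[OF j] Vc ik] using ik by (simp add: Vm_def)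
    also have "\<dots> = (\<Sum>m<d. W i m * E ! j $$ (m, k))"
      using WV[OF j, of i "\<lambda>h. if h = k then 1 else 0"] ik ed unfolding unit by (simp add: mv_def)
    also have "\<dots> = (Wm * E ! j) $$ (i, k)"
      unfolding mult_mat_nth[OF Wc Ec[OF j] ik] using ik by (simp add: Wm_def)
    finally show "(B ! j * Vm) $$ (i, k) = (Wm * E ! j) $$ (i, k)" .
  qed
  have Beq: "B ! j = Wm * E ! j * mat_adjoint Vm" if j: "j < g" for j
  proof -
    have "Wm * E ! j * mat_adjoint Vm = B ! j * (Vm * mat_adjoint Vm)"
      unfolding BV[OF j, symmetric] by (rule as[OF Bc[OF j] Vc Vac])
    then show ?thesis using uV Bc[OF j] unfolding unitary_mat_def by simp
  qed
  have Eeq: "E ! j = mat_adjoint Wm * (B ! j * Vm)" if j: "j < g" for j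
  proof -
    have "mat_adjoint Wm * (Wm * E ! j) = (mat_adjoint Wm * Wm) * E ! j" by (rule as[OF Wac Wc Ec[OF j], symmetric])
    then show ?thesis unfolding BV[OF j] using uW Ec[OF j] unfolding unitary_mat_def by simp
  qed
  \<comment> \<open>\<open>E_j\<close> is \<open>B_j\<close> between two fixed unitary matrices, so
    a relation between the \<open>B_j\<close> is one between the \<open>E_j\<close>.\<close>
  have indep: "\<forall>c. (\<forall>i<e. \<forall>k<e. (\<Sum>j<g. c j * cf B j i k) = 0) \<longrightarrow> (\<forall>j<g. c j = 0)"
  proof (intro allI impI)
    fix c j assume z: "\<forall>i<e. \<forall>k<e. (\<Sum>j<g. c j * cf B j i k) = 0" and j: "j < g"
    have "(\<Sum>j<g. c j * E ! j $$ (i, k)) = 0" if ik: "i < d" "k < d" for i k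
    proof -
      have "(\<Sum>j<g. c j * E ! j $$ (i, k)) = mat_sum d d {..<g} (\<lambda>j. c j \<cdot>\<^sub>m E ! j) $$ (i, k)"
        using ik carrier_matD[OF Ec] by (simp add: mat_sum_nth)
      also have "mat_sum d d {..<g} (\<lambda>j. c j \<cdot>\<^sub>m E ! j) = mat_adjoint Wm * (mat_sum d d {..<g} (\<lambda>j. c j \<cdot>\<^sub>m B ! j) * Vm)"
      proof -
        have "c j \<cdot>\<^sub>m E ! j = mat_adjoint Wm * (c j \<cdot>\<^sub>m B ! j * Vm)" if "j < g" for j
          using Eeq[OF that] mult_smult_distrib[OF Wac mc[OF Bc[OF that] Vc], of "c j"] mult_smult_assoc_mat[OF Bc[OF that] Vc, of "c j"] by simp
        then have "mat_sum d d {..<g} (\<lambda>j. c j \<cdot>\<^sub>m E ! j) = mat_sum d d {..<g} (\<lambda>j. mat_adjoint Wm * (c j \<cdot>\<^sub>m B ! j * Vm))"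
          unfolding mat_sum_def by (intro cong_mat) (auto intro!: sum.cong)
        also have "\<dots> = mat_adjoint Wm * (mat_sum d d {..<g} (\<lambda>j. c j \<cdot>\<^sub>m B ! j) * Vm)"
          by (subst mult_mat_sum(2)[OF Vc], use Bc in force, subst mult_mat_sum(1)[OF Wac], use mc[OF _ Vc] Bc in force, rule refl)
        finally show ?thesis .
      qed
      also have "mat_sum d d {..<g} (\<lambda>j. c j \<cdot>\<^sub>m B ! j) = 0\<^sub>m d d"
        using z carrier_matD[OF Bc] ed by (intro eq_matI) (auto simp: mat_sum_def)
      finally show ?thesis using ik Vc Wac by simp
    qed
    then show "c j = 0" by (rule lin_indep_tuple_coeffs[OF E i(2) _ j])
  qed
  define \<xi> where "\<xi> k j = (SOME \<xi>. \<forall>i<e. \<forall>h<e. (\<Sum>l<e. cf B k i l * cf B j l h) = (\<Sum>s<g. \<xi> s * cf B s i h))" for k j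
  have \<xi>: "(\<Sum>l<e. cf B k i l * cf B j l h) = (\<Sum>s<g. \<xi> k j s * cf B s i h)"
    if "k < g" "j < g" "i < e" "h < e" for k j i h
  proof -
    have "\<exists>\<xi>. \<forall>i<e. \<forall>h<e. (\<Sum>l<e. cf B k i l * cf B j l h) = (\<Sum>s<g. \<xi> s * cf B s i h)"
      by (rule structure_constants[OF gB iv(1) that(1,2)])
    from someI_ex[OF this, folded \<xi>_def] that(3,4) show ?thesis by blast
  qed
  define \<Xi> where "\<Xi> = map (\<lambda>j. Matrix.mat g g (\<lambda>(k, s). \<xi> k j s)) [0..<g]"
  have \<Xi>m: "\<Xi> \<in> mtuples g g" unfolding \<Xi>_def mtuples_def by auto
  have \<Xi>n: "\<Xi> ! j $$ (k, s) = \<xi> k j s" if "j < g" "k < g" "s < g" for j k s using that unfolding \<Xi>_def by simp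
  have prod: "(\<Sum>l<e. cf B k i l * cf B j l h) = (\<Sum>s<g. \<Xi> ! j $$ (k, s) * cf B s i h)"
    if "k < g" "j < g" "i < e" "h < e" for k j i h using \<xi>[OF that] that by (simp add: \<Xi>n)
  have BB: "B ! k * B ! j = mat_sum d d {..<g} (\<lambda>s. \<Xi> ! j $$ (k, s) \<cdot>\<^sub>m B ! s)" if kj: "k < g" "j < g" for k j
  proof (rule eq_matI)
    show "dim_row (B ! k * B ! j) = dim_row (mat_sum d d {..<g} (\<lambda>s. \<Xi> ! j $$ (k, s) \<cdot>\<^sub>m B ! s))"
      "dim_col (B ! k * B ! j) = dim_col (mat_sum d d {..<g} (\<lambda>s. \<Xi> ! j $$ (k, s) \<cdot>\<^sub>m B ! s))"
      using Bc[OF kj(1)] Bc[OF kj(2)] unfolding mat_sum_def by auto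
    fix i h assume "i < dim_row (mat_sum d d {..<g} (\<lambda>s. \<Xi> ! j $$ (k, s) \<cdot>\<^sub>m B ! s))"
      "h < dim_col (mat_sum d d {..<g} (\<lambda>s. \<Xi> ! j $$ (k, s) \<cdot>\<^sub>m B ! s))"
    then have ih: "i < d" "h < d" unfolding mat_sum_def by auto
    show "(B ! k * B ! j) $$ (i, h) = mat_sum d d {..<g} (\<lambda>s. \<Xi> ! j $$ (k, s) \<cdot>\<^sub>m B ! s) $$ (i, h)"
      unfolding mult_mat_nth[OF Bc[OF kj(1)] Bc[OF kj(2)] ih] mat_sum_nth[OF ih]
      using prod[OF kj, of i h] ih ed carrier_matD[OF Bc] by simp
  qed
  \<comment> \<open>From \<open>B_j = Wm * E_j * mat_adjoint Vm\<close>: the right factor gives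
    \<open>M\<close>, and \<open>Z\<close> is determined by
    \<open>mat_adjoint M * Z = Wm\<close>.\<close>
  define M where "M = mat_adjoint Vm"
  define Z where "Z = mat_adjoint Vm * Wm"
  have uM: "unitary_mat d M" unfolding M_def by (rule unitary_mat_adjoint[OF uV])
  have uZ: "unitary_mat d Z" unfolding Z_def by (rule unitary_mat_mult[OF unitary_mat_adjoint[OF uV] uW])
  have Zc: "Z \<in> carrier_mat d d" using uZ unfolding unitary_mat_def by simp
  have MZ: "mat_adjoint M * Z = Wm"
  proof -
    have "mat_adjoint M * Z = (Vm * mat_adjoint Vm) * Wm"
      unfolding M_def Z_def mat_adjoint_adjoint[OF Vc] by (rule as[OF Vc Vac Wc, symmetric])
    then show ?thesis using uV Wc unfolding unitary_mat_def by simp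
  qed
  \<comment> \<open>The unitary factors in the middle cancel, leaving
    \<open>mat_adjoint Wm * (B_k * B_j) * Vm\<close>, to which the product formula for
    \<open>B\<close> applies.\<close>
  have EZE: "E ! k * Z * E ! j = mat_sum d d {..<g} (\<lambda>s. \<Xi> ! j $$ (k, s) \<cdot>\<^sub>m E ! s)" if kj: "k < g" "j < g" for k j
  proof -
    have "Z * E ! j = mat_adjoint Vm * (B ! j * Vm)"
      unfolding Z_def BV[OF kj(2)] by (rule as[OF Vac Wc Ec[OF kj(2)]])
    then have "E ! k * Z * E ! j = mat_adjoint Wm * (B ! k * Vm) * (mat_adjoint Vm * (B ! j * Vm))"
      using as[OF Ec[OF kj(1)] Zc Ec[OF kj(2)]] Eeq[OF kj(1)] by simp
    also have "\<dots> = mat_adjoint Wm * ((B ! k * Vm) * (mat_adjoint Vm * (B ! j * Vm)))"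
      by (rule as[OF Wac mc[OF Bc[OF kj(1)] Vc] mc[OF Vac mc[OF Bc[OF kj(2)] Vc]]])
    also have "(B ! k * Vm) * (mat_adjoint Vm * (B ! j * Vm)) = B ! k * (Vm * (mat_adjoint Vm * (B ! j * Vm)))"
      by (rule as[OF Bc[OF kj(1)] Vc mc[OF Vac mc[OF Bc[OF kj(2)] Vc]]])
    also have "Vm * (mat_adjoint Vm * (B ! j * Vm)) = (Vm * mat_adjoint Vm) * (B ! j * Vm)"
      by (rule as[OF Vc Vac mc[OF Bc[OF kj(2)] Vc], symmetric])
    also have "\<dots> = B ! j * Vm" using uV left_mult_one_mat[OF mc[OF Bc[OF kj(2)] Vc]] unfolding unitary_mat_def by simp
    also have "B ! k * (B ! j * Vm) = (B ! k * B ! j) * Vm" by (rule as[OF Bc[OF kj(1)] Bc[OF kj(2)] Vc, symmetric])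
    also have "\<dots> = mat_sum d d {..<g} (\<lambda>s. \<Xi> ! j $$ (k, s) \<cdot>\<^sub>m B ! s * Vm)"
      unfolding BB[OF kj] by (rule mult_mat_sum(2)[OF Vc]) (use Bc in force)
    also have "mat_adjoint Wm * \<dots> = mat_sum d d {..<g} (\<lambda>s. mat_adjoint Wm * (\<Xi> ! j $$ (k, s) \<cdot>\<^sub>m B ! s * Vm))"
      by (rule mult_mat_sum(1)[OF Wac]) (use mc[OF _ Vc] Bc in force)
    also have "\<dots> = mat_sum d d {..<g} (\<lambda>s. \<Xi> ! j $$ (k, s) \<cdot>\<^sub>m E ! s)"
    proof -
      have "mat_adjoint Wm * (r \<cdot>\<^sub>m B ! s * Vm) = r \<cdot>\<^sub>m E ! s" if "s < g" for r s
        using Eeq[OF that] mult_smult_distrib[OF Wac mc[OF Bc[OF that] Vc], of r] mult_smult_assoc_mat[OF Bc[OF that] Vc, of r] by simp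
      then show ?thesis unfolding mat_sum_def by (intro cong_mat) (auto intro!: sum.cong)
    qed
    finally show ?thesis .
  qed
  have conv: "convexotonic g \<Xi>"
    unfolding convexotonic_def
  proof (intro conjI allI impI \<Xi>m)
    fix j k assume jk: "j < g" "k < g"
    have \<Xi>c: "\<Xi> ! s \<in> carrier_mat g g" if "s < g" for s using mtuples_nth[OF \<Xi>m that] .
    show "\<Xi> ! k * \<Xi> ! j = mat_sum g g {..<g} (\<lambda>s. \<Xi> ! j $$ (k, s) \<cdot>\<^sub>m \<Xi> ! s)"
    proof (rule eq_matI)
      show "dim_row (\<Xi> ! k * \<Xi> ! j) = dim_row (mat_sum g g {..<g} (\<lambda>s. \<Xi> ! j $$ (k, s) \<cdot>\<^sub>m \<Xi> ! s))"
        "dim_col (\<Xi> ! k * \<Xi> ! j) = dim_col (mat_sum g g {..<g} (\<lambda>s. \<Xi> ! j $$ (k, s) \<cdot>\<^sub>m \<Xi> ! s))"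
        using \<Xi>c[OF jk(1)] \<Xi>c[OF jk(2)] unfolding mat_sum_def by auto
      fix r t assume "r < dim_row (mat_sum g g {..<g} (\<lambda>s. \<Xi> ! j $$ (k, s) \<cdot>\<^sub>m \<Xi> ! s))"
        "t < dim_col (mat_sum g g {..<g} (\<lambda>s. \<Xi> ! j $$ (k, s) \<cdot>\<^sub>m \<Xi> ! s))"
      then have rt: "r < g" "t < g" unfolding mat_sum_def by auto
      \<comment> \<open>The coefficients of \<open>(B_r B_k) B_j - B_r (B_k B_j)\<close>. By
        associativity and independence of the \<open>B_t\<close> they vanish, and this is the
        convexotonic identity entry by entry.\<close>
      let ?c = "\<lambda>t. (\<Sum>s<g. \<xi> r k s * \<xi> s j t) - (\<Sum>s<g. \<xi> k j s * \<xi> r s t)"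
      have "(\<Sum>t<g. ?c t * cf B t i h) = 0" if ih: "i < e" "h < e" for i h
      proof -
        have "(\<Sum>t<g. (\<Sum>s<g. \<xi> r k s * \<xi> s j t) * cf B t i h) = (\<Sum>s<g. \<xi> r k s * (\<Sum>t<g. \<xi> s j t * cf B t i h))"
          unfolding sum_distrib_left sum_distrib_right by (subst sum.swap) (simp add: mult.assoc)
        also have "\<dots> = (\<Sum>s<g. \<xi> r k s * (\<Sum>l<e. cf B s i l * cf B j l h))"
          using ih jk by (intro sum.cong refl) (simp add: \<xi>)
        also have "\<dots> = (\<Sum>l<e. (\<Sum>s<g. \<xi> r k s * cf B s i l) * cf B j l h)"
          unfolding sum_distrib_left sum_distrib_right by (subst sum.swap) (simp add: mult.assoc)
        also have "\<dots> = (\<Sum>l<e. (\<Sum>m<e. cf B r i m * cf B k m l) * cf B j l h)"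
          using ih jk rt by (intro sum.cong refl) (simp add: \<xi>)
        also have "\<dots> = (\<Sum>m<e. cf B r i m * (\<Sum>l<e. cf B k m l * cf B j l h))"
          unfolding sum_distrib_left sum_distrib_right by (subst sum.swap) (simp add: mult.assoc)
        also have "\<dots> = (\<Sum>m<e. cf B r i m * (\<Sum>s<g. \<xi> k j s * cf B s m h))"
          using ih jk by (intro sum.cong refl) (simp add: \<xi>)
        also have "\<dots> = (\<Sum>s<g. \<xi> k j s * (\<Sum>m<e. cf B r i m * cf B s m h))"
          unfolding sum_distrib_left by (subst sum.swap) (simp add: mult.left_commute)
        also have "\<dots> = (\<Sum>s<g. \<xi> k j s * (\<Sum>t<g. \<xi> r s t * cf B t i h))"
          using ih rt by (intro sum.cong refl) (simp add: \<xi>)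
        also have "\<dots> = (\<Sum>t<g. (\<Sum>s<g. \<xi> k j s * \<xi> r s t) * cf B t i h)"
          unfolding sum_distrib_left sum_distrib_right by (subst sum.swap) (simp add: mult.assoc)
        finally show ?thesis by (simp add: left_diff_distrib sum_subtractf)
      qed
      then have "?c t = 0" using indep[THEN spec, of ?c] rt(2) by blast
      then show "(\<Xi> ! k * \<Xi> ! j) $$ (r, t) = mat_sum g g {..<g} (\<lambda>s. \<Xi> ! j $$ (k, s) \<cdot>\<^sub>m \<Xi> ! s) $$ (r, t)"
        unfolding mult_mat_nth[OF \<Xi>c[OF jk(2)] \<Xi>c[OF jk(1)] rt] mat_sum_nth[OF rt]
        using rt jk carrier_matD[OF \<Xi>c] by (simp add: \<Xi>n)
    qed
  qed
  have alg: "spans_algebra d B" using spans_algebraI[OF B \<xi>] ed by simp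
  show ?thesis
  proof (rule conjI, rule ed[symmetric], rule exI[of _ Z], rule exI[of _ M], rule exI[of _ \<Xi>], intro conjI allI impI ballI)
    show "unitary_mat d Z" "unitary_mat d M" "\<Xi> \<in> mtuples g g" "spans_algebra d B" "convexotonic g \<Xi>" by fact+
    show "B ! j = mat_adjoint M * Z * E ! j * M" if "j < g" for j unfolding MZ unfolding M_def by (rule Beq[OF that])
    show "E ! k * Z * E ! j = mat_sum d d {..<g} (\<lambda>s. \<Xi> ! j $$ (k, s) \<cdot>\<^sub>m E ! s)" if "j < g" "k < g" for j k
      by (rule EZE[OF that(2,1)])
    show "B ! k * B ! j = mat_sum d d {..<g} (\<lambda>s. \<Xi> ! j $$ (k, s) \<cdot>\<^sub>m B ! s)" if "j < g" "k < g" for j k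
      by (rule BB[OF that(2,1)])
    fix n X assume nX: "0 < n" "X \<in> spectraball d g E n"
    show "X \<in> convexotonic_domain g \<Xi> n" "p n X = convexotonic_map g \<Xi> n X"
      using convexotonic_formula[OF gB iv(1) indep prod \<Xi>m nX] by auto
  qed
qed

end
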